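(* Let $X$, $\Gamma$, $o$ be as in the context, with $\delta(\Gamma)<\infty$. The Patterson-Sullivan construction produces a conformal density with support in a single $\Gamma$-invariant subset of the geometric limit set, and every point in its support has slope $\theta^*$. Precisely: let $h:[0,\infty)\to[1,\infty)$ be a Patterson function and let $(\mu_x^s)_{x\in X,\,s>1}$ be the associated family of measures on $\overline X$ (both defined in the context). If $(s_j)\subset(1,\infty)$ is a sequence with $s_j\searrow 1$ such that $\mu_o^{s_j}$ converges weakly to a measure $\mu_o$ on $\overline X$, then for every $x\in X$ the sequence $\mu_x^{s_j}$ converges weakly to a measure $\mu_x$, the map $x\mapsto\mu_x$ is a $\Gamma$-invariant conformal density of dimension $\delta(\Gamma)$, and $\operatorname{supp}(\mu_x)\subset L_\Gamma\cap\partial X_{\theta^*}$ for all $x\in X$.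
   Context: A Hadamard space is a complete CAT(0) geodesic metric space. Let $(X_1,d_1),\dots,(X_r,d_r)$ be locally compact Hadamard spaces and $X=X_1\times\cdots\times X_r$ with $d=\sqrt{d_1^2+\cdots+d_r^2}$, which is again a locally compact Hadamard space. $\partial X$ is the geometric boundary (classes of asymptotic geodesic rays, with the cone topology) and $\overline X=X\cup\partial X$ is the geometric compactification. A geodesic line in a Hadamard space is rank one if it does not bound a flat half-plane. An isometry $h$ of a Hadamard space is axial if there are $l(h)>0$ and a geodesic line $\sigma$ (an axis) with $h(\sigma(t))=\sigma(t+l(h))$ for all $t$; $\mathrm{Ax}(h)$ is the set of points $x$ with $d(x,hx)=l(h)$. An axial isometry is rank one if it has a rank one axis; two rank one isometries are independent if their fixed point sets are disjoint. $\Gamma<\mathrm{Is}(X_1)\times\cdots\times\mathrm{Is}(X_r)$ is a group acting properly discontinuously by isometries on $X$ and containing two elements $h=(h_1,\dots,h_r)$, $g=(g_1,\dots,g_r)$ such that for every $i$ the isometries $g_i$ and $h_i$ of $X_i$ are independent rank one isometries (this $h$ is unrelated to the Patterson function below). The base point $o=(o_1,\dots,o_r)\in\mathrm{Ax}(h)$ is fixed. The geometric limit set is $L_\Gamma=\overline{\Gamma\cdot x}\cap\partial X$ ($x\in X$ arbitrary). Slopes: $E=\{\theta\in\mathbb R^r_{\ge0}:\|\theta\|=1\}$. Every geodesic ray $\sigma$ in $X$ can be written $\sigma(t)=(\sigma_1(t\theta_1),\dots,\sigma_r(t\theta_r))$ with $\theta\in E$ and unit speed geodesic rays $\sigma_i$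 in $X_i$ (for $\theta_i=0$ the $i$-th component is constant). $\theta$ is the slope of $\sigma$ and depends only on the class of $\sigma$ in $\partial X$. $\partial X_\theta$ is the set of points of $\partial X$ of slope $\theta$. Exponents: $\delta(\Gamma)=\inf\{s>0:\sum_{\gamma\in\Gamma}e^{-s\,d(o,\gamma o)}\text{ converges}\}$ is the critical exponent. For $\theta\in E$, $\varepsilon>0$ let $N_\theta^\varepsilon(n)$ be the number of $\gamma=(\gamma_1,\dots,\gamma_r)\in\Gamma$ with $0<d(o,\gamma o)<n$ and $\left|\frac{d_i(o_i,\gamma_io_i)}{d(o,\gamma o)}-\theta_i\right|<\varepsilon$ for all $i$; the exponent of growth of slope $\theta$ is $\delta_\theta(\Gamma)=\lim_{\varepsilon\to0}\limsup_{n\to\infty}\frac{\ln N_\theta^\varepsilon(n)}{n}$. It is known that there is a unique $\theta^*\in E$ at which $\theta\mapsto\delta_\theta(\Gamma)$ is maximal, and $\delta_{\theta^*}(\Gamma)=\delta(\Gamma)$. Busemann function: $\beta_{\tilde\eta}(x,y)=\lim_{s\to\infty}(d(x,\sigma(s))-d(y,\sigma(s)))$ for any geodesic ray $\sigma$ in the class $\tilde\eta\in\partial X$. A $\Gamma$-invariant conformal density of dimension $\delta\ge0$ is a map $\mu$, $x\mapsto\mu_x$, from $X$ to the positive finite Borel measures on $\partial X$ with $\operatorname{supp}(\mu_o)\subset L_\Gamma$, $\gamma_*\mu_x=\mu_{\gamma x}$ for all $\gamma\in\Gamma$, $x\in X$ (where $\gamma_*\mu_x(A)=\mu_x(\gamma^{-1}A)$),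 and $\frac{d\mu_x}{d\mu_o}(\tilde\eta)=e^{\delta\beta_{\tilde\eta}(o,x)}$ for all $\tilde\eta\in\operatorname{supp}(\mu_o)$, $x\in X$. Patterson-Sullivan construction: put $b(x,z)=\delta(\Gamma)d(x,z)$ and $b_\gamma=b(o,\gamma o)$. A Patterson function is a non-decreasing continuous function $h:[0,\infty)\to[1,\infty)$ such that (i) $\sum_{\gamma\in\Gamma}e^{-sb_\gamma}h(e^{b_\gamma})$ converges for $s>1$ and diverges for $s\le1$; (ii) for every $\alpha>0$ there is $r_0>0$ such that $h(rt)\le t^\alpha h(r)$ for all $r\ge r_0$, $t>1$. (Such $h$ exists by Patterson's lemma.) For $s>1$, $x\in X$ put $$P^s=\sum_{\gamma\in\Gamma}e^{-sb_\gamma}h(e^{b_\gamma}),\qquad \mu_x^s=\frac1{P^s}\sum_{\gamma\in\Gamma}e^{-sb(x,\gamma o)}h(e^{b(x,\gamma o)})D(\gamma o),$$ where $D(z)$ is the unit Dirac measure at $z$. *)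

theory Defs
  imports "HOL-Analysis.Analysis" "HOL-Algebra.Bij" "HOL-Algebra.Product_Groups"
begin

section \<open>Hadamard spaces\<close>

definition geodesic_segment :: "'b metric \<Rightarrow> (real \<Rightarrow> 'b) \<Rightarrow> 'b \<Rightarrow> 'b \<Rightarrow> bool" where
  "geodesic_segment m c x y \<longleftrightarrow>
     c ` {0..mdist m x y} \<subseteq> mspace m \<and> c 0 = x \<and> c (mdist m x y) = y \<and>
     (\<forall>s\<in>{0..mdist m x y}. \<forall>t\<in>{0..mdist m x y}. mdist m (c s) (c t) = \<bar>s - t\<bar>)"

definition geodesic_space :: "'b metric \<Rightarrow> bool" where
  "geodesic_space m \<longleftrightarrow> (\<forall>x\<in>mspace m. \<forall>y\<in>mspace m. \<exists>c. geodesic_segment m c x y)"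

text \<open>The CAT(0) inequality: geodesic triangles are not thicker than their comparison triangles in
  the Euclidean plane (here the type \<^typ>\<open>complex\<close>). Two points on the boundary of a triangle
  always lie on two sides with a common vertex \<open>x\<close> (possibly on the same side), so it is enough to
  let \<open>x\<close>, \<open>y\<close>, \<open>z\<close> and the two sides issuing from \<open>x\<close> vary.\<close>

definition CAT0 :: "'b metric \<Rightarrow> bool" where
  "CAT0 m \<longleftrightarrow> geodesic_space m \<and>
     (\<forall>x\<in>mspace m. \<forall>y\<in>mspace m. \<forall>z\<in>mspace m. \<forall>c c'.
        geodesic_segment m c x y \<longrightarrow> geodesic_segment m c' x z \<longrightarrow>
        (\<forall>x' y' z' :: complex.
           dist x' y' = mdist m x y \<and> dist x' z' = mdist m x z \<and> dist y' z' = mdist m y z \<longrightarrow>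
           (\<forall>s\<in>{0..mdist m x y}. \<forall>t\<in>{0..mdist m x z}.
              \<forall>p'\<in>closed_segment x' y'. \<forall>q'\<in>closed_segment x' z'.
                dist x' p' = s \<and> dist x' q' = t \<longrightarrow> mdist m (c s) (c' t) \<le> dist p' q')))"

definition Hadamard_space :: "'b metric \<Rightarrow> bool" where
  "Hadamard_space m \<longleftrightarrow> CAT0 m \<and> mcomplete_of m"

section \<open>Geometric boundary and cone topology\<close>

text \<open>Rays are parametrised by \<open>[0,\<infinity>)\<close>; their values at negative arguments are irrelevant, and
  asymptote classes contain all such variants.\<close>

definition geodesic_ray :: "'b metric \<Rightarrow> (real \<Rightarrow> 'b) \<Rightarrow> bool" where
  "geodesic_ray m \<sigma> \<longleftrightarrow> \<sigma> ` {0..} \<subseteq> mspace m \<and> (\<forall>s\<ge>0. \<forall>t\<ge>0. mdist m (\<sigma> s) (\<sigma> t) = \<bar>s - t\<bar>)"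

definition asymptotic :: "'b metric \<Rightarrow> ((real \<Rightarrow> 'b) \<times> (real \<Rightarrow> 'b)) set" where
  "asymptotic m = {(\<sigma>, \<tau>). geodesic_ray m \<sigma> \<and> geodesic_ray m \<tau> \<and>
                      (\<exists>K. \<forall>t\<ge>0. mdist m (\<sigma> t) (\<tau> t) \<le> K)}"

text \<open>A point of the geometric compactification is \<open>Inl x\<close> with \<open>x\<close> in the space, or \<open>Inr \<xi>\<close> with
  \<open>\<xi>\<close> an asymptote class of rays.\<close>

type_synonym 'b bordpt = "'b + (real \<Rightarrow> 'b) set"

definition geom_boundary :: "'b metric \<Rightarrow> 'b bordpt set" where
  "geom_boundary m = Inr ` (Collect (geodesic_ray m) // asymptotic m)"

definition bordification :: "'b metric \<Rightarrow> 'b bordpt set" where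
  "bordification m = Inl ` mspace m \<union> geom_boundary m"

text \<open>The basic neighbourhood \<open>U(c,R,\<epsilon>)\<close> of the end point of the ray \<open>c\<close>: all points outside the
  closed ball of radius \<open>R\<close> about \<open>c 0\<close> whose projection to this ball is \<open>\<epsilon>\<close>-close to \<open>c R\<close>.\<close>

definition cone_nbhd :: "'b metric \<Rightarrow> (real \<Rightarrow> 'b) \<Rightarrow> real \<Rightarrow> real \<Rightarrow> 'b bordpt set" where
  "cone_nbhd m c R \<epsilon> =
     {Inl x | x. x \<in> mspace m \<and> mdist m (c 0) x > R \<and>
        (\<exists>\<sigma>. geodesic_segment m \<sigma> (c 0) x \<and> mdist m (\<sigma> R) (c R) < \<epsilon>)} \<union>
     {Inr \<xi> | \<xi>. Inr \<xi> \<in> geom_boundary m \<and>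
        (\<exists>\<sigma>\<in>\<xi>. \<sigma> 0 = c 0 \<and> mdist m (\<sigma> R) (c R) < \<epsilon>)}"

definition cone_topology :: "'b metric \<Rightarrow> 'b bordpt topology" where
  "cone_topology m = topology_generated_by
     ({Inl ` mball_of m x r | x r. x \<in> mspace m \<and> r > 0} \<union>
      {cone_nbhd m c R \<epsilon> | c R \<epsilon>. geodesic_ray m c \<and> R > 0 \<and> \<epsilon> > 0})"

definition boundary_topology :: "'b metric \<Rightarrow> 'b bordpt topology" where
  "boundary_topology m = subtopology (cone_topology m) (geom_boundary m)"

text \<open>The Busemann function of a class does not depend on the ray chosen in that class.\<close>

definition busemann :: "'b metric \<Rightarrow> 'b bordpt \<Rightarrow> 'b \<Rightarrow> 'b \<Rightarrow> real" where
  "busemann m \<eta> x y =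
     (let \<sigma> = (SOME \<sigma>. \<sigma> \<in> projr \<eta>) in Lim at_top (\<lambda>s. mdist m x (\<sigma> s) - mdist m y (\<sigma> s)))"

section \<open>Isometries\<close>

definition isometry_group :: "'b metric \<Rightarrow> ('b \<Rightarrow> 'b) monoid" where
  "isometry_group m = BijGroup (mspace m)
     \<lparr>carrier := {f \<in> Bij (mspace m).
        \<forall>x\<in>mspace m. \<forall>y\<in>mspace m. mdist m (f x) (f y) = mdist m x y}\<rparr>"

fun bord_act :: "'b metric \<Rightarrow> ('b \<Rightarrow> 'b) \<Rightarrow> 'b bordpt \<Rightarrow> 'b bordpt" where
  "bord_act m f (Inl x) = Inl (f x)"
| "bord_act m f (Inr \<xi>) = Inr (asymptotic m `` ((\<lambda>\<sigma>. f \<circ> \<sigma>) ` \<xi>))"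

definition fixed_points :: "'b metric \<Rightarrow> ('b \<Rightarrow> 'b) \<Rightarrow> 'b bordpt set" where
  "fixed_points m f = {\<xi> \<in> bordification m. bord_act m f \<xi> = \<xi>}"

definition geodesic_line :: "'b metric \<Rightarrow> (real \<Rightarrow> 'b) \<Rightarrow> bool" where
  "geodesic_line m \<sigma> \<longleftrightarrow> range \<sigma> \<subseteq> mspace m \<and> (\<forall>s t. mdist m (\<sigma> s) (\<sigma> t) = \<bar>s - t\<bar>)"

text \<open>The metric of the product type \<^typ>\<open>real \<times> real\<close> is the Euclidean one.\<close>

definition bounds_flat_half_plane :: "'b metric \<Rightarrow> (real \<Rightarrow> 'b) \<Rightarrow> bool" where
  "bounds_flat_half_plane m \<sigma> \<longleftrightarrow>
     (\<exists>\<phi> :: real \<times> real \<Rightarrow> 'b. \<phi> ` (UNIV \<times> {0..}) \<subseteq> mspace m \<and>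
        (\<forall>u\<in>UNIV \<times> {0..}. \<forall>v\<in>UNIV \<times> {0..}. mdist m (\<phi> u) (\<phi> v) = dist u v) \<and>
        (\<forall>t. \<phi> (t, 0) = \<sigma> t))"

definition rank_one_line :: "'b metric \<Rightarrow> (real \<Rightarrow> 'b) \<Rightarrow> bool" where
  "rank_one_line m \<sigma> \<longleftrightarrow> geodesic_line m \<sigma> \<and> \<not> bounds_flat_half_plane m \<sigma>"

definition is_axis :: "'b metric \<Rightarrow> ('b \<Rightarrow> 'b) \<Rightarrow> real \<Rightarrow> (real \<Rightarrow> 'b) \<Rightarrow> bool" where
  "is_axis m f l \<sigma> \<longleftrightarrow> l > 0 \<and> geodesic_line m \<sigma> \<and> (\<forall>t. f (\<sigma> t) = \<sigma> (t + l))"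

text \<open>The translation length \<open>l\<close> of an axial isometry is the same for all of its axes.\<close>

definition Ax :: "'b metric \<Rightarrow> ('b \<Rightarrow> 'b) \<Rightarrow> 'b set" where
  "Ax m f = {x \<in> mspace m. \<exists>l \<sigma>. is_axis m f l \<sigma> \<and> mdist m x (f x) = l}"

definition rank_one_isometry :: "'b metric \<Rightarrow> ('b \<Rightarrow> 'b) \<Rightarrow> bool" where
  "rank_one_isometry m f \<longleftrightarrow> (\<exists>l \<sigma>. is_axis m f l \<sigma> \<and> rank_one_line m \<sigma>)"

definition independent_rank_one :: "'b metric \<Rightarrow> ('b \<Rightarrow> 'b) \<Rightarrow> ('b \<Rightarrow> 'b) \<Rightarrow> bool" where
  "independent_rank_one m f g \<longleftrightarrow>
     rank_one_isometry m f \<and> rank_one_isometry m g \<and> fixed_points m f \<inter> fixed_points m g = {}"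

section \<open>Products\<close>

definition product_metric :: "('r::finite \<Rightarrow> 'a metric) \<Rightarrow> ('r \<Rightarrow> 'a) metric" where
  "product_metric X = metric ({x. \<forall>i. x i \<in> mspace (X i)},
     \<lambda>x y. sqrt (\<Sum>i\<in>UNIV. (mdist (X i) (x i) (y i))\<^sup>2))"

lemma Metric_space_product:
  fixes X :: "'r::finite \<Rightarrow> 'a metric"
  shows "Metric_space {x. \<forall>i. x i \<in> mspace (X i)}
           (\<lambda>x y. sqrt (\<Sum>i\<in>UNIV. (mdist (X i) (x i) (y i))\<^sup>2))"
proof
  fix x y :: "'r \<Rightarrow> 'a"
  show "0 \<le> sqrt (\<Sum>i\<in>UNIV. (mdist (X i) (x i) (y i))\<^sup>2)"
    by (simp add: sum_nonneg)
  show "sqrt (\<Sum>i\<in>UNIV. (mdist (X i) (x i) (y i))\<^sup>2) = sqrt (\<Sum>i\<in>UNIV. (mdist (X i) (y i) (x i))\<^sup>2)"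
    by (simp add: mdist_commute)
next
  fix x y :: "'r \<Rightarrow> 'a"
  assume "x \<in> {x. \<forall>i. x i \<in> mspace (X i)}" "y \<in> {x. \<forall>i. x i \<in> mspace (X i)}"
  then show "(sqrt (\<Sum>i\<in>UNIV. (mdist (X i) (x i) (y i))\<^sup>2) = 0) = (x = y)"
    by (auto simp: sum_nonneg_eq_0_iff fun_eq_iff)
next
  fix x y z :: "'r \<Rightarrow> 'a"
  assume "x \<in> {x. \<forall>i. x i \<in> mspace (X i)}" "y \<in> {x. \<forall>i. x i \<in> mspace (X i)}"
    "z \<in> {x. \<forall>i. x i \<in> mspace (X i)}"
  then have "L2_set (\<lambda>i. mdist (X i) (x i) (z i)) UNIV
      \<le> L2_set (\<lambda>i. mdist (X i) (x i) (y i) + mdist (X i) (y i) (z i)) UNIV"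
    by (intro L2_set_mono) (auto intro: mdist_triangle)
  also have "\<dots> \<le> L2_set (\<lambda>i. mdist (X i) (x i) (y i)) UNIV + L2_set (\<lambda>i. mdist (X i) (y i) (z i)) UNIV"
    by (rule L2_set_triangle_ineq)
  finally show "sqrt (\<Sum>i\<in>UNIV. (mdist (X i) (x i) (z i))\<^sup>2)
      \<le> sqrt (\<Sum>i\<in>UNIV. (mdist (X i) (x i) (y i))\<^sup>2) + sqrt (\<Sum>i\<in>UNIV. (mdist (X i) (y i) (z i))\<^sup>2)"
    by (simp add: L2_set_def)
qed

lemma mspace_product_metric [simp]: "mspace (product_metric X) = {x. \<forall>i. x i \<in> mspace (X i)}"
  unfolding product_metric_def by (rule Metric_space.mspace_metric[OF Metric_space_product])

lemma mdist_product_metric [simp]: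
  "mdist (product_metric X) x y = sqrt (\<Sum>i\<in>UNIV. (mdist (X i) (x i) (y i))\<^sup>2)"
  unfolding product_metric_def by (simp add: Metric_space.mdist_metric[OF Metric_space_product])

definition prod_act :: "('r \<Rightarrow> 'a \<Rightarrow> 'a) \<Rightarrow> ('r \<Rightarrow> 'a) \<Rightarrow> 'r \<Rightarrow> 'a" where
  "prod_act \<gamma> x = (\<lambda>i. \<gamma> i (x i))"

definition properly_discontinuous ::
    "('r::finite \<Rightarrow> 'a metric) \<Rightarrow> ('r \<Rightarrow> 'a \<Rightarrow> 'a) set \<Rightarrow> bool" where
  "properly_discontinuous X \<Gamma> \<longleftrightarrow>
     (\<forall>K. compactin (mtopology_of (product_metric X)) K \<longrightarrow>
          finite {\<gamma> \<in> \<Gamma>. prod_act \<gamma> ` K \<inter> K \<noteq> {}})"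

definition limit_set ::
    "('r::finite \<Rightarrow> 'a metric) \<Rightarrow> ('r \<Rightarrow> 'a \<Rightarrow> 'a) set \<Rightarrow> ('r \<Rightarrow> 'a) \<Rightarrow> ('r \<Rightarrow> 'a) bordpt set" where
  "limit_set X \<Gamma> x =
     (cone_topology (product_metric X) closure_of ((\<lambda>\<gamma>. Inl (prod_act \<gamma> x)) ` \<Gamma>))
     \<inter> geom_boundary (product_metric X)"

definition slopes :: "(real ^ 'r::finite) set" where
  "slopes = {\<theta>. (\<forall>i. \<theta> $ i \<ge> 0) \<and> norm \<theta> = 1}"

definition ray_has_slope ::
    "('r::finite \<Rightarrow> 'a metric) \<Rightarrow> (real \<Rightarrow> 'r \<Rightarrow> 'a) \<Rightarrow> real ^ 'r \<Rightarrow> bool" where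
  "ray_has_slope X \<sigma> \<theta> \<longleftrightarrow> \<theta> \<in> slopes \<and>
     (\<forall>i. if \<theta> $ i = 0 then \<exists>p\<in>mspace (X i). \<forall>t\<ge>0. \<sigma> t i = p
          else \<exists>\<rho>. geodesic_ray (X i) \<rho> \<and> (\<forall>t\<ge>0. \<sigma> t i = \<rho> (t * \<theta> $ i)))"

definition boundary_of_slope ::
    "('r::finite \<Rightarrow> 'a metric) \<Rightarrow> real ^ 'r \<Rightarrow> ('r \<Rightarrow> 'a) bordpt set" where
  "boundary_of_slope X \<theta> =
     {Inr \<xi> | \<xi>. Inr \<xi> \<in> geom_boundary (product_metric X) \<and> (\<exists>\<sigma>\<in>\<xi>. ray_has_slope X \<sigma> \<theta>)}"

section \<open>Exponents\<close>

definition critical_exponent ::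
    "('r::finite \<Rightarrow> 'a metric) \<Rightarrow> ('r \<Rightarrow> 'a \<Rightarrow> 'a) set \<Rightarrow> ('r \<Rightarrow> 'a) \<Rightarrow> ereal" where
  "critical_exponent X \<Gamma> x0 = Inf (ereal ` {s. s > 0 \<and>
     (\<lambda>\<gamma>. exp (- s * mdist (product_metric X) x0 (prod_act \<gamma> x0))) summable_on \<Gamma>})"

definition slope_count ::
    "('r::finite \<Rightarrow> 'a metric) \<Rightarrow> ('r \<Rightarrow> 'a \<Rightarrow> 'a) set \<Rightarrow> ('r \<Rightarrow> 'a) \<Rightarrow> real ^ 'r \<Rightarrow> real \<Rightarrow> nat \<Rightarrow> nat"
  where
  "slope_count X \<Gamma> x0 \<theta> \<epsilon> n = card {\<gamma> \<in> \<Gamma>.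
     0 < mdist (product_metric X) x0 (prod_act \<gamma> x0) \<and>
     mdist (product_metric X) x0 (prod_act \<gamma> x0) < real n \<and>
     (\<forall>i. \<bar>mdist (X i) (x0 i) (\<gamma> i (x0 i)) / mdist (product_metric X) x0 (prod_act \<gamma> x0) - \<theta> $ i\<bar> < \<epsilon>)}"

text \<open>Extended reals are used so that \<open>ln 0\<close> is \<open>- \<infinity>\<close>; on the reals, \<^term>\<open>ln (0::real)\<close> is 0.\<close>

definition slope_exponent ::
    "('r::finite \<Rightarrow> 'a metric) \<Rightarrow> ('r \<Rightarrow> 'a \<Rightarrow> 'a) set \<Rightarrow> ('r \<Rightarrow> 'a) \<Rightarrow> real ^ 'r \<Rightarrow> ereal" where
  "slope_exponent X \<Gamma> x0 \<theta> =
     Lim (at_right 0) (\<lambda>\<epsilon>. limsup (\<lambda>n.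
       if slope_count X \<Gamma> x0 \<theta> \<epsilon> n = 0 then - \<infinity>
       else ereal (ln (real (slope_count X \<Gamma> x0 \<theta> \<epsilon> n)) / real n)))"

section \<open>Measures\<close>

definition borel_of :: "'c topology \<Rightarrow> 'c measure" where
  "borel_of T = sigma (topspace T) {U. openin T U}"

definition finite_borel_measure :: "'c topology \<Rightarrow> 'c measure \<Rightarrow> bool" where
  "finite_borel_measure T \<mu> \<longleftrightarrow> sets \<mu> = sets (borel_of T) \<and> finite_measure \<mu>"

definition msupport :: "'c topology \<Rightarrow> 'c measure \<Rightarrow> 'c set" where
  "msupport T \<mu> = {x \<in> topspace T. \<forall>U. openin T U \<and> x \<in> U \<longrightarrow> emeasure \<mu> U > 0}"

definition weakly_converges :: "'c topology \<Rightarrow> (nat \<Rightarrow> 'c measure) \<Rightarrow> 'c measure \<Rightarrow> bool" where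
  "weakly_converges T \<nu> \<mu> \<longleftrightarrow>
     (\<forall>f. continuous_map T euclideanreal f \<and> bounded (f ` topspace T) \<longrightarrow>
        (\<lambda>j. integral\<^sup>L (\<nu> j) f) \<longlonglongrightarrow> integral\<^sup>L \<mu> f)"

text \<open>Equality with a \<^const>\<open>density\<close> expresses that the Radon-Nikodym derivative with respect to
  \<open>\<mu> x0\<close> is the given function; its values off the support of \<open>\<mu> x0\<close> play no role, since the
  complement of the support is a null set.\<close>

definition conformal_density ::
    "('r::finite \<Rightarrow> 'a metric) \<Rightarrow> ('r \<Rightarrow> 'a \<Rightarrow> 'a) set \<Rightarrow> ('r \<Rightarrow> 'a) \<Rightarrow> real \<Rightarrow>
     (('r \<Rightarrow> 'a) \<Rightarrow> ('r \<Rightarrow> 'a) bordpt measure) \<Rightarrow> bool" where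
  "conformal_density X \<Gamma> x0 \<delta> \<mu> \<longleftrightarrow>
     (let Y = product_metric X; B = boundary_topology Y in
       \<delta> \<ge> 0 \<and>
       (\<forall>x\<in>mspace Y. finite_borel_measure B (\<mu> x)) \<and>
       msupport B (\<mu> x0) \<subseteq> limit_set X \<Gamma> x0 \<and>
       (\<forall>\<gamma>\<in>\<Gamma>. \<forall>x\<in>mspace Y.
          distr (\<mu> x) (borel_of B) (bord_act Y (prod_act \<gamma>)) = \<mu> (prod_act \<gamma> x)) \<and>
       (\<forall>x\<in>mspace Y.
          \<mu> x = density (\<mu> x0) (\<lambda>\<eta>. ennreal (exp (\<delta> * busemann Y \<eta> x0 x)))))"

section \<open>The Patterson-Sullivan construction\<close>

definition patterson_b ::
    "('r::finite \<Rightarrow> 'a metric) \<Rightarrow> ('r \<Rightarrow> 'a \<Rightarrow> 'a) set \<Rightarrow> ('r \<Rightarrow> 'a) \<Rightarrow> ('r \<Rightarrow> 'a) \<Rightarrow> ('r \<Rightarrow> 'a) \<Rightarrow> real"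
  where
  "patterson_b X \<Gamma> x0 x z =
     real_of_ereal (critical_exponent X \<Gamma> x0) * mdist (product_metric X) x z"

definition patterson_term ::
    "('r::finite \<Rightarrow> 'a metric) \<Rightarrow> ('r \<Rightarrow> 'a \<Rightarrow> 'a) set \<Rightarrow> ('r \<Rightarrow> 'a) \<Rightarrow> (real \<Rightarrow> real) \<Rightarrow> real \<Rightarrow>
     ('r \<Rightarrow> 'a) \<Rightarrow> ('r \<Rightarrow> 'a \<Rightarrow> 'a) \<Rightarrow> real" where
  "patterson_term X \<Gamma> x0 h s x \<gamma> =
     exp (- s * patterson_b X \<Gamma> x0 x (prod_act \<gamma> x0)) *
     h (exp (patterson_b X \<Gamma> x0 x (prod_act \<gamma> x0)))"

definition patterson_function ::
    "('r::finite \<Rightarrow> 'a metric) \<Rightarrow> ('r \<Rightarrow> 'a \<Rightarrow> 'a) set \<Rightarrow> ('r \<Rightarrow> 'a) \<Rightarrow> (real \<Rightarrow> real) \<Rightarrow> bool" where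
  "patterson_function X \<Gamma> x0 h \<longleftrightarrow>
     h ` {0..} \<subseteq> {1..} \<and> mono_on {0..} h \<and> continuous_on {0..} h \<and>
     (\<forall>s>1. patterson_term X \<Gamma> x0 h s x0 summable_on \<Gamma>) \<and>
     (\<forall>s\<le>1. \<not> patterson_term X \<Gamma> x0 h s x0 summable_on \<Gamma>) \<and>
     (\<forall>\<alpha>>0. \<exists>r0>0. \<forall>r\<ge>r0. \<forall>t>1. h (r * t) \<le> t powr \<alpha> * h r)"

text \<open>The weighted sum of Dirac measures at the orbit points is the image under the orbit map of a
  weighted counting measure on the group.\<close>

definition patterson_measure ::
    "('r::finite \<Rightarrow> 'a metric) \<Rightarrow> ('r \<Rightarrow> 'a \<Rightarrow> 'a) set \<Rightarrow> ('r \<Rightarrow> 'a) \<Rightarrow> (real \<Rightarrow> real) \<Rightarrow> real \<Rightarrow>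
     ('r \<Rightarrow> 'a) \<Rightarrow> ('r \<Rightarrow> 'a) bordpt measure" where
  "patterson_measure X \<Gamma> x0 h s x =
     distr (density (count_space \<Gamma>)
              (\<lambda>\<gamma>. ennreal (patterson_term X \<Gamma> x0 h s x \<gamma> / infsum (patterson_term X \<Gamma> x0 h s x0) \<Gamma>)))
       (borel_of (cone_topology (product_metric X))) (\<lambda>\<gamma>. Inl (prod_act \<gamma> x0))"

end

theory Submission
  imports Defs
begin

text \<open>
  Let \<open>b = x0\<close> be the base point, \<open>z \<gamma> = \<gamma> x0\<close> its orbit and \<open>\<delta>\<close> the critical exponent. Three facts
  make the theorem true.

  \<^bold>\<open>The cone topology is the topology of horofunctions.\<close> For \<open>\<xi>\<close> in the bordification let
  \<open>horo \<xi> x y\<close> be \<open>d(x,\<xi>) - d(y,\<xi>)\<close> if \<open>\<xi>\<close> is an interior point, and the Busemann function if it is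
  a boundary point. Two estimates for a geodesic from \<open>p\<close> of length \<open>L\<close>, both uniform in \<open>L\<close> and
  both consequences of the inequality of Bruhat and Tits, tie these functions to geodesics: the
  point at distance \<open>t\<close> from \<open>p\<close> determines \<open>horo \<xi> y p\<close> up to an error \<open>O(1/t)\<close>
  (\<open>far_distance_difference\<close>), and a point \<open>q\<close> with \<open>d(p,q) = t\<close> and \<open>horo \<xi> q p\<close> close to \<open>-t\<close>
  is close to the geodesic (\<open>almost_on_geodesic\<close>). The first makes all \<open>horo \<xi> y p\<close> continuous in
  \<open>\<xi>\<close> (\<open>continuous_horo\<close>). The second, together with finite nets of balls, shows that they generate
  the topology (\<open>open_contains_horo_nbhd\<close>). Countably many base points suffice, so every open set is
  the set where some continuous function is positive (\<open>open_is_cozero\<close>). Therefore finite Borel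
  measures are determined by integrals of continuous functions, and open sets whose measure tends
  to 0 are null sets of the weak limit.

  \<^bold>\<open>The conformal factor is continuous on the compactification.\<close> Replacing \<open>b\<close> by \<open>x\<close> multiplies the
  term of \<open>\<gamma>\<close> in the Patterson series by \<open>exp (\<delta> * horo (z \<gamma>) b x)\<close>, up to a factor that tends to
  1 as \<open>s\<close> tends to 1 and \<open>z \<gamma>\<close> to infinity (\<open>weight_comparison\<close>). The mass of the series tends to
  infinity, so finitely many terms do not matter, and the measures for \<open>x\<close> converge to
  \<open>\<mu> x = exp (\<delta> * horo \<xi> b x) \<mu>0\<close> (\<open>weak_convergence\<close>). Equivariance passes to the limit because
  weak limits are unique.

  \<^bold>\<open>Sparse parts of the orbit are invisible.\<close> If the series over the orbit points in an open set
  \<open>U\<close> converges at the exponent 1, then \<open>\<mu>0 U = 0\<close> (\<open>null_open\<close>). This applies to small balls, to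
  open sets without orbit points, and to cone neighbourhoods of a boundary point of slope
  \<open>\<theta> \<noteq> \<theta>s\<close>. Geodesics of the product have components of constant speed, so the orbit points in
  such a neighbourhood have a direction close to \<open>\<theta>\<close> (\<open>cone_nbhd_direction\<close>), and their number
  grows at a rate close to the exponent of \<open>\<theta>\<close>. This exponent is smaller than that of \<open>\<theta>s\<close>, which
  is at most \<open>\<delta>\<close>. As the function \<open>h\<close> grows more slowly than any power, the series over these
  points converges at the exponent 1 (\<open>weight_summable_on_sparse_part\<close>).
\<close>

section \<open>The Bruhat-Tits inequality\<close>

text \<open>Everything used about CAT(0) spaces is this inequality of Bruhat and Tits. It compares a
  triangle only with one of its vertices and the opposite side, which makes it stable under
  products, where no comparison triangle has to be constructed.\<close>

definition CN_inequality :: "'b metric \<Rightarrow> bool" where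
  "CN_inequality m \<longleftrightarrow> (\<forall>w\<in>mspace m. \<forall>y\<in>mspace m. \<forall>z\<in>mspace m. \<forall>c. geodesic_segment m c y z \<longrightarrow>
     (\<forall>l\<in>{0..1}. (mdist m w (c (l * mdist m y z)))\<^sup>2
        \<le> (1 - l) * (mdist m w y)\<^sup>2 + l * (mdist m w z)\<^sup>2 - l * (1 - l) * (mdist m y z)\<^sup>2))"

lemma CN_inequalityD:
  assumes "CN_inequality m" "w \<in> mspace m" "y \<in> mspace m" "z \<in> mspace m" "geodesic_segment m c y z"
    and "0 \<le> l" "l \<le> 1"
  shows "(mdist m w (c (l * mdist m y z)))\<^sup>2
        \<le> (1 - l) * (mdist m w y)\<^sup>2 + l * (mdist m w z)\<^sup>2 - l * (1 - l) * (mdist m y z)\<^sup>2"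
  using assms unfolding CN_inequality_def by auto

lemma geodesic_segment_props:
  assumes "geodesic_segment m c x y"
  shows "c 0 = x" "c (mdist m x y) = y" "x \<in> mspace m" "y \<in> mspace m"
    "\<And>t. 0 \<le> t \<Longrightarrow> t \<le> mdist m x y \<Longrightarrow> c t \<in> mspace m"
    "\<And>s t. 0 \<le> s \<Longrightarrow> s \<le> mdist m x y \<Longrightarrow> 0 \<le> t \<Longrightarrow> t \<le> mdist m x y \<Longrightarrow> mdist m (c s) (c t) = \<bar>s - t\<bar>"
    "\<And>t. 0 \<le> t \<Longrightarrow> t \<le> mdist m x y \<Longrightarrow> mdist m x (c t) = t"
    "\<And>t. 0 \<le> t \<Longrightarrow> t \<le> mdist m x y \<Longrightarrow> mdist m (c t) y = mdist m x y - t"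
proof -
  have p: "c ` {0..mdist m x y} \<subseteq> mspace m" "c 0 = x" "c (mdist m x y) = y"
    "\<And>s t. s\<in>{0..mdist m x y} \<Longrightarrow> t\<in>{0..mdist m x y} \<Longrightarrow> mdist m (c s) (c t) = \<bar>s - t\<bar>"
    using assms unfolding geodesic_segment_def by auto
  show "c 0 = x" "c (mdist m x y) = y" using p by auto
  show "x \<in> mspace m" "y \<in> mspace m" using p(1) p(2,3)[symmetric] by auto
  show "\<And>t. 0 \<le> t \<Longrightarrow> t \<le> mdist m x y \<Longrightarrow> c t \<in> mspace m" using p(1) by auto
  show "\<And>s t. 0 \<le> s \<Longrightarrow> s \<le> mdist m x y \<Longrightarrow> 0 \<le> t \<Longrightarrow> t \<le> mdist m x y \<Longrightarrow> mdist m (c s) (c t) = \<bar>s - t\<bar>"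
    using p(4) by auto
  show "\<And>t. 0 \<le> t \<Longrightarrow> t \<le> mdist m x y \<Longrightarrow> mdist m x (c t) = t"
    using p(4)[of 0] p(2) by auto
  show "\<And>t. 0 \<le> t \<Longrightarrow> t \<le> mdist m x y \<Longrightarrow> mdist m (c t) y = mdist m x y - t"
    using p(4)[of _ "mdist m x y"] p(3) by auto
qed

lemma geodesic_segment_reverse:
  assumes "geodesic_segment m c x y"
  shows "geodesic_segment m (\<lambda>t. c (mdist m x y - t)) y x"
proof -
  note p = geodesic_segment_props[OF assms]
  have L: "mdist m y x = mdist m x y" by (rule mdist_commute)
  show ?thesis
    unfolding geodesic_segment_def L
  proof (intro conjI ballI)
    show "(\<lambda>t. c (mdist m x y - t)) ` {0..mdist m x y} \<subseteq> mspace m" using p(5) by auto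
    show "c (mdist m x y - 0) = y" "c (mdist m x y - mdist m x y) = x" using p(1,2) by auto
  next
    fix s t assume "s \<in> {0..mdist m x y}" "t \<in> {0..mdist m x y}"
    then show "mdist m (c (mdist m x y - s)) (c (mdist m x y - t)) = \<bar>s - t\<bar>" by (simp add: p(6))
  qed
qed

text \<open>The vertex opposite to the side is one end of the second side in the CAT(0) condition, so
  the inequality is Stewart's identity in the comparison triangle. That triangle is placed with the
  side on the positive real axis.\<close>

lemma CAT0_imp_CN_inequality:
  assumes "CAT0 m"
  shows "CN_inequality m"
  unfolding CN_inequality_def
proof (intro ballI allI impI)
  fix w y z c l
  assume w: "w \<in> mspace m" and y: "y \<in> mspace m" and z: "z \<in> mspace m"
    and c: "geodesic_segment m c y z" and l: "l \<in> {0..1::real}"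
  define a b e where "a = mdist m y z" and "b = mdist m y w" and "e = mdist m z w"
  note gp = geodesic_segment_props[OF c]
  have nn: "a \<ge> 0" "b \<ge> 0" "e \<ge> 0" by (auto simp: a_def b_def e_def)
  have tri: "a \<le> b + e" "b \<le> a + e" "e \<le> a + b"
    using mdist_triangle[OF y w z] mdist_triangle[OF y z w] mdist_triangle[OF z y w]
    by (auto simp: a_def b_def e_def mdist_commute)
  show "(mdist m w (c (l * mdist m y z)))\<^sup>2
        \<le> (1 - l) * (mdist m w y)\<^sup>2 + l * (mdist m w z)\<^sup>2 - l * (1 - l) * (mdist m y z)\<^sup>2"
  proof (cases "a = 0")
    case True
    then have "y = z" using y z by (simp add: a_def)
    moreover have "mdist m z z = 0" using z by simp
    ultimately show ?thesis using gp(1) by (simp add: algebra_simps)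
  next
    case False
    then have a: "a > 0" using nn by simp
    obtain c' where c': "geodesic_segment m c' y w"
      using assms y w unfolding CAT0_def geodesic_space_def by blast
    define u where "u = (a\<^sup>2 + b\<^sup>2 - e\<^sup>2) / (2 * a)"
    have u2: "2 * a * u = a\<^sup>2 + b\<^sup>2 - e\<^sup>2" using a by (simp add: u_def)
    have "u\<^sup>2 \<le> b\<^sup>2"
    proof -
      have "(a - b)\<^sup>2 \<le> e\<^sup>2" using tri nn by (intro power2_le_iff_abs_le[THEN iffD2]) auto
      moreover have "e\<^sup>2 \<le> (a + b)\<^sup>2" using tri nn by (intro power_mono) auto
      ultimately have "2 * a * u \<le> 2 * a * b" "- (2 * a * b) \<le> 2 * a * u"
        unfolding u2 by (auto simp: power2_eq_square algebra_simps)
      then have "u \<le> b" "- b \<le> u"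
        using a mult_le_cancel_left_pos[of "2 * a" u b] mult_le_cancel_left_pos[of "2 * a" "- b" u]
        by simp_all
      then show ?thesis using nn by (intro power2_le_iff_abs_le[THEN iffD2]) auto
    qed
    define v where "v = sqrt (b\<^sup>2 - u\<^sup>2)"
    have v2: "v\<^sup>2 = b\<^sup>2 - u\<^sup>2" using \<open>u\<^sup>2 \<le> b\<^sup>2\<close> by (simp add: v_def)
    define t where "t = l * a"
    have t: "0 \<le> t" "t \<le> a" using l a by (auto simp: t_def mult_left_le_one_le)
    have dz: "dist (0::complex) (Complex a 0) = a"
      using a by (simp add: dist_norm cmod_def)
    have dw: "dist (0::complex) (Complex u v) = b"
      using v2 nn by (simp add: dist_norm cmod_def)
    have "(u - a)\<^sup>2 + v\<^sup>2 = e\<^sup>2" using v2 u2 by (simp add: power2_eq_square algebra_simps)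
    then have dzw: "dist (Complex a 0) (Complex u v) = e"
      using nn by (simp add: dist_norm cmod_def power2_commute)
    have seg: "Complex t 0 \<in> closed_segment 0 (Complex a 0)"
      unfolding in_segment using l by (intro exI[of _ l]) (auto simp: t_def complex_eq_iff)
    have "mdist m (c t) (c' b) \<le> dist (Complex t 0) (Complex u v)"
      using assms[unfolded CAT0_def, THEN conjunct2, rule_format, OF y z w c c',
          of 0 "Complex a 0" "Complex u v" t b "Complex t 0" "Complex u v"]
      using dz dw dzw seg t nn by (auto simp: a_def[symmetric] b_def[symmetric] e_def[symmetric]
          dist_norm cmod_def)
    moreover have "c' b = w" using geodesic_segment_props(2)[OF c'] by (simp add: b_def)
    ultimately have "mdist m w (c t) \<le> dist (Complex t 0) (Complex u v)"
      by (simp add: mdist_commute)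
    then have "(mdist m w (c t))\<^sup>2 \<le> (dist (Complex t 0) (Complex u v))\<^sup>2"
      by (intro power_mono) auto
    also have "\<dots> = (t - u)\<^sup>2 + v\<^sup>2"
      by (simp add: dist_norm cmod_def)
    also have "\<dots> = t\<^sup>2 - l * (2 * a * u) + b\<^sup>2"
      unfolding v2 by (simp add: t_def power2_eq_square algebra_simps)
    also have "\<dots> = (1 - l) * b\<^sup>2 + l * e\<^sup>2 - l * (1 - l) * a\<^sup>2"
      unfolding u2 by (simp add: t_def power2_eq_square algebra_simps)
    finally show ?thesis
      by (simp add: a_def b_def e_def t_def mdist_commute)
  qed
qed

text \<open>For \<open>w\<close> the point of \<open>c'\<close> at the same parameter, the right hand side is 0.\<close>

lemma geodesic_segment_unique_if_CN:
  assumes c: "geodesic_segment m c y z" and c': "geodesic_segment m c' y z"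
    and CN: "\<And>w. w \<in> mspace m \<Longrightarrow> (mdist m w (c (l * mdist m y z)))\<^sup>2
        \<le> (1 - l) * (mdist m w y)\<^sup>2 + l * (mdist m w z)\<^sup>2 - l * (1 - l) * (mdist m y z)\<^sup>2"
    and l: "0 \<le> l" "l \<le> 1"
  shows "c' (l * mdist m y z) = c (l * mdist m y z)"
proof -
  define L where "L = mdist m y z"
  have L: "0 \<le> L" by (simp add: L_def)
  have t: "0 \<le> l * L" "l * L \<le> L" using l L by (auto simp: mult_left_le_one_le)
  note p = geodesic_segment_props[OF c, folded L_def] and p' = geodesic_segment_props[OF c', folded L_def]
  have "mdist m (c' (l * L)) y = l * L" "mdist m (c' (l * L)) z = L - l * L"
    using p'(7,8) t by (auto simp: mdist_commute)
  then have "(mdist m (c' (l * L)) (c (l * L)))\<^sup>2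
     \<le> (1 - l) * (l * L)\<^sup>2 + l * (L - l * L)\<^sup>2 - l * (1 - l) * L\<^sup>2"
    using CN[folded L_def, OF p'(5), OF t] by simp
  also have "\<dots> = 0" by (simp add: power2_eq_square algebra_simps)
  finally have "mdist m (c' (l * L)) (c (l * L)) = 0" by simp
  then show ?thesis using p(5) p'(5) t by (simp add: L_def)
qed

section \<open>Proper spaces\<close>

definition balls_totally_bounded :: "'b metric \<Rightarrow> bool" where
  "balls_totally_bounded m \<longleftrightarrow> (\<forall>p\<in>mspace m. \<forall>R. Metric_space.mtotally_bounded (mspace m) (mdist m) (mcball_of m p R))"

lemma balls_totally_boundedD:
  assumes "balls_totally_bounded m" "p \<in> mspace m" "e > 0"
  obtains K where "finite K" "K \<subseteq> mspace m" "\<And>x. x \<in> mspace m \<Longrightarrow> mdist m p x \<le> R \<Longrightarrow> \<exists>k\<in>K. mdist m k x < e"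
proof -
  interpret Metric_space "mspace m" "mdist m" by (rule Metric_space_mspace_mdist)
  have "mtotally_bounded (mcball p R)"
    using assms unfolding balls_totally_bounded_def by (auto simp: mcball_of_def)
  then obtain K where "finite K" "K \<subseteq> mcball p R" "mcball p R \<subseteq> (\<Union>x\<in>K. mball x e)"
    using assms(3) unfolding mtotally_bounded_def by meson
  then show thesis using assms(2) by (intro that[of K]) (auto simp: subset_iff)
qed

text \<open>The theorem of Hopf and Rinow. The radii of totally bounded balls about a point form an
  interval. It contains its supremum because geodesics approximate a ball by smaller balls, and it
  is open because a compact ball has a compact neighbourhood.\<close>

lemma Hopf_Rinow:
  assumes geo: "geodesic_space m" and compl: "mcomplete_of m"
    and loc: "locally_compact_space (mtopology_of m)"
  shows "balls_totally_bounded m"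
  unfolding balls_totally_bounded_def
proof (intro ballI allI)
  interpret Metric_space "mspace m" "mdist m" by (rule Metric_space_mspace_mdist)
  fix p R assume p: "p \<in> mspace m"
  let ?TB = "\<lambda>r. mtotally_bounded (mcball p r)"
  have mono: "?TB r" if "?TB r'" "r \<le> r'" for r r'
    using that by (intro mtotally_bounded_subset[OF that(1)]) (auto simp: subset_iff)
  have shrink: "\<exists>y\<in>mspace m. mdist m p y \<le> r' \<and> mdist m y x \<le> r - r'"
    if "x \<in> mspace m" "mdist m p x \<le> r" "0 \<le> r'" "r' \<le> r" for x r r'
  proof (cases "mdist m p x \<le> r'")
    case True then show ?thesis using that by (intro bexI[of _ x]) auto
  next
    case False
    have "\<exists>c. geodesic_segment m c p x" using geo p that(1) unfolding geodesic_space_def by simp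
    then obtain c where "geodesic_segment m c p x" ..
    note gp = geodesic_segment_props[OF this]
    have "r' \<le> mdist m p x" using False by simp
    then have "mdist m p (c r') = r'" "mdist m (c r') x = mdist m p x - r'" "c r' \<in> mspace m"
      using gp(5,7,8) that(3) by simp_all
    then show ?thesis using that(2) by (intro bexI[of _ "c r'"]) simp_all
  qed
  have closed: "?TB \<rho>" if \<rho>: "\<And>r. 0 \<le> r \<Longrightarrow> r < \<rho> \<Longrightarrow> ?TB r" "\<rho> > 0" for \<rho>
    unfolding mtotally_bounded_def
  proof (intro allI impI)
    fix e :: real assume e: "e > 0"
    define r' where "r' = max 0 (\<rho> - e / 2)"
    have r': "0 \<le> r'" "r' < \<rho>" "\<rho> - r' \<le> e/2" unfolding r'_def using e \<rho>(2) by (simp_all add: max_def)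
    have "?TB r'" using \<rho>(1) r' by simp
    then have "\<exists>K. finite K \<and> K \<subseteq> mcball p r' \<and> mcball p r' \<subseteq> (\<Union>x\<in>K. mball x (e/2))"
      unfolding mtotally_bounded_def using e by simp
    then obtain K where K: "finite K" "K \<subseteq> mcball p r'" "mcball p r' \<subseteq> (\<Union>x\<in>K. mball x (e/2))"
      by (elim exE conjE) (rule that)
    have "mcball p \<rho> \<subseteq> (\<Union>x\<in>K. mball x e)"
    proof
      fix x assume x: "x \<in> mcball p \<rho>"
      then obtain y where y: "y \<in> mspace m" "mdist m p y \<le> r'" "mdist m y x \<le> \<rho> - r'"
        using shrink[of x \<rho> r'] r' by auto
      with K(3) p obtain k where k: "k \<in> K" "k \<in> mspace m" "mdist m k y < e/2" by fastforce
      then have "mdist m k x < e" using mdist_triangle[of k m y x] y x r' by auto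
      then show "x \<in> (\<Union>x\<in>K. mball x e)" using k x by auto
    qed
    moreover have "K \<subseteq> mcball p \<rho>" using K(2) r' by auto
    ultimately show "\<exists>K. finite K \<and> K \<subseteq> mcball p \<rho> \<and> mcball p \<rho> \<subseteq> (\<Union>x\<in>K. mball x e)"
      using K(1) by blast
  qed
  have "open": "\<exists>\<eta>>0. ?TB (\<rho> + \<eta>)" if \<rho>: "?TB \<rho>" "\<rho> \<ge> 0" for \<rho>
  proof -
    have cl: "mtopology closure_of (mcball p \<rho>) = mcball p \<rho>"
      by (simp add: closure_of_closedin)
    have comp: "compactin mtopology (mcball p \<rho>)"
      using \<rho> mtotally_bounded_eq_compact_closure_of compl cl unfolding mcomplete_of_def by metis
    define \<C> where "\<C> = {U. openin mtopology U \<and> (\<exists>K. compactin mtopology K \<and> U \<subseteq> K)}"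
    have cov: "mcball p \<rho> \<subseteq> \<Union>\<C>"
    proof
      fix x assume "x \<in> mcball p \<rho>"
      then have "x \<in> topspace (mtopology_of m)" by auto
      then obtain U K where "openin (mtopology_of m) U" "compactin (mtopology_of m) K" "x \<in> U" "U \<subseteq> K"
        using loc unfolding locally_compact_space_def by meson
      then show "x \<in> \<Union>\<C>" unfolding \<C>_def mtopology_of_def by blast
    qed
    obtain \<F> where F: "finite \<F>" "\<F> \<subseteq> \<C>" "mcball p \<rho> \<subseteq> \<Union>\<F>"
      using comp cov unfolding compactin_def \<C>_def by (metis (no_types, lifting) mem_Collect_eq)
    have op: "\<And>U. U \<in> \<F> \<Longrightarrow> openin mtopology U" using F(2) \<C>_def by auto
    obtain \<eta> where \<eta>: "\<eta> > 0" "\<And>x. x \<in> mcball p \<rho> \<Longrightarrow> \<exists>U\<in>\<F>. mball x \<eta> \<subseteq> U"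
      using lebesgue_number[OF comp F(3) op] by blast
    obtain K where K: "\<And>U. U \<in> \<F> \<Longrightarrow> compactin mtopology (K U) \<and> U \<subseteq> K U"
      using F(2) unfolding \<C>_def subset_iff mem_Collect_eq by metis
    have "mtotally_bounded (\<Union>U\<in>\<F>. K U)"
      using K F(1) by (intro compactin_imp_mtotally_bounded compactin_Union) auto
    moreover have "mcball p (\<rho> + \<eta>/2) \<subseteq> (\<Union>U\<in>\<F>. K U)"
    proof
      fix x assume x: "x \<in> mcball p (\<rho> + \<eta>/2)"
      then obtain y where y: "y \<in> mspace m" "mdist m p y \<le> \<rho>" "mdist m y x \<le> \<eta>/2"
        using shrink[of x "\<rho> + \<eta>/2" \<rho>] \<rho> \<eta> by auto
      then obtain U where "U \<in> \<F>" "mball y \<eta> \<subseteq> U" using \<eta>(2)[of y] p by auto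
      moreover have "x \<in> mball y \<eta>" using x y \<eta>(1) by auto
      ultimately show "x \<in> (\<Union>U\<in>\<F>. K U)" using K by blast
    qed
    ultimately show ?thesis using mtotally_bounded_subset \<eta>(1)
      by (intro exI[of _ "\<eta>/2"]) auto
  qed
  have TB0: "?TB 0"
  proof -
    have "mcball p 0 = {p}" using p by (auto simp: mcball_def dest: order.antisym[OF _ mdist_nonneg])
    then show ?thesis using p by (simp add: finite_imp_mtotally_bounded)
  qed
  have "?TB R"
  proof (rule ccontr)
    assume R: "\<not> ?TB R"
    then have "R > 0" using mono[OF TB0, of R] by (meson not_le)
    define S where "S = {r\<in>{0..R}. ?TB r}"
    define \<rho> where "\<rho> = Sup S"
    have S: "0 \<in> S" "bdd_above S" using TB0 \<open>R > 0\<close> by (auto simp: S_def bdd_above_def)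
    have \<rho>: "0 \<le> \<rho>" "\<rho> \<le> R" unfolding \<rho>_def using S
      by (auto intro: cSup_upper) (auto intro!: cSup_least simp: S_def)
    have below: "?TB r" if r: "r < \<rho>" for r
    proof -
      obtain r' where "r' \<in> S" "r < r'" using r S less_cSupD[of S r] unfolding \<rho>_def by blast
      then show ?thesis using mono[of r' r] by (auto simp: S_def)
    qed
    have T: "?TB \<rho>"
    proof (cases "\<rho> = 0")
      case False then show ?thesis using \<rho> by (intro closed[OF below]) simp_all
    qed (use TB0 in auto)
    then obtain \<eta> where \<eta>: "\<eta> > 0" "?TB (\<rho> + \<eta>)" using "open" \<rho> by blast
    have "\<rho> + \<eta> < R" using R mono[OF \<eta>(2), of R] by (meson not_le)
    then have "\<rho> + \<eta> \<in> S" using \<eta> \<rho> by (auto simp: S_def)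
    then have "\<rho> + \<eta> \<le> \<rho>" unfolding \<rho>_def using S by (intro cSup_upper)
    then show False using \<eta> by simp
  qed
  then show "mtotally_bounded (mcball_of m p R)" using p by (simp add: mcball_of_def)
qed

section \<open>Products\<close>

lemma mdist_component_le:
  "mdist (X i) (x i) (y i) \<le> mdist (product_metric X) x y" for i :: "'r::finite"
proof -
  have "(mdist (X i) (x i) (y i))\<^sup>2 \<le> (\<Sum>i\<in>UNIV. (mdist (X i) (x i) (y i))\<^sup>2)"
    by (rule member_le_sum) auto
  then show ?thesis by (auto intro: real_le_rsqrt)
qed

lemma mdist_product_sq:
  "(mdist (product_metric X) x y)\<^sup>2 = (\<Sum>i\<in>UNIV. (mdist (X i) (x i) (y i))\<^sup>2)"
  by (simp add: sum_nonneg)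

lemma mcomplete_of_seqD:
  assumes "mcomplete_of m" "\<And>n::nat. u n \<in> mspace m"
    and "\<And>e. e > 0 \<Longrightarrow> \<exists>N. \<forall>k\<ge>N. \<forall>n\<ge>N. mdist m (u k) (u n) < e"
  obtains x where "x \<in> mspace m" "(\<lambda>n. mdist m (u n) x) \<longlonglongrightarrow> 0"
proof -
  interpret Metric_space "mspace m" "mdist m" by (rule Metric_space_mspace_mdist)
  have "MCauchy u" unfolding MCauchy_def using assms(2,3) by (auto simp: image_subset_iff)
  then obtain x where "limitin mtopology u x sequentially"
    using assms(1) unfolding mcomplete_of_def mcomplete_def by blast
  then have "x \<in> mspace m" "(\<lambda>n. mdist m (u n) x) \<longlonglongrightarrow> 0"
    by (simp_all add: limitin_metric_dist_null)
  then show thesis by (rule that)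
qed

lemma mcomplete_of_product:
  fixes X :: "'r::finite \<Rightarrow> 'a metric"
  assumes "\<And>i. mcomplete_of (X i)"
  shows "mcomplete_of (product_metric X)"
proof -
  let ?Y = "product_metric X"
  interpret Y: Metric_space "mspace ?Y" "mdist ?Y" by (rule Metric_space_mspace_mdist)
  show ?thesis unfolding mcomplete_of_def Y.mcomplete_def
  proof (intro allI impI)
    fix u assume u: "Y.MCauchy u"
    have uin: "u n \<in> mspace ?Y" for n using u unfolding Y.MCauchy_def by auto
    have "\<exists>x\<in>mspace (X i). (\<lambda>n. mdist (X i) (u n i) x) \<longlonglongrightarrow> 0" for i
    proof -
      have C: "\<exists>N. \<forall>k\<ge>N. \<forall>n\<ge>N. mdist (X i) (u k i) (u n i) < e" if "e > 0" for e
      proof -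
        obtain N where N: "\<And>k n. N \<le> k \<Longrightarrow> N \<le> n \<Longrightarrow> mdist ?Y (u k) (u n) < e"
          using u \<open>e > 0\<close> unfolding Y.MCauchy_def by meson
        show ?thesis
        proof (intro exI allI impI)
          fix k n assume "N \<le> k" "N \<le> n"
          then show "mdist (X i) (u k i) (u n i) < e"
            using N[of k n] mdist_component_le[of X i "u k" "u n"] by linarith
        qed
      qed
      show ?thesis
        by (rule mcomplete_of_seqD[OF assms, of "\<lambda>n. u n i" i]) (use uin C in auto)
    qed
    then obtain x where x: "\<And>i. x i \<in> mspace (X i)" "\<And>i. (\<lambda>n. mdist (X i) (u n i) (x i)) \<longlonglongrightarrow> 0"
      by metis
    have "(\<lambda>n. sqrt (\<Sum>i\<in>UNIV. (mdist (X i) (u n i) (x i))\<^sup>2)) \<longlonglongrightarrow> sqrt (\<Sum>i\<in>(UNIV::'r set). 0\<^sup>2)"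
      by (intro tendsto_intros x(2))
    then have "limitin Y.mtopology u x sequentially"
      unfolding Y.limitin_metric_dist_null using x(1) uin by simp
    then show "\<exists>x. limitin Y.mtopology u x sequentially" by (intro exI[of _ x])
  qed
qed

lemma balls_totally_bounded_product:
  fixes X :: "'r::finite \<Rightarrow> 'a metric"
  assumes "\<And>i. balls_totally_bounded (X i)"
  shows "balls_totally_bounded (product_metric X)"
  unfolding balls_totally_bounded_def
proof (intro ballI allI)
  let ?Y = "product_metric X"
  interpret Y: Metric_space "mspace ?Y" "mdist ?Y" by (rule Metric_space_mspace_mdist)
  fix p R assume p: "p \<in> mspace ?Y"
  show "Y.mtotally_bounded (mcball_of ?Y p R)"
    unfolding Y.mtotally_bounded_sequentially
  proof (intro conjI allI impI)
    show "mcball_of ?Y p R \<subseteq> mspace ?Y" by auto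
    fix u :: "nat \<Rightarrow> 'r \<Rightarrow> 'a" assume u: "range u \<subseteq> mcball_of ?Y p R"
    \<comment> \<open>refine a subsequence one coordinate at a time\<close>
    have "\<exists>r. strict_mono (r::nat\<Rightarrow>nat) \<and>
        (\<forall>i\<in>F. Metric_space.MCauchy (mspace (X i)) (mdist (X i)) (\<lambda>n. u (r n) i))"
      if "finite F" for F
      using that
    proof (induction F)
      case empty
      have "strict_mono (id::nat\<Rightarrow>nat)" by (simp add: strict_mono_def)
      then show ?case by blast
    next
      case (insert i F)
      then obtain r where r: "strict_mono (r::nat\<Rightarrow>nat)"
        "\<forall>i\<in>F. Metric_space.MCauchy (mspace (X i)) (mdist (X i)) (\<lambda>n. u (r n) i)" by blast
      interpret Xi: Metric_space "mspace (X i)" "mdist (X i)" by (rule Metric_space_mspace_mdist)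
      have "u (r n) i \<in> mcball_of (X i) (p i) R" for n
      proof -
        have "u (r n) \<in> mcball_of ?Y p R" using u rangeI[of u "r n"] by blast
        then have *: "u (r n) \<in> mspace ?Y" "mdist ?Y p (u (r n)) \<le> R"
          by (simp_all only: in_mcball_of)
        then have "mdist (X i) (p i) (u (r n) i) \<le> R"
          using mdist_component_le[of X i p "u (r n)"] by linarith
        then show ?thesis using p * by simp
      qed
      then have "range (\<lambda>n. u (r n) i) \<subseteq> mcball_of (X i) (p i) R" by auto
      moreover have "Xi.mtotally_bounded (mcball_of (X i) (p i) R)"
        using assms[of i] p unfolding balls_totally_bounded_def by auto
      ultimately obtain r' where r': "strict_mono (r'::nat\<Rightarrow>nat)" "Xi.MCauchy ((\<lambda>n. u (r n) i) \<circ> r')"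
        unfolding Xi.mtotally_bounded_sequentially by blast
      have "Metric_space.MCauchy (mspace (X j)) (mdist (X j)) (\<lambda>n. u ((r \<circ> r') n) j)"
        if "j \<in> insert i F" for j
      proof (cases "j = i")
        case True then show ?thesis using r'(2) by (simp add: o_def)
      next
        case False
        then show ?thesis using Metric_space.MCauchy_subsequence[OF Metric_space_mspace_mdist r'(1), of "X j" "\<lambda>n. u (r n) j"]
            r(2) that by (auto simp: o_def)
      qed
      then show ?case using strict_mono_o[OF r(1) r'(1)] by blast
    qed
    from this[of UNIV] obtain r where r: "strict_mono (r::nat\<Rightarrow>nat)"
      "\<And>i. Metric_space.MCauchy (mspace (X i)) (mdist (X i)) (\<lambda>n. u (r n) i)" by auto
    have "Y.MCauchy (u \<circ> r)"
      unfolding Y.MCauchy_def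
    proof (intro conjI allI impI)
      show "range (u \<circ> r) \<subseteq> mspace ?Y" using u by (auto simp: image_subset_iff)
      fix e :: real assume e: "e > 0"
      define e' where "e' = e / (real CARD('r) + 1)"
      have e': "e' > 0" using e by (simp add: e'_def add_nonneg_pos)
      have "\<forall>i. \<exists>N. \<forall>n n'. N \<le> n \<longrightarrow> N \<le> n' \<longrightarrow> mdist (X i) (u (r n) i) (u (r n') i) < e'"
        using r(2) e' Metric_space.MCauchy_def[OF Metric_space_mspace_mdist] by metis
      then obtain N where N: "\<And>i n n'. N i \<le> n \<Longrightarrow> N i \<le> n' \<Longrightarrow> mdist (X i) (u (r n) i) (u (r n') i) < e'"
        by metis
      have "mdist ?Y (u (r n)) (u (r n')) < e" if "Max (range N) \<le> n" "Max (range N) \<le> n'" for n n'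
      proof -
        have "N i \<le> Max (range N)" for i by simp
        then have "N i \<le> n" "N i \<le> n'" for i using that le_trans by blast+
        then have "mdist (X i) (u (r n) i) (u (r n') i) < e'" for i using N by blast
        then have "(\<Sum>i\<in>UNIV. mdist (X i) (u (r n) i) (u (r n') i)) \<le> (\<Sum>i\<in>(UNIV::'r set). e')"
          by (intro sum_mono less_imp_le) auto
        also have "\<dots> < e" using e by (simp add: e'_def field_simps)
        finally have "(\<Sum>i\<in>UNIV. mdist (X i) (u (r n) i) (u (r n') i)) < e" .
        then show ?thesis
          using L2_set_le_sum[of UNIV "\<lambda>i. mdist (X i) (u (r n) i) (u (r n') i)"]
          by (simp add: L2_set_def)
      qed
      then show "\<exists>N. \<forall>n n'. N \<le> n \<longrightarrow> N \<le> n' \<longrightarrow> mdist ?Y ((u \<circ> r) n) ((u \<circ> r) n') < e"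
        by (intro exI[of _ "Max (range N)"]) auto
    qed
    then show "\<exists>r. strict_mono r \<and> Y.MCauchy (u \<circ> r)" using r(1) by blast
  qed
qed

text \<open>Geodesics of the factors, each run at the proportional speed, form a geodesic of the product,
  and the inequality for it is the sum of the inequalities in the factors. By uniqueness this
  describes all geodesics of the product. If the two points coincide then the quotient is 0, which
  is the correct speed.\<close>

definition product_geodesic ::
  "('r::finite \<Rightarrow> 'a metric) \<Rightarrow> ('r \<Rightarrow> real \<Rightarrow> 'a) \<Rightarrow> ('r \<Rightarrow> 'a) \<Rightarrow> ('r \<Rightarrow> 'a) \<Rightarrow> real \<Rightarrow> 'r \<Rightarrow> 'a" where
  "product_geodesic X c x y t =
     (\<lambda>i. c i (t * (mdist (X i) (x i) (y i) / mdist (product_metric X) x y)))"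

lemma product_geodesic_time:
  assumes "0 \<le> t" "t \<le> mdist (product_metric X) x y"
  shows "0 \<le> t * (mdist (X i) (x i) (y i) / mdist (product_metric X) x y)"
    "t * (mdist (X i) (x i) (y i) / mdist (product_metric X) x y) \<le> mdist (X i) (x i) (y i)"
proof -
  let ?L = "mdist (product_metric X) x y"
  have q: "0 \<le> t / ?L" "t / ?L \<le> 1" using assms by (auto simp del: mdist_product_metric simp: divide_le_eq_1)
  have e: "t * (mdist (X i) (x i) (y i) / ?L) = (t / ?L) * mdist (X i) (x i) (y i)" by simp
  show "0 \<le> t * (mdist (X i) (x i) (y i) / ?L)"
    unfolding e using q by (intro mult_nonneg_nonneg) auto
  show "t * (mdist (X i) (x i) (y i) / ?L) \<le> mdist (X i) (x i) (y i)"
    unfolding e using q by (intro mult_left_le_one_le) auto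
qed

lemma product_geodesic_segment:
  fixes X :: "'r::finite \<Rightarrow> 'a metric"
  assumes c: "\<And>i. geodesic_segment (X i) (c i) (x i) (y i)"
  shows "geodesic_segment (product_metric X) (product_geodesic X c x y) x y"
proof -
  let ?Y = "product_metric X" and ?c = "product_geodesic X c x y"
  define L where "L = mdist ?Y x y"
  define v where "v i = mdist (X i) (x i) (y i) / L" for i
  note gp = geodesic_segment_props[OF c]
  have cv: "?c t i = c i (t * v i)" for t i by (simp add: product_geodesic_def v_def L_def)
  have L0: "L \<ge> 0" unfolding L_def by (rule mdist_nonneg)
  have tm: "0 \<le> t * v i" "t * v i \<le> mdist (X i) (x i) (y i)" if "0 \<le> t" "t \<le> L" for t i
    using product_geodesic_time[of t X x y i] that unfolding v_def L_def by auto
  have Lv: "L * v i = mdist (X i) (x i) (y i)" for i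
    using mdist_component_le[of X i x y] by (cases "L = 0") (auto simp: v_def L_def[symmetric]
        intro: order.antisym simp del: mdist_product_metric)
  show ?thesis
    unfolding geodesic_segment_def L_def[symmetric]
  proof (intro conjI ballI)
    show "?c ` {0..L} \<subseteq> mspace ?Y"
      using tm gp(5) by (auto simp: cv)
    show "?c 0 = x" "?c L = y" using gp(1,2) by (auto simp: cv fun_eq_iff Lv)
    fix s t assume st: "s \<in> {0..L}" "t \<in> {0..L}"
    have "mdist (X i) (?c s i) (?c t i) = \<bar>s - t\<bar> * v i" for i
    proof -
      have "v i \<ge> 0" using L0 by (simp add: v_def)
      then show ?thesis unfolding cv
        using gp(6)[of "s * v i" i "t * v i"] tm st by (simp add: abs_mult flip: left_diff_distrib)
    qed
    then have "(mdist ?Y (?c s) (?c t))\<^sup>2 = (s - t)\<^sup>2 * (\<Sum>i\<in>UNIV. (v i)\<^sup>2)"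
      unfolding mdist_product_sq by (simp add: power_mult_distrib sum_distrib_left)
    also have "\<dots> = (s - t)\<^sup>2"
    proof (cases "L = 0")
      case True
      then have "s = 0" "t = 0" using st by auto
      then show ?thesis by simp
    next
      case False
      have "L\<^sup>2 * (\<Sum>i\<in>UNIV. (v i)\<^sup>2) = (\<Sum>i\<in>UNIV. (L * v i)\<^sup>2)"
        by (simp add: power_mult_distrib sum_distrib_left)
      also have "\<dots> = L\<^sup>2" unfolding Lv by (simp only: L_def mdist_product_sq)
      finally show ?thesis using False by simp
    qed
    finally show "mdist ?Y (?c s) (?c t) = \<bar>s - t\<bar>"
      by (metis mdist_nonneg real_sqrt_abs real_sqrt_pow2 real_sqrt_power sqrt_ge_absD abs_of_nonneg)
  qed
qed

lemma product_geodesic_CN: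
  fixes X :: "'r::finite \<Rightarrow> 'a metric"
  assumes CN: "\<And>i. CN_inequality (X i)"
    and c: "\<And>i. geodesic_segment (X i) (c i) (x i) (y i)"
    and w: "w \<in> mspace (product_metric X)" and l: "0 \<le> l" "l \<le> 1"
  shows "(mdist (product_metric X) w (product_geodesic X c x y (l * mdist (product_metric X) x y)))\<^sup>2
     \<le> (1 - l) * (mdist (product_metric X) w x)\<^sup>2 + l * (mdist (product_metric X) w y)\<^sup>2
        - l * (1 - l) * (mdist (product_metric X) x y)\<^sup>2"
proof -
  define L where "L = mdist (product_metric X) x y"
  note gp = geodesic_segment_props[OF c]
  have "(mdist (X i) (w i) (product_geodesic X c x y (l * L) i))\<^sup>2
     \<le> (1 - l) * (mdist (X i) (w i) (x i))\<^sup>2 + l * (mdist (X i) (w i) (y i))\<^sup>2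
        - l * (1 - l) * (mdist (X i) (x i) (y i))\<^sup>2" for i
  proof -
    have "product_geodesic X c x y (l * L) i = c i (l * mdist (X i) (x i) (y i))"
    proof (cases "L = 0")
      case True
      then have "mdist (X i) (x i) (y i) = 0"
        using mdist_component_le[of X i x y] by (intro order.antisym) (auto simp: L_def simp del: mdist_product_metric)
      then show ?thesis by (simp add: product_geodesic_def)
    qed (simp add: product_geodesic_def L_def[symmetric] del: mdist_product_metric)
    then show ?thesis
      using CN_inequalityD[OF CN[of i] _ gp(3) gp(4) c l, of "w i"] w by simp
  qed
  then have "(\<Sum>i\<in>UNIV. (mdist (X i) (w i) (product_geodesic X c x y (l * L) i))\<^sup>2)
    \<le> (\<Sum>i\<in>UNIV. (1 - l) * (mdist (X i) (w i) (x i))\<^sup>2 + l * (mdist (X i) (w i) (y i))\<^sup>2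
        - l * (1 - l) * (mdist (X i) (x i) (y i))\<^sup>2)"
    by (intro sum_mono) auto
  then show ?thesis
    unfolding L_def mdist_product_sq by (simp add: sum.distrib sum_subtractf sum_distrib_left)
qed

lemma geodesic_space_product:
  fixes X :: "'r::finite \<Rightarrow> 'a metric"
  assumes "\<And>i. geodesic_space (X i)"
  shows "geodesic_space (product_metric X)"
  unfolding geodesic_space_def
proof (intro ballI)
  fix x y assume xy: "x \<in> mspace (product_metric X)" "y \<in> mspace (product_metric X)"
  have "\<exists>c. geodesic_segment (X i) c (x i) (y i)" for i
    using assms[of i] xy unfolding geodesic_space_def by simp
  then obtain c where "\<And>i. geodesic_segment (X i) (c i) (x i) (y i)" by metis
  from product_geodesic_segment[of X c x y, OF this] show "\<exists>c. geodesic_segment (product_metric X) c x y" by blast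
qed

lemma product_geodesic_unique:
  fixes X :: "'r::finite \<Rightarrow> 'a metric"
  assumes CN: "\<And>i. CN_inequality (X i)"
    and c: "\<And>i. geodesic_segment (X i) (c i) (x i) (y i)"
    and \<sigma>: "geodesic_segment (product_metric X) \<sigma> x y"
    and l: "0 \<le> l" "l \<le> 1"
  shows "\<sigma> (l * mdist (product_metric X) x y) = product_geodesic X c x y (l * mdist (product_metric X) x y)"
  by (rule geodesic_segment_unique_if_CN[OF product_geodesic_segment[OF c] \<sigma> product_geodesic_CN[OF CN c _ l] l])

lemma CN_inequality_product:
  fixes X :: "'r::finite \<Rightarrow> 'a metric"
  assumes geo: "\<And>i. geodesic_space (X i)" and CN: "\<And>i. CN_inequality (X i)"
  shows "CN_inequality (product_metric X)"
  unfolding CN_inequality_def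
proof (intro ballI allI impI)
  let ?Y = "product_metric X"
  fix w y z c and l :: real
  assume w: "w \<in> mspace ?Y" and y: "y \<in> mspace ?Y" and z: "z \<in> mspace ?Y"
    and c: "geodesic_segment ?Y c y z" and l: "l \<in> {0..1}"
  have "\<exists>c. geodesic_segment (X i) c (y i) (z i)" for i
    using geo[of i] y z unfolding geodesic_space_def by simp
  then obtain c' where c': "\<And>i. geodesic_segment (X i) (c' i) (y i) (z i)" by metis
  show "(mdist ?Y w (c (l * mdist ?Y y z)))\<^sup>2
     \<le> (1 - l) * (mdist ?Y w y)\<^sup>2 + l * (mdist ?Y w z)\<^sup>2 - l * (1 - l) * (mdist ?Y y z)\<^sup>2"
    using product_geodesic_CN[OF CN c' w, of l] product_geodesic_unique[OF CN c' c, of l] l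
    by (simp del: mdist_product_metric)
qed

text \<open>This is where slopes come from: by uniqueness, every geodesic is a product geodesic.\<close>

lemma product_geodesic_component_speed:
  fixes X :: "'r::finite \<Rightarrow> 'a metric"
  assumes geo: "\<And>i. geodesic_space (X i)" and CN: "\<And>i. CN_inequality (X i)"
    and \<sigma>: "geodesic_segment (product_metric X) \<sigma> x y"
    and s: "0 \<le> s" "s \<le> mdist (product_metric X) x y" and t: "0 \<le> t" "t \<le> mdist (product_metric X) x y"
  shows "mdist (X i) (\<sigma> s i) (\<sigma> t i)
    = \<bar>s - t\<bar> * (mdist (X i) (x i) (y i) / mdist (product_metric X) x y)"
proof -
  let ?Y = "product_metric X"
  define L where "L = mdist ?Y x y"
  note gp = geodesic_segment_props[OF \<sigma>]
  have L0: "L \<ge> 0" unfolding L_def by (rule mdist_nonneg)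
  have "\<exists>c. geodesic_segment (X i) c (x i) (y i)" for i
    using geo[of i] gp(3,4) unfolding geodesic_space_def by simp
  then obtain c where c: "\<And>i. geodesic_segment (X i) (c i) (x i) (y i)" by metis
  have eq: "\<sigma> t = product_geodesic X c x y t" if "0 \<le> t" "t \<le> L" for t
  proof (cases "L = 0")
    case True
    then have "t = 0" using that by simp
    then show ?thesis using product_geodesic_unique[OF CN c \<sigma>, of 0] by simp
  next
    case False
    then show ?thesis using product_geodesic_unique[OF CN c \<sigma>, of "t / L"] that
      by (simp add: L_def[symmetric] divide_le_eq_1 del: mdist_product_metric)
  qed
  define v where "v = mdist (X i) (x i) (y i) / L"
  have "v \<ge> 0" using L0 by (simp add: v_def)
  have "mdist (X i) (\<sigma> s i) (\<sigma> t i) = mdist (X i) (c i (s * v)) (c i (t * v))"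
    using eq s t by (simp add: product_geodesic_def v_def L_def del: mdist_product_metric)
  also have "\<dots> = \<bar>s * v - t * v\<bar>"
    using product_geodesic_time[OF s, of i] product_geodesic_time[OF t, of i]
    by (intro geodesic_segment_props(6)[OF c]) (auto simp: v_def L_def simp del: mdist_product_metric)
  also have "\<dots> = \<bar>s - t\<bar> * v" using \<open>v \<ge> 0\<close> by (simp add: abs_mult flip: left_diff_distrib)
  finally show ?thesis by (simp add: v_def L_def)
qed

section \<open>Geodesics and rays\<close>

locale proper_CN_space =
  fixes m :: "'b metric"
  assumes geo: "geodesic_space m" and CN: "CN_inequality m"
    and compl: "mcomplete_of m" and proper: "balls_totally_bounded m"
begin

abbreviation M :: "'b set" where "M \<equiv> mspace m"
abbreviation d :: "'b \<Rightarrow> 'b \<Rightarrow> real" where "d \<equiv> mdist m"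

lemma ex_geodesic:
  assumes "x \<in> M" "y \<in> M" shows "\<exists>c. geodesic_segment m c x y"
  using geo assms unfolding geodesic_space_def by simp

lemma reverse_triangle:
  assumes "x \<in> M" "y \<in> M" "z \<in> M" shows "\<bar>d x z - d y z\<bar> \<le> d x y"
  using mdist_triangle[OF assms] mdist_triangle[of y m x z] assms by (simp add: mdist_commute[of m y x])

lemma CN_at_time:
  assumes c: "geodesic_segment m c p z" and t: "0 \<le> t" "t \<le> d p z" and w: "w \<in> M"
  shows "(d w (c t))\<^sup>2 \<le> (1 - t / d p z) * (d w p)\<^sup>2 + t / d p z * (d w z)\<^sup>2 - t * (d p z - t)"
proof -
  note gp = geodesic_segment_props[OF c]
  define L l where "L = d p z" and "l = t / L"
  have t': "t = l * L" using t by (simp add: l_def L_def)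
  have l: "0 \<le> l" "l \<le> 1" using t by (auto simp: l_def L_def divide_le_eq_1)
  have "(d w (c (l * L)))\<^sup>2 \<le> (1 - l) * (d w p)\<^sup>2 + l * (d w z)\<^sup>2 - l * (1 - l) * L\<^sup>2"
    using CN_inequalityD[OF CN w gp(3,4) c l] by (simp add: L_def)
  also have "l * (1 - l) * L\<^sup>2 = t * (L - t)" unfolding t' by (simp add: algebra_simps power2_eq_square)
  finally show ?thesis unfolding t'[symmetric] unfolding l_def L_def .
qed

text \<open>Two applications of the inequality, one at each end of the segment between the two points,
  give the comparison of distances along two sides of a triangle.\<close>

lemma contract_to_vertex:
  assumes c: "geodesic_segment m c z a" and c': "geodesic_segment m c' z b" and l: "0 \<le> l" "l \<le> 1"
  shows "d (c (l * d z a)) (c' (l * d z b)) \<le> l * d a b"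
proof -
  note gp = geodesic_segment_props[OF c] and gp' = geodesic_segment_props[OF c']
  define A B u v where "A = d z a" and "B = d z b" and "u = c (l * A)" and "v = c' (l * B)"
  have tA: "0 \<le> l * A" "l * A \<le> A" and tB: "0 \<le> l * B" "l * B \<le> B"
    using l by (auto simp: A_def B_def mult_left_le_one_le)
  have u: "u \<in> M" "d z u = l * A" unfolding u_def using gp(5,7) tA by (auto simp: A_def)
  have "(d u v)\<^sup>2 \<le> (1 - l) * (d u z)\<^sup>2 + l * (d u b)\<^sup>2 - l * (1 - l) * B\<^sup>2"
    unfolding v_def B_def using CN_inequalityD[OF CN u(1) gp'(3,4) c' l] .
  moreover have "(d b u)\<^sup>2 \<le> (1 - l) * (d b z)\<^sup>2 + l * (d b a)\<^sup>2 - l * (1 - l) * A\<^sup>2"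
    unfolding u_def A_def using CN_inequalityD[OF CN gp'(4) gp(3,4) c l] .
  then have "l * (d u b)\<^sup>2 \<le> l * ((1 - l) * B\<^sup>2 + l * (d a b)\<^sup>2 - l * (1 - l) * A\<^sup>2)"
    using l by (intro mult_left_mono) (auto simp: B_def mdist_commute)
  ultimately have "(d u v)\<^sup>2 \<le> (1 - l) * (l * A)\<^sup>2 + l * ((1 - l) * B\<^sup>2 + l * (d a b)\<^sup>2 - l * (1 - l) * A\<^sup>2)
      - l * (1 - l) * B\<^sup>2"
    using u(2) by (simp add: mdist_commute)
  also have "\<dots> = (l * d a b)\<^sup>2" by (simp add: power2_eq_square algebra_simps)
  finally have "d u v \<le> l * d a b" by (rule power2_le_imp_le) (use l in simp)
  then show ?thesis by (simp add: u_def v_def A_def B_def)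
qed

text \<open>The excess \<open>d q z - d p z + t\<close> is the amount by which the way from \<open>p\<close> to \<open>z\<close> becomes longer
  if it leads through \<open>q\<close>. The bound does not depend on the length of the geodesic, so that it
  survives the passage to rays.\<close>

lemma almost_on_geodesic:
  assumes c: "geodesic_segment m c p z" and t: "0 \<le> t" "t \<le> d p z" and q: "q \<in> M" "d p q = t"
  shows "(d q (c t))\<^sup>2 \<le> 2 * t * (d q z - d p z + t) + (d q z - d p z + t)\<^sup>2"
proof -
  note gp = geodesic_segment_props[OF c]
  define L k e where "L = d p z" and "k = t / L" and "e = d q z - L + t"
  have t': "t = k * L" using t by (simp add: k_def L_def)
  have k: "0 \<le> k" "k \<le> 1" using t by (auto simp: k_def L_def divide_le_eq_1)
  have e: "e \<ge> 0" using mdist_triangle[OF gp(3) q(1) gp(4)] q by (simp add: e_def L_def)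
  have "(d q (c t))\<^sup>2 \<le> (1 - k) * t\<^sup>2 + k * (L - t + e)\<^sup>2 - t * (L - t)"
    using CN_at_time[OF c t q(1)] q by (simp add: k_def L_def e_def mdist_commute)
  also have "\<dots> = 2 * t * e - k * (2 * t * e) + k * e\<^sup>2"
    unfolding t' by (simp add: algebra_simps power2_eq_square)
  also have "\<dots> \<le> 2 * t * e + e\<^sup>2"
  proof -
    have "0 \<le> k * (2 * t * e)" using k t e by simp
    moreover have "k * e\<^sup>2 \<le> e\<^sup>2" using k by (intro mult_left_le_one_le) auto
    ultimately show ?thesis by linarith
  qed
  finally show ?thesis by (simp add: e_def L_def)
qed

text \<open>The inequality gives \<open>(d y (c t))\<^sup>2 \<le> (t + a)\<^sup>2 + (d y p)\<^sup>2\<close> for the difference \<open>a\<close> of the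
  distances of \<open>z\<close> from \<open>y\<close> and \<open>p\<close>, and \<open>t + a\<close> is large. The error is again independent of the
  length of the geodesic.\<close>

lemma far_distance_difference:
  assumes c: "geodesic_segment m c p z" and y: "y \<in> M" and t: "d y p < t" "t \<le> d p z"
  shows "\<bar>(d y z - d p z) - (d y (c t) - t)\<bar> \<le> (d y p)\<^sup>2 / (2 * (t - d y p))"
proof -
  note gp = geodesic_segment_props[OF c]
  define L D a k where "L = d p z" and "D = d y p" and "a = d y z - L" and "k = t / L"
  have D: "D \<ge> 0" "D < t" using t by (auto simp: D_def)
  have t0: "0 \<le> t" using D by simp
  have t': "t = k * L" using t D by (auto simp: k_def L_def)
  have k: "0 \<le> k" "k \<le> 1" using t t0 by (auto simp: k_def L_def divide_le_eq_1)
  have ct: "c t \<in> M" "d (c t) z = L - t" using gp(5,8) t t0 by (auto simp: L_def)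
  have aD: "\<bar>a\<bar> \<le> D" using reverse_triangle[OF y gp(3,4)] by (simp add: a_def D_def L_def)
  have up: "a \<le> d y (c t) - t"
    using mdist_triangle[OF y ct(1) gp(4)] ct by (simp add: a_def)
  define s where "s = t + a"
  have s: "s \<ge> t - D" "s > 0" using aD D by (auto simp: s_def)
  have "(d y (c t))\<^sup>2 \<le> (1 - k) * D\<^sup>2 + k * (L + a)\<^sup>2 - t * (L - t)"
    using CN_at_time[OF c t0 t(2) y] by (simp add: k_def L_def a_def D_def)
  also have "\<dots> = D\<^sup>2 - k * (D\<^sup>2 - a\<^sup>2) + 2 * a * t + t\<^sup>2"
    unfolding t' by (simp add: algebra_simps power2_eq_square)
  also have "\<dots> \<le> D\<^sup>2 + s\<^sup>2"
  proof -
    have "a\<^sup>2 \<le> D\<^sup>2" using aD D by (intro power2_le_iff_abs_le[THEN iffD2]) auto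
    then have "0 \<le> k * (D\<^sup>2 - a\<^sup>2)" using k by simp
    moreover have "s\<^sup>2 = t\<^sup>2 + a\<^sup>2 + 2 * a * t" by (simp add: s_def power2_sum)
    ultimately show ?thesis using zero_le_power2[of a] by linarith
  qed
  also have "\<dots> \<le> (s + D\<^sup>2 / (2 * s))\<^sup>2"
    using s by (simp add: power2_sum)
  finally have "d y (c t) \<le> s + D\<^sup>2 / (2 * s)"
    using s by (intro power2_le_imp_le[of "d y (c t)"]) auto
  also have "\<dots> \<le> s + D\<^sup>2 / (2 * (t - D))"
    using s D by (intro add_left_mono divide_left_mono) auto
  finally have "d y (c t) - t - a \<le> D\<^sup>2 / (2 * (t - D))" by (simp add: s_def)
  moreover have "0 \<le> d y (c t) - t - a" using up by simp
  ultimately show ?thesis unfolding a_def D_def L_def by (simp add: abs_le_iff)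
qed

lemma rayD:
  assumes "geodesic_ray m \<sigma>"
  shows "\<And>t. 0 \<le> t \<Longrightarrow> \<sigma> t \<in> M" "\<And>s t. 0 \<le> s \<Longrightarrow> 0 \<le> t \<Longrightarrow> d (\<sigma> s) (\<sigma> t) = \<bar>s - t\<bar>"
  using assms unfolding geodesic_ray_def by auto

lemma ray_segment:
  assumes "geodesic_ray m \<sigma>" "0 \<le> n" shows "geodesic_segment m \<sigma> (\<sigma> 0) (\<sigma> n)"
  using rayD[OF assms(1)] assms(2) unfolding geodesic_segment_def by (auto simp: image_subset_iff)

lemma decreasing_limit:
  fixes f :: "real \<Rightarrow> real"
  assumes dec: "\<And>s t. 0 \<le> s \<Longrightarrow> s \<le> t \<Longrightarrow> f t \<le> f s" and bd: "\<And>s. 0 \<le> s \<Longrightarrow> b \<le> f s"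
  shows "\<exists>l. (f \<longlongrightarrow> l) at_top"
proof -
  have ne: "f ` {0..} \<noteq> {}" "bdd_below (f ` {0..})" using bd by (auto simp: bdd_below_def)
  have "(f \<longlongrightarrow> Inf (f ` {0..})) at_top"
  proof (rule decreasing_tendsto)
    show "\<forall>\<^sub>F n in at_top. Inf (f ` {0..}) \<le> f n"
      using eventually_ge_at_top[of 0] by eventually_elim (use ne in \<open>auto intro: cInf_lower\<close>)
    fix x assume "Inf (f ` {0..}) < x"
    then obtain s where s: "0 \<le> s" "f s < x" using cInf_lessD[OF ne(1)] by auto
    show "\<forall>\<^sub>F n in at_top. f n < x"
      using eventually_ge_at_top[of s] by eventually_elim (use dec s in \<open>fastforce intro: le_less_trans\<close>)
  qed
  then show ?thesis by blast
qed

lemma ray_distance_limit: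
  assumes "geodesic_ray m \<sigma>" "y \<in> M"
  shows "\<exists>l. ((\<lambda>s. d y (\<sigma> s) - s) \<longlongrightarrow> l) at_top"
proof (rule decreasing_limit)
  note r = rayD[OF assms(1)]
  show "d y (\<sigma> t) - t \<le> d y (\<sigma> s) - s" if "0 \<le> s" "s \<le> t" for s t
    using mdist_triangle[OF assms(2) r(1)[of s] r(1)[of t]] r(2)[of s t] that by simp
  show "- d y (\<sigma> 0) \<le> d y (\<sigma> s) - s" if "0 \<le> s" for s
    using mdist_triangle[OF r(1)[of 0] assms(2) r(1)[of s]] r(2)[of 0 s] that
    by (simp add: mdist_commute[of m "\<sigma> 0" y])
qed

lemma busemann_limit_exists:
  assumes "geodesic_ray m \<sigma>" "x \<in> M" "y \<in> M"
  shows "\<exists>l. ((\<lambda>s. d x (\<sigma> s) - d y (\<sigma> s)) \<longlongrightarrow> l) at_top"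
proof -
  obtain a b where ab: "((\<lambda>s. d x (\<sigma> s) - s) \<longlongrightarrow> a) at_top" "((\<lambda>s. d y (\<sigma> s) - s) \<longlongrightarrow> b) at_top"
    using ray_distance_limit assms by meson
  from tendsto_diff[OF ab] show ?thesis by (intro exI[of _ "a - b"]) simp
qed

text \<open>The geodesics from \<open>p\<close> to the points \<open>\<sigma> n\<close> form a Cauchy sequence at every time, by
  the bound on almost geodesic points: the excess of the way to \<open>\<sigma> k\<close> over \<open>\<sigma> n\<close> is the
  oscillation of the monotone sequence \<open>d p (\<sigma> n) - n\<close>. The limit is the ray from \<open>p\<close>
  asymptotic to \<open>\<sigma>\<close>.\<close>

lemma ray_from_point:
  assumes \<sigma>: "geodesic_ray m \<sigma>" and p: "p \<in> M"
  obtains c g where "geodesic_ray m c" "c 0 = p" "\<And>t. 0 \<le> t \<Longrightarrow> d (c t) (\<sigma> t) \<le> 2 * d p (\<sigma> 0)"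
    "\<And>n. geodesic_segment m (g n) p (\<sigma> (real n))"
    "\<And>t. 0 \<le> t \<Longrightarrow> (\<lambda>n. d (g n t) (c t)) \<longlonglongrightarrow> 0"
proof -
  note r = rayD[OF \<sigma>]
  have "\<exists>g. geodesic_segment m g p (\<sigma> (real n))" for n using ex_geodesic p r(1) by simp
  then obtain g where g: "\<And>n. geodesic_segment m (g n) p (\<sigma> (real n))" by metis
  note gp = geodesic_segment_props[OF g]
  define L where "L n = d p (\<sigma> (real n))" for n
  define D where "D = d p (\<sigma> 0)"
  have LD: "\<bar>L n - real n\<bar> \<le> D" for n
    using reverse_triangle[OF p r(1)[of 0] r(1)[of "real n"]] r(2)[of 0 "real n"] by (simp add: L_def D_def)
  have late: "\<exists>N. \<forall>n\<ge>N. t \<le> L n \<and> t \<le> real n \<and> 0 < n" for t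
  proof -
    obtain N where N: "real N \<ge> \<bar>t\<bar> + D + 1" using real_arch_simple by blast
    have D0: "0 \<le> D" by (simp add: D_def)
    show ?thesis
    proof (intro exI[of _ N] allI impI)
      fix n assume "N \<le> n"
      then have "real N \<le> real n" by simp
      then show "t \<le> L n \<and> t \<le> real n \<and> 0 < n" using LD[of n] N D0 by (auto intro: gr0I)
    qed
  qed
  obtain u where u: "(\<lambda>n. L n - real n) \<longlonglongrightarrow> u"
  proof -
    obtain u where "((\<lambda>s. d p (\<sigma> s) - s) \<longlongrightarrow> u) at_top" using ray_distance_limit[OF \<sigma> p] by blast
    from filterlim_compose[OF this filterlim_real_sequentially] show thesis
      by (intro that) (simp add: L_def)
  qed
  have step: "(d (g n t) (g k t))\<^sup>2 \<le> 2 * t * ((L n - n) - (L k - k)) + ((L n - n) - (L k - k))\<^sup>2"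
    if t: "0 \<le> t" "t \<le> L n" "t \<le> L k" and nk: "n \<le> k" for n k t
  proof -
    have gn: "g n t \<in> M" "d p (g n t) = t" "d (g n t) (\<sigma> n) = L n - t"
      using gp(5,7,8)[of t n] t by (auto simp: L_def)
    define e where "e = d (g n t) (\<sigma> k) - L k + t"
    have "e \<le> (L n - n) - (L k - k)"
      using mdist_triangle[OF gn(1) r(1)[of n] r(1)[of k]] r(2)[of n k] gn(3) nk by (simp add: e_def)
    moreover have e0: "0 \<le> e" using mdist_triangle[OF p gn(1) r(1)[of k]] gn(2) by (simp add: e_def L_def)
    ultimately have "2 * t * e + e\<^sup>2 \<le> 2 * t * ((L n - n) - (L k - k)) + ((L n - n) - (L k - k))\<^sup>2"
      using t by (intro add_mono mult_left_mono power_mono) auto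
    then show ?thesis
      using almost_on_geodesic[OF g[of k] t(1) _ gn(1,2)] t(3) by (auto simp: e_def L_def)
  qed
  have "\<exists>x\<in>M. (\<lambda>n. d (g n t) x) \<longlonglongrightarrow> 0" if t: "0 \<le> t" for t
  proof -
    obtain N where N: "\<And>n. n \<ge> N \<Longrightarrow> t \<le> L n" using late by meson
    have inM: "g (n + N) t \<in> M" for n using gp(5)[of t "n + N"] t N[of "n + N"] by (simp add: L_def)
    have cau: "\<exists>K. \<forall>k\<ge>K. \<forall>n\<ge>K. d (g (k + N) t) (g (n + N) t) < e" if e: "e > 0" for e
    proof -
      have "((\<lambda>x. 2 * t * x + x\<^sup>2) \<longlongrightarrow> 2 * t * 0 + 0\<^sup>2) (at (0::real))" by (intro tendsto_intros)
      then have "\<forall>\<^sub>F x in at 0. 2 * t * x + x\<^sup>2 < e\<^sup>2" using e by (intro order_tendstoD(2)) auto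
      then obtain \<eta> where \<eta>: "\<eta> > 0" "\<And>x. x \<noteq> 0 \<Longrightarrow> \<bar>x\<bar> < \<eta> \<Longrightarrow> 2 * t * x + x\<^sup>2 < e\<^sup>2"
        unfolding eventually_at by (auto simp: dist_real_def)
      then have \<eta>': "2 * t * x + x\<^sup>2 < e\<^sup>2" if "\<bar>x\<bar> < \<eta>" for x
        using that e by (cases "x = 0") auto
      have "Cauchy (\<lambda>n. L n - real n)" using u by (rule LIMSEQ_imp_Cauchy)
      then obtain K where K: "\<And>n k. n \<ge> K \<Longrightarrow> k \<ge> K \<Longrightarrow> \<bar>(L n - real n) - (L k - real k)\<bar> < \<eta>"
        using \<eta>(1) unfolding Cauchy_def dist_real_def by meson
      have *: "d (g n t) (g k t) < e" if "n \<ge> K + N" "k \<ge> n" for n k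
      proof -
        have "(d (g n t) (g k t))\<^sup>2 < e\<^sup>2"
          using step[of t n k] t N[of n] N[of k] that \<eta>'[OF K[of n k]] by simp
        then show ?thesis using e by (simp add: power2_less_imp_less)
      qed
      show ?thesis
      proof (intro exI[of _ K] allI impI)
        fix k n assume "K \<le> k" "K \<le> n"
        then show "d (g (k + N) t) (g (n + N) t) < e"
          using *[of "k + N" "n + N"] *[of "n + N" "k + N"] mdist_commute[of m "g (n + N) t"]
          by (cases "k \<le> n") auto
      qed
    qed
    obtain x where x: "x \<in> M" "(\<lambda>n. d (g (n + N) t) x) \<longlonglongrightarrow> 0"
      using mcomplete_of_seqD[OF compl, of "\<lambda>n. g (n + N) t"] inM cau by blast
    then show ?thesis using LIMSEQ_offset[OF x(2)] by blast
  qed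
  then obtain c where c: "\<And>t. 0 \<le> t \<Longrightarrow> c t \<in> M" "\<And>t. 0 \<le> t \<Longrightarrow> (\<lambda>n. d (g n t) (c t)) \<longlonglongrightarrow> 0"
    by metis
  have inM: "\<forall>\<^sub>F n in sequentially. g n t \<in> M \<and> t \<le> L n \<and> t \<le> real n \<and> 0 < n" if "0 \<le> t" for t
    using late[of t] gp(5)[of t] that unfolding eventually_sequentially L_def by metis
  have ray: "geodesic_ray m c"
    unfolding geodesic_ray_def
  proof (intro conjI allI impI)
    show "c ` {0..} \<subseteq> M" using c(1) by auto
    fix s t :: real assume st: "0 \<le> s" "0 \<le> t"
    have "\<forall>\<^sub>F n in sequentially. \<bar>d (c s) (c t) - \<bar>s - t\<bar>\<bar> \<le> d (g n s) (c s) + d (g n t) (c t)"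
      using inM[OF st(1)] inM[OF st(2)]
    proof eventually_elim
      case (elim n)
      then have "d (g n s) (g n t) = \<bar>s - t\<bar>" using gp(6)[of s n t] st by (auto simp: L_def)
      then show ?case
        using reverse_triangle[of "c s" "g n s" "c t"] reverse_triangle[of "c t" "g n t" "g n s"] elim
          c(1)[OF st(1)] c(1)[OF st(2)]
        by (simp add: mdist_commute[of m "c s" "g n s"] mdist_commute[of m "c t" "g n t"]
            mdist_commute[of m "c t" "g n s"] mdist_commute[of m "g n t" "g n s"])
    qed
    moreover have "(\<lambda>n. d (g n s) (c s) + d (g n t) (c t)) \<longlonglongrightarrow> 0 + 0"
      by (intro tendsto_add c(2) st)
    ultimately have "\<bar>d (c s) (c t) - \<bar>s - t\<bar>\<bar> \<le> 0"
      by (intro tendsto_lowerbound[of _ "0::real" sequentially]) auto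
    then show "d (c s) (c t) = \<bar>s - t\<bar>" by simp
  qed
  have "(\<lambda>n. d p (c 0)) \<longlonglongrightarrow> 0" using c(2)[of 0] gp(1) by simp
  then have "d p (c 0) = 0" by (simp add: LIMSEQ_const_iff)
  then have c0: "c 0 = p" using p c(1)[of 0] by simp
  have bd: "d (c t) (\<sigma> t) \<le> 2 * D" if t: "0 \<le> t" for t
  proof -
    have "\<forall>\<^sub>F n in sequentially. d (c t) (\<sigma> t) - 2 * D \<le> d (g n t) (c t)"
      using inM[OF t]
    proof eventually_elim
      case (elim n)
      define l where "l = 1 - t / real n"
      have l: "0 \<le> l" "l \<le> 1" using elim t by (auto simp: l_def divide_le_eq_1)
      have n0: "0 \<le> real n" by simp
      have dn: "d (\<sigma> 0) (\<sigma> n) = n" "d (\<sigma> n) (\<sigma> 0) = n" "d (\<sigma> n) p = L n"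
        using r(2)[of 0 "real n"] r(2)[of "real n" 0] by (auto simp: L_def mdist_commute)
      have t1: "L n - l * L n = t * (L n / n)" "n - l * n = t"
        using elim by (auto simp: l_def algebra_simps)
      have "d (g n (L n - l * L n)) (\<sigma> (n - l * n)) \<le> l * D"
        using contract_to_vertex[OF geodesic_segment_reverse[OF g[of n]]
            geodesic_segment_reverse[OF ray_segment[OF \<sigma> n0]] l] dn
        by (simp add: D_def L_def[symmetric])
      also have "\<dots> \<le> D" using l by (simp add: D_def mult_left_le_one_le)
      finally have A: "d (g n (t * (L n / n))) (\<sigma> t) \<le> D" unfolding t1 .
      have L0: "0 \<le> L n" by (simp add: L_def)
      have tt: "0 \<le> t * (L n / n)" "t * (L n / n) \<le> L n"
      proof -
        show "0 \<le> t * (L n / n)" using t L0 by simp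
        have "t / n * L n \<le> L n" using elim t L0 by (intro mult_left_le_one_le) (auto simp: divide_le_eq_1)
        then show "t * (L n / n) \<le> L n" by simp
      qed
      have "d (g n t) (g n (t * (L n / n))) = \<bar>t - t * (L n / n)\<bar>"
        using gp(6)[of t n "t * (L n / n)"] elim t tt by (simp add: L_def)
      also have "t - t * (L n / n) = t / n * (n - L n)"
        using elim by (simp add: field_simps)
      also have "\<bar>t / n * (n - L n)\<bar> \<le> \<bar>n - L n\<bar>"
        unfolding abs_mult using elim t by (intro mult_left_le_one_le) (auto simp: divide_le_eq_1)
      also have "\<dots> \<le> D" using LD[of n] by simp
      finally have B: "d (g n t) (g n (t * (L n / n))) \<le> D" .
      have G: "g n (t * (L n / n)) \<in> M" using gp(5)[of "t * (L n / n)" n] tt by (simp add: L_def)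
      have "d (g n t) (\<sigma> t) \<le> 2 * D"
        using mdist_triangle[of "g n t" m "g n (t * (L n / n))" "\<sigma> t"] elim G r(1)[OF t] A B by simp
      then show ?case
        using mdist_triangle[of "c t" m "g n t" "\<sigma> t"] elim r(1)[OF t] c(1)[OF t]
        by (simp add: mdist_commute[of m "c t" "g n t"])
    qed
    then have "d (c t) (\<sigma> t) - 2 * D \<le> 0"
      using c(2)[OF t] by (intro tendsto_lowerbound[of _ "0::real" sequentially]) auto
    then show ?thesis by simp
  qed
  show thesis by (rule that[OF ray c0 _ g c(2)]) (use bd in \<open>auto simp: D_def\<close>)
qed

text \<open>The distance of two rays with a common origin is a convex function of time that vanishes at 0,
  so it cannot be bounded without being 0.\<close>

lemma asymptotic_rays_same_start:
  assumes c: "geodesic_ray m c" and c': "geodesic_ray m c'" and eq: "c 0 = c' 0"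
    and bd: "\<And>t. 0 \<le> t \<Longrightarrow> d (c t) (c' t) \<le> K" and t: "0 \<le> t"
  shows "c t = c' t"
proof -
  note r = rayD[OF c] and r' = rayD[OF c']
  have "\<forall>\<^sub>F n in at_top. d (c t) (c' t) \<le> t * K / n"
    using eventually_ge_at_top[of "t + 1"]
  proof eventually_elim
    case (elim n)
    have n: "0 \<le> n" "0 \<le> t / n" "t / n \<le> 1" using elim t by auto
    have s: "d (c 0) (c n) = n" "d (c 0) (c' n) = n" using r(2)[of 0 n] r'(2)[of 0 n] n eq by auto
    have "d (c (t / n * n)) (c' (t / n * n)) \<le> t / n * d (c n) (c' n)"
      using contract_to_vertex[OF ray_segment[OF c n(1)] ray_segment[OF c' n(1), folded eq] n(2,3)] s by simp
    also have "\<dots> \<le> t / n * K" using bd[OF n(1)] n by (intro mult_left_mono) auto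
    finally show ?case using elim t by simp
  qed
  moreover have "((\<lambda>n. t * K / n) \<longlongrightarrow> 0) at_top"
    by (rule real_tendsto_divide_at_top[OF tendsto_const filterlim_ident])
  ultimately have "d (c t) (c' t) \<le> 0"
    by (intro tendsto_lowerbound[of _ "0::real" at_top]) auto
  then show ?thesis using r(1)[OF t] r'(1)[OF t] by (metis mdist_nonneg mdist_zero order.antisym)
qed

text \<open>By uniqueness, \<open>\<tau>\<close> is the limit of geodesics from its origin to the points \<open>\<sigma> n\<close>, and an
  initial piece of these geodesics determines the distance difference at their far ends.\<close>

lemma busemann_limit_from_start:
  assumes \<sigma>: "geodesic_ray m \<sigma>" and \<tau>: "geodesic_ray m \<tau>" and as: "(\<sigma>, \<tau>) \<in> asymptotic m" and y: "y \<in> M"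
    and a: "((\<lambda>s. d y (\<sigma> s) - d (\<tau> 0) (\<sigma> s)) \<longlongrightarrow> a) at_top"
    and b: "((\<lambda>s. d y (\<tau> s) - s) \<longlongrightarrow> b) at_top"
  shows "a = b"
proof -
  define p where "p = \<tau> 0"
  note r = rayD[OF \<sigma>] and q = rayD[OF \<tau>]
  have p: "p \<in> M" using q(1) by (simp add: p_def)
  obtain c g where c: "geodesic_ray m c" "c 0 = p" "\<And>t. 0 \<le> t \<Longrightarrow> d (c t) (\<sigma> t) \<le> 2 * d p (\<sigma> 0)"
    and g: "\<And>n. geodesic_segment m (g n) p (\<sigma> (real n))"
    "\<And>t. 0 \<le> t \<Longrightarrow> (\<lambda>n. d (g n t) (c t)) \<longlonglongrightarrow> 0"
    using ray_from_point[OF \<sigma> p] by blast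
  obtain K where K: "\<And>t. 0 \<le> t \<Longrightarrow> d (\<sigma> t) (\<tau> t) \<le> K" using as unfolding asymptotic_def by auto
  have eq: "c t = \<tau> t" if "0 \<le> t" for t
  proof (rule asymptotic_rays_same_start[OF c(1) \<tau> _ _ that])
    show "c 0 = \<tau> 0" using c p_def by simp
    fix t :: real assume "0 \<le> t"
    then show "d (c t) (\<tau> t) \<le> 2 * d p (\<sigma> 0) + K"
      using mdist_triangle[OF rayD(1)[OF c(1)] r(1) q(1), of t t t] c(3) K by fastforce
  qed
  define D where "D = d y p"
  have key: "\<bar>a - (d y (\<tau> t) - t)\<bar> \<le> D\<^sup>2 / (2 * (t - D))" if t: "D < t" for t
  proof -
    have t0: "0 \<le> t" using t by (auto simp: D_def intro: order_trans[OF mdist_nonneg less_imp_le])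
    have ev: "\<forall>\<^sub>F n in sequentially. t \<le> d p (\<sigma> (real n))"
    proof -
      obtain N where N: "real N \<ge> t + d p (\<sigma> 0)" using real_arch_simple by blast
      have "t \<le> d p (\<sigma> (real n))" if "n \<ge> N" for n
        using reverse_triangle[OF p r(1)[of 0] r(1)[of "real n"]] r(2)[of 0 "real n"] N that
        by (auto simp: abs_le_iff)
      then show ?thesis unfolding eventually_sequentially by blast
    qed
    have lim1: "(\<lambda>n. d y (\<sigma> (real n)) - d p (\<sigma> (real n))) \<longlonglongrightarrow> a"
      using filterlim_compose[OF a filterlim_real_sequentially] by (simp add: p_def)
    have lim2: "(\<lambda>n. d y (g n t)) \<longlonglongrightarrow> d y (\<tau> t)"
    proof -
      have "\<forall>\<^sub>F n in sequentially. norm (d y (g n t) - d y (\<tau> t)) \<le> d (g n t) (c t)"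
        using ev
      proof eventually_elim
        case (elim n)
        then have "g n t \<in> M" using geodesic_segment_props(5)[OF g(1)[of n]] t0 by simp
        then show ?case using reverse_triangle[of "g n t" "\<tau> t" y] eq[OF t0] q(1)[OF t0] y
          by (simp add: mdist_commute[of m y])
      qed
      then have "(\<lambda>n. d y (g n t) - d y (\<tau> t)) \<longlonglongrightarrow> 0"
        using g(2)[OF t0] by (rule Lim_null_comparison)
      then show ?thesis by (simp add: LIM_zero_iff)
    qed
    have "(\<lambda>n. \<bar>(d y (\<sigma> (real n)) - d p (\<sigma> (real n))) - (d y (g n t) - t)\<bar>) \<longlonglongrightarrow> \<bar>a - (d y (\<tau> t) - t)\<bar>"
      by (intro tendsto_intros lim1 lim2)
    moreover have "\<forall>\<^sub>F n in sequentially. \<bar>(d y (\<sigma> (real n)) - d p (\<sigma> (real n))) - (d y (g n t) - t)\<bar>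
        \<le> D\<^sup>2 / (2 * (t - D))"
      using ev by eventually_elim (use far_distance_difference[OF g(1) y] t in \<open>simp add: D_def\<close>)
    ultimately show ?thesis by (intro tendsto_upperbound) auto
  qed
  have "((\<lambda>t. \<bar>a - (d y (\<tau> t) - t)\<bar>) \<longlongrightarrow> \<bar>a - b\<bar>) at_top" by (intro tendsto_intros b)
  moreover have "((\<lambda>t. D\<^sup>2 / (2 * (t - D))) \<longlongrightarrow> 0) at_top"
  proof -
    have "filterlim (\<lambda>t. - D + t) at_top at_top"
      by (rule filterlim_tendsto_add_at_top[OF tendsto_const filterlim_ident])
    from filterlim_tendsto_pos_mult_at_top[OF tendsto_const[of 2] _ this]
    have "filterlim (\<lambda>t. 2 * (t - D)) at_top at_top" by simp
    then show ?thesis by (rule real_tendsto_divide_at_top[OF tendsto_const])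
  qed
  moreover have "\<forall>\<^sub>F t in at_top. \<bar>a - (d y (\<tau> t) - t)\<bar> \<le> D\<^sup>2 / (2 * (t - D))"
    using eventually_gt_at_top[of D] by eventually_elim (rule key)
  ultimately have "\<bar>a - b\<bar> \<le> 0" by (intro tendsto_le[of at_top]) auto
  then show ?thesis by simp
qed

end

section \<open>Horofunctions on the bordification\<close>

lemma asymptotic_refl: "geodesic_ray m \<sigma> \<Longrightarrow> (\<sigma>, \<sigma>) \<in> asymptotic m"
  unfolding asymptotic_def geodesic_ray_def by (auto intro: exI[of _ 0])

lemma asymptotic_sym: "(\<sigma>, \<tau>) \<in> asymptotic m \<Longrightarrow> (\<tau>, \<sigma>) \<in> asymptotic m"
  unfolding asymptotic_def by (auto simp: mdist_commute)

lemma asymptotic_trans: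
  assumes "(\<rho>, \<sigma>) \<in> asymptotic m" "(\<sigma>, \<tau>) \<in> asymptotic m" shows "(\<rho>, \<tau>) \<in> asymptotic m"
proof -
  obtain K K' where K: "\<And>t. 0 \<le> t \<Longrightarrow> mdist m (\<rho> t) (\<sigma> t) \<le> K" "\<And>t. 0 \<le> t \<Longrightarrow> mdist m (\<sigma> t) (\<tau> t) \<le> K'"
    and r: "geodesic_ray m \<rho>" "geodesic_ray m \<sigma>" "geodesic_ray m \<tau>"
    using assms unfolding asymptotic_def by auto
  have "mdist m (\<rho> t) (\<tau> t) \<le> K + K'" if "0 \<le> t" for t
    using mdist_triangle[of "\<rho> t" m "\<sigma> t" "\<tau> t"] r K[OF that] that unfolding geodesic_ray_def by fastforce
  then show ?thesis using r unfolding asymptotic_def by auto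
qed

lemma mdist_self [simp]: "x \<in> mspace m \<Longrightarrow> mdist m x x = 0"
  by simp

lemma geom_boundaryD:
  assumes "Inr C \<in> geom_boundary m"
  shows "\<exists>\<sigma>. \<sigma> \<in> C" "\<And>\<sigma>. \<sigma> \<in> C \<Longrightarrow> geodesic_ray m \<sigma>"
    "\<And>\<sigma> \<tau>. \<sigma> \<in> C \<Longrightarrow> \<tau> \<in> C \<Longrightarrow> (\<sigma>, \<tau>) \<in> asymptotic m"
    "\<And>\<sigma> \<tau>. \<sigma> \<in> C \<Longrightarrow> (\<sigma>, \<tau>) \<in> asymptotic m \<Longrightarrow> \<tau> \<in> C"
proof -
  obtain \<rho> where \<rho>: "geodesic_ray m \<rho>" "C = asymptotic m `` {\<rho>}"
    using assms unfolding geom_boundary_def by (auto elim: quotientE)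
  show "\<exists>\<sigma>. \<sigma> \<in> C" using \<rho> asymptotic_refl by blast
  show "\<And>\<sigma>. \<sigma> \<in> C \<Longrightarrow> geodesic_ray m \<sigma>" using \<rho> unfolding asymptotic_def by auto
  show "\<And>\<sigma> \<tau>. \<sigma> \<in> C \<Longrightarrow> \<tau> \<in> C \<Longrightarrow> (\<sigma>, \<tau>) \<in> asymptotic m"
    "\<And>\<sigma> \<tau>. \<sigma> \<in> C \<Longrightarrow> (\<sigma>, \<tau>) \<in> asymptotic m \<Longrightarrow> \<tau> \<in> C"
    using \<rho> by (auto intro: asymptotic_trans asymptotic_sym)
qed

lemma geom_boundaryI:
  assumes "geodesic_ray m \<sigma>" shows "Inr (asymptotic m `` {\<sigma>}) \<in> geom_boundary m"
  using assms unfolding geom_boundary_def by (auto intro: quotientI)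

lemma geom_boundary_cases:
  assumes "\<xi> \<in> geom_boundary m" obtains C where "\<xi> = Inr C" "Inr C \<in> geom_boundary m"
  using assms unfolding geom_boundary_def by auto

lemma Inl_notin_boundary [simp]: "Inl z \<notin> geom_boundary m"
  by (auto simp: geom_boundary_def)

lemma bordification_Inl [simp]: "Inl z \<in> bordification m \<longleftrightarrow> z \<in> mspace m"
  by (auto simp: bordification_def)

lemma bordification_Inr [simp]: "Inr C \<in> bordification m \<longleftrightarrow> Inr C \<in> geom_boundary m"
  by (auto simp: bordification_def)

lemma geom_boundary_subset_bordification: "geom_boundary m \<subseteq> bordification m"
  by (auto simp: bordification_def)

text \<open>The common extension of \<open>z \<mapsto> d(x,z) - d(y,z)\<close> and the Busemann function to the
  bordification.\<close>

definition horo :: "'b metric \<Rightarrow> 'b bordpt \<Rightarrow> 'b \<Rightarrow> 'b \<Rightarrow> real" where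
  "horo m \<xi> x y = (case \<xi> of Inl z \<Rightarrow> mdist m x z - mdist m y z | Inr C \<Rightarrow> busemann m \<xi> x y)"

lemma horo_Inl [simp]: "horo m (Inl z) x y = mdist m x z - mdist m y z"
  by (simp add: horo_def)

lemma horo_Inr: "horo m (Inr C) x y = busemann m (Inr C) x y"
  by (simp add: horo_def)

text \<open>The path \<open>c\<close> is a geodesic from \<open>p\<close> towards \<open>\<xi>\<close> of length at least \<open>R\<close>. This treats
  interior and boundary points alike.\<close>

definition reaches :: "'b metric \<Rightarrow> (real \<Rightarrow> 'b) \<Rightarrow> 'b \<Rightarrow> 'b bordpt \<Rightarrow> real \<Rightarrow> bool" where
  "reaches m c p \<xi> R = (case \<xi> of Inl z \<Rightarrow> geodesic_segment m c p z \<and> R \<le> mdist m p z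
     | Inr C \<Rightarrow> c \<in> C \<and> c 0 = p)"

lemma reaches_Inl [simp]: "reaches m c p (Inl z) R \<longleftrightarrow> geodesic_segment m c p z \<and> R \<le> mdist m p z"
  by (simp add: reaches_def)

lemma reaches_Inr [simp]: "reaches m c p (Inr C) R \<longleftrightarrow> c \<in> C \<and> c 0 = p"
  by (simp add: reaches_def)

text \<open>The strict inequality in the definition of the basic neighbourhoods becomes the existence of
  a slightly longer geodesic.\<close>

lemma in_cone_nbhd_iff:
  "\<xi> \<in> cone_nbhd m c R \<epsilon> \<longleftrightarrow> \<xi> \<in> bordification m \<and>
     (\<exists>\<sigma> R'. R < R' \<and> reaches m \<sigma> (c 0) \<xi> R' \<and> mdist m (\<sigma> R) (c R) < \<epsilon>)"
proof (cases \<xi>)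
  case (Inl z)
  then show ?thesis unfolding cone_nbhd_def by (auto intro: less_le_trans)
next
  case (Inr C)
  then show ?thesis unfolding cone_nbhd_def by (auto intro: gt_ex)
qed

context proper_CN_space
begin

lemma horo_along_ray:
  assumes C: "Inr C \<in> geom_boundary m" and \<sigma>: "\<sigma> \<in> C" and x: "x \<in> M" and y: "y \<in> M"
  shows "((\<lambda>s. d x (\<sigma> s) - d y (\<sigma> s)) \<longlongrightarrow> horo m (Inr C) x y) at_top"
proof -
  define \<tau> where "\<tau> = (SOME \<tau>. \<tau> \<in> C)"
  have \<tau>: "\<tau> \<in> C" unfolding \<tau>_def using geom_boundaryD(1)[OF C] by (rule someI_ex)
  have r: "geodesic_ray m \<sigma>" "geodesic_ray m \<tau>" "(\<sigma>, \<tau>) \<in> asymptotic m"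
    using geom_boundaryD(2)[OF C \<sigma>] geom_boundaryD(2)[OF C \<tau>] geom_boundaryD(3)[OF C \<sigma> \<tau>] .
  have p: "\<tau> 0 \<in> M" using rayD(1)[OF r(2)] by simp
  have "\<exists>b. ((\<lambda>s. d z (\<sigma> s) - d (\<tau> 0) (\<sigma> s)) \<longlongrightarrow> b) at_top \<and> ((\<lambda>s. d z (\<tau> s) - s) \<longlongrightarrow> b) at_top"
    if z: "z \<in> M" for z
  proof -
    obtain a b where ab: "((\<lambda>s. d z (\<sigma> s) - d (\<tau> 0) (\<sigma> s)) \<longlongrightarrow> a) at_top" "((\<lambda>s. d z (\<tau> s) - s) \<longlongrightarrow> b) at_top"
      using busemann_limit_exists[OF r(1) z p] ray_distance_limit[OF r(2) z] by auto
    then have "a = b" using busemann_limit_from_start[OF r z] by blast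
    then show ?thesis using ab by blast
  qed
  then have "\<forall>z\<in>M. \<exists>b. ((\<lambda>s. d z (\<sigma> s) - d (\<tau> 0) (\<sigma> s)) \<longlongrightarrow> b) at_top
      \<and> ((\<lambda>s. d z (\<tau> s) - s) \<longlongrightarrow> b) at_top" by (rule ballI)
  from bchoice[OF this] obtain b where
    b: "\<And>z. z \<in> M \<Longrightarrow> ((\<lambda>s. d z (\<sigma> s) - d (\<tau> 0) (\<sigma> s)) \<longlongrightarrow> b z) at_top"
    "\<And>z. z \<in> M \<Longrightarrow> ((\<lambda>s. d z (\<tau> s) - s) \<longlongrightarrow> b z) at_top" by auto
  have "((\<lambda>s. d x (\<tau> s) - d y (\<tau> s)) \<longlongrightarrow> b x - b y) at_top"
    using tendsto_diff[OF b(2)[OF x] b(2)[OF y]] by simp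
  then have "Lim at_top (\<lambda>s. d x (\<tau> s) - d y (\<tau> s)) = b x - b y"
    by (rule tendsto_Lim[OF trivial_limit_at_top_linorder])
  then have "horo m (Inr C) x y = b x - b y"
    unfolding horo_Inr busemann_def Let_def sum.sel \<tau>_def .
  moreover have "((\<lambda>s. d x (\<sigma> s) - d y (\<sigma> s)) \<longlongrightarrow> b x - b y) at_top"
    using tendsto_diff[OF b(1)[OF x] b(1)[OF y]] by simp
  ultimately show ?thesis by (simp only:)
qed

lemma ex_reaches:
  assumes "\<xi> \<in> bordification m" "p \<in> M" "\<And>z. \<xi> = Inl z \<Longrightarrow> R \<le> d p z"
  shows "\<exists>c. reaches m c p \<xi> R"
proof (cases \<xi>)
  case (Inl z) then show ?thesis using assms ex_geodesic[of p z] by auto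
next
  case (Inr C)
  then have C: "Inr C \<in> geom_boundary m" using assms(1) by simp
  obtain \<sigma> where \<sigma>: "\<sigma> \<in> C" using geom_boundaryD(1)[OF C] by blast
  have r: "geodesic_ray m \<sigma>" using geom_boundaryD(2)[OF C \<sigma>] .
  obtain c where c: "geodesic_ray m c" "c 0 = p" "\<And>t. 0 \<le> t \<Longrightarrow> d (c t) (\<sigma> t) \<le> 2 * d p (\<sigma> 0)"
    by (rule ray_from_point[OF r assms(2)]) (rule that)
  then have "(\<sigma>, c) \<in> asymptotic m" using r unfolding asymptotic_def by (auto simp: mdist_commute[of m "\<sigma> _"])
  then have "c \<in> C" using geom_boundaryD(4)[OF C \<sigma>] by blast
  then show ?thesis using c Inr by auto
qed

definition approximates :: "(nat \<Rightarrow> 'b) \<Rightarrow> 'b bordpt \<Rightarrow> bool" where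
  "approximates w \<xi> \<longleftrightarrow> range w \<subseteq> M \<and>
     (\<forall>x\<in>M. \<forall>y\<in>M. (\<lambda>n. d x (w n) - d y (w n)) \<longlonglongrightarrow> horo m \<xi> x y)"

lemma approximatesD:
  assumes "approximates w \<xi>"
  shows "w n \<in> M" "x \<in> M \<Longrightarrow> y \<in> M \<Longrightarrow> (\<lambda>n. d x (w n) - d y (w n)) \<longlonglongrightarrow> horo m \<xi> x y"
  using assms unfolding approximates_def by auto

text \<open>Interior points on the way to \<open>\<xi>\<close> approximate all horofunctions at \<open>\<xi>\<close>. This transfers
  the estimates for geodesic segments to the bordification.\<close>

lemma reaches_approx:
  assumes \<xi>: "\<xi> \<in> bordification m" and c: "reaches m c p \<xi> R"
  obtains z where "approximates z \<xi>" "\<And>n. geodesic_segment m c p (z n)" "\<And>n. R \<le> d p (z n)"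
proof (cases \<xi>)
  case (Inl z) then show ?thesis using that[of "\<lambda>n. z"] \<xi> c by (simp add: approximates_def)
next
  case (Inr C)
  then have C: "Inr C \<in> geom_boundary m" "c \<in> C" "c 0 = p" using \<xi> c by auto
  have r: "geodesic_ray m c" using geom_boundaryD(2)[OF C(1,2)] .
  let ?z = "\<lambda>n. c (\<bar>R\<bar> + real n)"
  show ?thesis
  proof (rule that[of ?z])
    fix n
    show "geodesic_segment m c p (?z n)" using ray_segment[OF r, of "\<bar>R\<bar> + real n"] C by simp
    show "R \<le> d p (?z n)" using rayD(2)[OF r, of 0 "\<bar>R\<bar> + real n"] C by simp
  next
    have at_top: "filterlim (\<lambda>n. \<bar>R\<bar> + real n) at_top sequentially"
      by (rule filterlim_tendsto_add_at_top[OF tendsto_const filterlim_real_sequentially])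
    show "approximates ?z \<xi>"
      unfolding approximates_def Inr
    proof (intro conjI ballI)
      show "range ?z \<subseteq> M" by (intro image_subsetI rayD(1)[OF r]) simp
      fix x y assume "x \<in> M" "y \<in> M"
      from filterlim_compose[OF horo_along_ray[OF C(1,2) this] at_top]
      show "(\<lambda>n. d x (?z n) - d y (?z n)) \<longlonglongrightarrow> horo m (Inr C) x y" .
    qed
  qed
qed

lemma horo_approx:
  assumes \<xi>: "\<xi> \<in> bordification m"
  obtains z where "approximates z \<xi>"
proof -
  obtain p where "p \<in> M"
  proof (cases \<xi>)
    case (Inr C)
    then obtain \<sigma> where "geodesic_ray m \<sigma>" using \<xi> geom_boundaryD(1,2)[of C m] by auto
    then show ?thesis using that rayD(1)[of \<sigma> 0] by simp
  qed (use \<xi> that in auto)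
  obtain c where c: "reaches m c p \<xi> 0" using ex_reaches[OF \<xi> \<open>p \<in> M\<close>, of 0] by auto
  show thesis by (rule reaches_approx[OF \<xi> c]) (rule that)
qed

lemma horo_cocycle:
  assumes \<xi>: "\<xi> \<in> bordification m" and "x \<in> M" "y \<in> M" "z \<in> M"
  shows "horo m \<xi> x z = horo m \<xi> x y + horo m \<xi> y z"
proof -
  obtain w where "approximates w \<xi>" using horo_approx[OF \<xi>] by blast
  note w = approximatesD[OF this]
  have "(\<lambda>n. (d x (w n) - d y (w n)) + (d y (w n) - d z (w n))) \<longlonglongrightarrow> horo m \<xi> x y + horo m \<xi> y z"
    by (intro tendsto_add w assms)
  then show ?thesis using w(2)[of x z] assms by (intro LIMSEQ_unique[of "\<lambda>n. d x (w n) - d z (w n)"]) auto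
qed

lemma horo_bound:
  assumes \<xi>: "\<xi> \<in> bordification m" and xy: "x \<in> M" "y \<in> M"
  shows "\<bar>horo m \<xi> x y\<bar> \<le> d x y"
proof -
  obtain w where "approximates w \<xi>" using horo_approx[OF \<xi>] by blast
  note w = approximatesD[OF this]
  have "(\<lambda>n. \<bar>d x (w n) - d y (w n)\<bar>) \<longlonglongrightarrow> \<bar>horo m \<xi> x y\<bar>" by (intro tendsto_intros w xy)
  then show ?thesis
    by (rule tendsto_upperbound) (use reverse_triangle[OF xy w(1)] in auto)
qed

lemma horo_self: "horo m \<xi> x x = 0"
  unfolding horo_def busemann_def by (auto split: sum.splits intro!: tendsto_Lim)

lemma reaches_points:
  assumes \<xi>: "\<xi> \<in> bordification m" and c: "reaches m c p \<xi> R" and t: "0 \<le> t" "t \<le> R"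
  shows "c t \<in> M" "d p (c t) = t" "horo m \<xi> (c t) p = - t" "p \<in> M"
proof -
  obtain w where w: "approximates w \<xi>" "\<And>n. geodesic_segment m c p (w n)" "\<And>n. R \<le> d p (w n)"
    using reaches_approx[OF \<xi> c] by blast
  note lim = approximatesD(2)[OF w(1)]
  note gp = geodesic_segment_props[OF w(2)]
  have tw: "t \<le> d p (w n)" for n using t w(3)[of n] by simp
  show ct: "c t \<in> M" "d p (c t) = t" "p \<in> M" using gp(5)[of t 0] gp(7)[of t 0] gp(3) tw t by auto
  have "(\<lambda>n. d (c t) (w n) - d p (w n)) = (\<lambda>n. - t)" using gp(8) tw t by auto
  then show "horo m \<xi> (c t) p = - t"
    using lim[OF ct(1,3)] by (simp add: LIMSEQ_const_iff)
qed

lemma almost_on_geodesic_horo: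
  assumes \<xi>: "\<xi> \<in> bordification m" and c: "reaches m c p \<xi> R" and t: "0 \<le> t" "t \<le> R"
    and q: "q \<in> M" "d p q = t"
  shows "(d q (c t))\<^sup>2 \<le> 2 * t * (horo m \<xi> q p + t) + (horo m \<xi> q p + t)\<^sup>2"
proof -
  obtain w where w: "approximates w \<xi>" "\<And>n. geodesic_segment m c p (w n)" "\<And>n. R \<le> d p (w n)"
    using reaches_approx[OF \<xi> c] by blast
  note lim = approximatesD(2)[OF w(1)]
  have p: "p \<in> M" using geodesic_segment_props(3)[OF w(2)] .
  have "(d q (c t))\<^sup>2 \<le> 2 * t * (d q (w n) - d p (w n) + t) + (d q (w n) - d p (w n) + t)\<^sup>2" for n
    using almost_on_geodesic[OF w(2) t(1) _ q, of n] w(3)[of n] t by simp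
  moreover have "(\<lambda>n. 2 * t * (d q (w n) - d p (w n) + t) + (d q (w n) - d p (w n) + t)\<^sup>2)
      \<longlonglongrightarrow> 2 * t * (horo m \<xi> q p + t) + (horo m \<xi> q p + t)\<^sup>2"
    by (intro tendsto_intros lim q p)
  ultimately show ?thesis by (intro LIMSEQ_le_const) auto
qed

lemma horo_from_initial_piece:
  assumes \<xi>: "\<xi> \<in> bordification m" and c: "reaches m c p \<xi> R" and y: "y \<in> M" and t: "d y p < t" "t \<le> R"
  shows "\<bar>horo m \<xi> y p - (d y (c t) - t)\<bar> \<le> (d y p)\<^sup>2 / (2 * (t - d y p))"
proof -
  obtain w where w: "approximates w \<xi>" "\<And>n. geodesic_segment m c p (w n)" "\<And>n. R \<le> d p (w n)"
    using reaches_approx[OF \<xi> c] by blast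
  note lim = approximatesD(2)[OF w(1)]
  have p: "p \<in> M" using geodesic_segment_props(3)[OF w(2)] .
  have "\<bar>(d y (w n) - d p (w n)) - (d y (c t) - t)\<bar> \<le> (d y p)\<^sup>2 / (2 * (t - d y p))" for n
    using far_distance_difference[OF w(2) y t(1), of n] w(3)[of n] t by simp
  moreover have "(\<lambda>n. \<bar>(d y (w n) - d p (w n)) - (d y (c t) - t)\<bar>) \<longlonglongrightarrow> \<bar>horo m \<xi> y p - (d y (c t) - t)\<bar>"
    by (intro tendsto_intros lim y p)
  ultimately show ?thesis by (intro LIMSEQ_le_const2) auto
qed

section \<open>The cone topology is the horofunction topology\<close>

abbreviation T :: "'b bordpt topology" where "T \<equiv> cone_topology m"

lemma openin_ball: "x \<in> M \<Longrightarrow> r > 0 \<Longrightarrow> openin T (Inl ` mball_of m x r)"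
  unfolding cone_topology_def by (rule topology_generated_by_Basis) blast

lemma openin_cone_nbhd: "geodesic_ray m c \<Longrightarrow> R > 0 \<Longrightarrow> \<epsilon> > 0 \<Longrightarrow> openin T (cone_nbhd m c R \<epsilon>)"
  unfolding cone_topology_def by (rule topology_generated_by_Basis) blast

lemma ray_end_in_cone_nbhd:
  assumes "Inr C \<in> geom_boundary m" "c \<in> C" "\<epsilon> > 0" "0 < R" shows "Inr C \<in> cone_nbhd m c R \<epsilon>"
  unfolding in_cone_nbhd_iff
  using assms rayD(1)[OF geom_boundaryD(2)[OF assms(1,2)], of R] by (auto intro!: exI[of _ c] gt_ex)

lemma topspace_T: "topspace T = bordification m"
proof
  show "topspace T \<subseteq> bordification m"
    unfolding cone_topology_def topology_generated_by_topspace by (auto simp: in_cone_nbhd_iff)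
  show "bordification m \<subseteq> topspace T"
  proof
    fix \<xi> assume \<xi>: "\<xi> \<in> bordification m"
    show "\<xi> \<in> topspace T"
    proof (cases \<xi>)
      case (Inl z)
      then have z: "z \<in> M" using \<xi> by simp
      have "openin T (Inl ` mball_of m z 1)" "\<xi> \<in> Inl ` mball_of m z 1"
        using openin_ball[OF z] z Inl by auto
      then show ?thesis using openin_subset by blast
    next
      case (Inr C)
      then have C: "Inr C \<in> geom_boundary m" using \<xi> by simp
      obtain c where c: "c \<in> C" using geom_boundaryD(1)[OF C] by blast
      have "openin T (cone_nbhd m c 1 1)" "\<xi> \<in> cone_nbhd m c 1 1"
        using openin_cone_nbhd[OF geom_boundaryD(2)[OF C c], of 1 1] ray_end_in_cone_nbhd[OF C c, of 1 1] Inr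
        by auto
      then show ?thesis using openin_subset by blast
    qed
  qed
qed

lemma openin_interior: "openin T (Inl ` M)"
proof -
  have "Inl ` M = (\<Union>x\<in>M. Inl ` mball_of m x 1)" by auto
  then show ?thesis using openin_ball by (metis (no_types, lifting) imageE openin_Union zero_less_one)
qed

text \<open>At a boundary point, a cone neighbourhood of large radius fixes the initial piece of the
  geodesics from \<open>p\<close>, hence the horofunction up to a small error.\<close>

lemma continuous_horo:
  assumes y: "y \<in> M" and p: "p \<in> M"
  shows "continuous_map T euclideanreal (\<lambda>\<xi>. horo m \<xi> y p)"
proof -
  have "\<exists>U. openin T U \<and> \<xi> \<in> U \<and> (\<forall>\<eta>\<in>U. \<bar>horo m \<eta> y p - horo m \<xi> y p\<bar> < \<epsilon>)"
    if \<xi>: "\<xi> \<in> bordification m" and \<epsilon>: "\<epsilon> > 0" for \<xi> \<epsilon>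
  proof (cases \<xi>)
    case (Inl z)
    then have z: "z \<in> M" using \<xi> by simp
    have "\<bar>horo m (Inl x) y p - horo m \<xi> y p\<bar> < \<epsilon>" if x: "x \<in> mball_of m z (\<epsilon>/2)" for x
    proof -
      have "x \<in> M" "d x z < \<epsilon> / 2" using x by (simp_all add: mdist_commute)
      then show ?thesis
        using reverse_triangle[of x z y] reverse_triangle[of x z p] y p z
        unfolding Inl horo_Inl mdist_commute[of m y] mdist_commute[of m p] by linarith
    qed
    then show ?thesis using openin_ball[OF z, of "\<epsilon>/2"] z Inl \<epsilon>
      by (intro exI[of _ "Inl ` mball_of m z (\<epsilon>/2)"]) auto
  next
    case (Inr C)
    then have C: "Inr C \<in> geom_boundary m" using \<xi> by simp
    obtain c where c: "c \<in> C" "c 0 = p" using ex_reaches[OF \<xi> p, of 0] Inr by auto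
    define D where "D = d y p"
    \<comment> \<open>a radius that makes the error of the initial piece smaller than a quarter of the tolerance\<close>
    define R where "R = D + (2 * D\<^sup>2 / \<epsilon> + 1)"
    have D: "D \<ge> 0" by (simp add: D_def)
    have "0 \<le> 2 * D\<^sup>2 / \<epsilon>" using \<epsilon> by simp
    then have R: "D < R" "0 < R" using D by (auto simp: R_def)
    have err: "D\<^sup>2 / (2 * (R - D)) < \<epsilon> / 4"
    proof -
      have "D\<^sup>2 < \<epsilon> / 4 * (2 * (R - D))" using \<epsilon> by (simp add: R_def field_simps)
      then show ?thesis using R by (simp add: divide_less_eq)
    qed
    let ?U = "cone_nbhd m c R (\<epsilon>/4)"
    have near: "\<bar>horo m \<eta> y p - (d y (c R) - R)\<bar> < \<epsilon> / 2" if "\<eta> \<in> ?U" for \<eta>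
    proof -
      obtain \<sigma> R' where \<sigma>: "R < R'" "reaches m \<sigma> p \<eta> R'" "d (\<sigma> R) (c R) < \<epsilon>/4" and \<eta>: "\<eta> \<in> bordification m"
        using \<open>\<eta> \<in> ?U\<close> c unfolding in_cone_nbhd_iff by auto
      have "\<bar>horo m \<eta> y p - (d y (\<sigma> R) - R)\<bar> < \<epsilon> / 4"
        by (rule le_less_trans[OF horo_from_initial_piece[OF \<eta> \<sigma>(2) y] err[unfolded D_def]])
          (use R \<sigma>(1) in \<open>auto simp: D_def\<close>)
      moreover have "\<bar>d y (\<sigma> R) - d y (c R)\<bar> < \<epsilon> / 4"
        using reverse_triangle[of "\<sigma> R" "c R" y] \<sigma> y reaches_points(1)[OF \<eta> \<sigma>(2), of R] R
          rayD(1)[OF geom_boundaryD(2)[OF C c(1)], of R]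
        by (simp add: mdist_commute[of m _ y])
      ultimately show ?thesis by linarith
    qed
    have "\<xi> \<in> ?U" using ray_end_in_cone_nbhd[OF C c(1)] \<epsilon> R Inr by simp
    moreover have "openin T ?U" using openin_cone_nbhd[OF geom_boundaryD(2)[OF C c(1)]] R \<epsilon> by simp
    moreover have "\<bar>horo m \<eta> y p - horo m \<xi> y p\<bar> < \<epsilon>" if "\<eta> \<in> ?U" for \<eta>
      using near[OF that] near[OF \<open>\<xi> \<in> ?U\<close>] by linarith
    ultimately show ?thesis by blast
  qed
  then show ?thesis
    unfolding mtopology_is_euclidean[symmetric] Met_TC.continuous_map_to_metric
    by (auto simp: topspace_T dist_real_def abs_minus_commute)
qed

definition horo_nbhd :: "'b \<Rightarrow> 'b bordpt \<Rightarrow> 'b set \<Rightarrow> real \<Rightarrow> 'b bordpt set" where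
  "horo_nbhd b \<xi> F \<kappa> = {\<eta> \<in> bordification m. \<forall>y\<in>F. \<bar>horo m \<eta> y b - horo m \<xi> y b\<bar> < \<kappa>}"

text \<open>Whether \<open>\<eta>\<close> lies in a cone neighbourhood is decided by the horofunction at three points:
  the vertex, the point of the geodesic to \<open>\<xi>\<close> on the sphere of radius \<open>R\<close>, and a slightly
  farther point of this geodesic, which forces \<open>\<eta>\<close> to lie outside the ball. An interior point is
  separated from everything outside a ball by a finite net of the ball. This is where properness is
  used.\<close>

lemma open_contains_horo_nbhd:
  assumes "openin T U" "\<xi> \<in> U" and b: "b \<in> M"
  shows "\<exists>F \<kappa>. finite F \<and> F \<subseteq> M \<and> \<kappa> > 0 \<and> horo_nbhd b \<xi> F \<kappa> \<subseteq> U"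
  using openin_topology_generated_by[OF assms(1)[unfolded cone_topology_def]] assms(2)
proof (induction U rule: generate_topology_on.induct)
  case Empty then show ?case by simp
next
  case (Int U V)
  then have "\<xi> \<in> U" "\<xi> \<in> V" by auto
  from Int.IH(1)[OF \<open>\<xi> \<in> U\<close>] obtain F \<kappa> where F: "finite F" "F \<subseteq> M" "\<kappa> > 0"
    "horo_nbhd b \<xi> F \<kappa> \<subseteq> U" by blast
  from Int.IH(2)[OF \<open>\<xi> \<in> V\<close>] obtain F' \<kappa>' where F': "finite F'" "F' \<subseteq> M" "\<kappa>' > 0"
    "horo_nbhd b \<xi> F' \<kappa>' \<subseteq> V" by blast
  show ?case using F F' by (intro exI[of _ "F \<union> F'"] exI[of _ "min \<kappa> \<kappa>'"]) (auto simp: horo_nbhd_def subset_iff)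
next
  case (UN K)
  then obtain U where U: "U \<in> K" "\<xi> \<in> U" by auto
  from UN.IH[OF U] obtain F \<kappa> where "finite F" "F \<subseteq> M" "\<kappa> > 0"
    "horo_nbhd b \<xi> F \<kappa> \<subseteq> U" by blast
  then show ?case using U(1) by (intro exI[of _ F] exI[of _ \<kappa>]) auto
next
  case (Basis U)
  have diff: "\<bar>horo m \<eta> x y - horo m \<xi> x y\<bar> < 2 * \<kappa>"
    if "\<bar>horo m \<eta> x b - horo m \<xi> x b\<bar> < \<kappa>" "\<bar>horo m \<eta> y b - horo m \<xi> y b\<bar> < \<kappa>"
      "\<eta> \<in> bordification m" "\<xi> \<in> bordification m" "x \<in> M" "y \<in> M" for \<eta> x y \<kappa>
    using horo_cocycle[OF that(3) that(5,6) b] horo_cocycle[OF that(4) that(5,6) b] that(1,2) by linarith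
  from Basis consider (ball) x r where "U = Inl ` mball_of m x r" "x \<in> M" "r > 0"
    | (cone) c R \<epsilon> where "U = cone_nbhd m c R \<epsilon>" "geodesic_ray m c" "R > 0" "\<epsilon> > 0" by auto
  then show ?case
  proof cases
    case ball
    then obtain w where w: "\<xi> = Inl w" "w \<in> M" "d x w < r" using Basis by auto
    then have \<xi>: "\<xi> \<in> bordification m" by simp
    define r' where "r' = r - d x w"
    have r': "r' > 0" using w by (simp add: r'_def)
    have sub: "y \<in> mball_of m x r" if "y \<in> M" "d w y < r'" for y
      using that mdist_triangle[of x m w y] ball w by (simp add: r'_def)
    obtain K where K: "finite K" "K \<subseteq> M" "\<And>x. x \<in> M \<Longrightarrow> d w x \<le> r' \<Longrightarrow> \<exists>k\<in>K. d k x < r'/4"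
      using balls_totally_boundedD[OF proper w(2), of "r'/4" r'] r' by auto
    have "\<eta> \<in> U" if \<eta>: "\<eta> \<in> bordification m"
      and close: "\<forall>y\<in>insert w K. \<bar>horo m \<eta> y b - horo m \<xi> y b\<bar> < r'/4" for \<eta>
    proof (rule ccontr)
      assume "\<eta> \<notin> U"
      then have "r' \<le> d w z" if "\<eta> = Inl z" for z
        using sub[of z] \<eta> that ball by (force simp: not_less)
      then obtain \<sigma> where \<sigma>: "reaches m \<sigma> w \<eta> r'" using ex_reaches[OF \<eta> w(2)] by blast
      define v where "v = \<sigma> r'"
      have v: "v \<in> M" "d w v = r'" "horo m \<eta> v w = - r'"
        using reaches_points[OF \<eta> \<sigma>, of r'] r' by (auto simp: v_def)
      obtain k where k: "k \<in> K" "d k v < r'/4" using K(3) v by auto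
      then have kM: "k \<in> M" using K by auto
      have "\<bar>horo m \<eta> k w - horo m \<xi> k w\<bar> < 2 * (r'/4)"
        using diff[of \<eta> k "r'/4" w] close k kM \<eta> \<xi> w by auto
      moreover have "horo m \<eta> k w \<le> r'/4 - r'"
        using horo_cocycle[OF \<eta> kM v(1) w(2)] horo_bound[OF \<eta> kM v(1)] v k by simp
      moreover have "horo m \<xi> k w \<ge> r' - r'/4"
        using mdist_triangle[of w m k v] w k kM v by (simp add: mdist_commute[of m w k])
      ultimately show False using r' by linarith
    qed
    then show ?thesis using K w r'
      by (intro exI[of _ "insert w K"] exI[of _ "r'/4"]) (auto simp: horo_nbhd_def)
  next
    case cone
    define p where "p = c 0"
    obtain \<sigma> R1 where \<sigma>: "R < R1" "reaches m \<sigma> p \<xi> R1" "d (\<sigma> R) (c R) < \<epsilon>" and \<xi>: "\<xi> \<in> bordification m"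
      using Basis(2)[unfolded cone(1) in_cone_nbhd_iff] unfolding p_def by blast
    define q q1 where "q = \<sigma> R" and "q1 = \<sigma> R1"
    have q: "q \<in> M" "d p q = R" "horo m \<xi> q p = - R" "p \<in> M"
      using reaches_points[OF \<xi> \<sigma>(2), of R] \<sigma>(1) cone by (auto simp: q_def)
    have q1: "q1 \<in> M" "d p q1 = R1" "horo m \<xi> q1 p = - R1"
      using reaches_points[OF \<xi> \<sigma>(2), of R1] \<sigma>(1) cone by (auto simp: q1_def)
    define e where "e = \<epsilon> - d q (c R)"
    have e: "e > 0" using \<sigma> by (simp add: e_def q_def)
    have cR: "c R \<in> M" using rayD(1)[OF cone(2)] cone by simp
    have "((\<lambda>x. 2 * R * x + x\<^sup>2) \<longlongrightarrow> 2 * R * 0 + 0\<^sup>2) (at_right (0::real))" by (intro tendsto_intros)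
    then have "\<forall>\<^sub>F x in at_right 0. 2 * R * x + x\<^sup>2 < e\<^sup>2" using e by (intro order_tendstoD(2)) auto
    then obtain \<eta>0 where \<eta>0: "\<eta>0 > 0" "\<And>x. 0 < x \<Longrightarrow> x < \<eta>0 \<Longrightarrow> 2 * R * x + x\<^sup>2 < e\<^sup>2"
      unfolding eventually_at_right_field by auto
    define \<kappa> where "\<kappa> = min (\<eta>0 / 4) ((R1 - R) / 4)"
    have k1: "\<kappa> > 0" using \<eta>0(1) \<sigma>(1) by (simp add: \<kappa>_def)
    have "\<kappa> \<le> \<eta>0 / 4" unfolding \<kappa>_def by (rule min.cobounded1)
    then have k2: "2 * \<kappa> < \<eta>0" using \<eta>0(1) by simp
    have "\<kappa> \<le> (R1 - R) / 4" unfolding \<kappa>_def by (rule min.cobounded2)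
    then have k3: "2 * \<kappa> < R1 - R" using k1 by simp
    note \<kappa> = k1 k2 k3
    have "\<eta> \<in> U" if \<eta>: "\<eta> \<in> bordification m"
      and close: "\<forall>y\<in>{p, q, q1}. \<bar>horo m \<eta> y b - horo m \<xi> y b\<bar> < \<kappa>" for \<eta>
    proof -
      have D: "\<bar>horo m \<eta> q p - horo m \<xi> q p\<bar> < 2 * \<kappa>" "\<bar>horo m \<eta> q1 p - horo m \<xi> q1 p\<bar> < 2 * \<kappa>"
        using diff[of \<eta> q \<kappa> p] diff[of \<eta> q1 \<kappa> p] close \<eta> \<xi> q q1 by auto
      define R2 where "R2 = R1 - 2 * \<kappa>"
      have R2: "R < R2" using \<kappa> by (simp add: R2_def)
      have far: "R2 \<le> d p z" if "\<eta> = Inl z" for z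
      proof -
        have "d q1 z - d p z < - R2" using D(2) q1 that by (simp add: R2_def)
        then show ?thesis using mdist_nonneg[of m q1 z] by linarith
      qed
      obtain \<tau> where \<tau>: "reaches m \<tau> p \<eta> R2" using ex_reaches[OF \<eta> q(4) far] by blast
      define x where "x = horo m \<eta> q p + R"
      have x: "x < 2 * \<kappa>" using D(1) q by (simp add: x_def)
      have x0: "0 \<le> x" using horo_bound[OF \<eta> q(1,4)] q(2) by (simp add: x_def mdist_commute)
      have "(d q (\<tau> R))\<^sup>2 \<le> 2 * R * x + x\<^sup>2"
        using almost_on_geodesic_horo[OF \<eta> \<tau> _ _ q(1,2)] R2 cone by (simp add: x_def)
      also have "\<dots> \<le> 2 * R * (2 * \<kappa>) + (2 * \<kappa>)\<^sup>2"
        using x x0 cone by (intro add_mono mult_left_mono power_mono) auto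
      also have "\<dots> < e\<^sup>2" using \<eta>0(2)[of "2 * \<kappa>"] \<kappa> by simp
      finally have "d q (\<tau> R) < e" using e by (simp add: power2_less_imp_less)
      moreover have "\<tau> R \<in> M" using reaches_points(1)[OF \<eta> \<tau>] R2 cone by simp
      ultimately have "d (\<tau> R) (c R) < \<epsilon>"
        using mdist_triangle[of "\<tau> R" m q "c R"] q cR by (simp add: e_def mdist_commute[of m q "\<tau> R"])
      then show ?thesis unfolding cone(1) in_cone_nbhd_iff using \<eta> \<tau> R2 by (auto simp: p_def)
    qed
    then show ?thesis using q q1 \<kappa>
      by (intro exI[of _ "{p, q, q1}"] exI[of _ \<kappa>]) (auto simp: horo_nbhd_def)
  qed
qed

lemma dense_sequence:
  assumes b: "b \<in> M"
  obtains ys :: "nat \<Rightarrow> 'b" where "\<And>n. ys n \<in> M" "\<And>x e. x \<in> M \<Longrightarrow> e > 0 \<Longrightarrow> \<exists>n. d (ys n) x < e"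
proof -
  have "\<exists>K. finite K \<and> K \<subseteq> M \<and> (\<forall>x\<in>M. d b x \<le> real i \<longrightarrow> (\<exists>k\<in>K. d k x < inverse (real (Suc j))))" for i j
    using balls_totally_boundedD[OF proper b, of "inverse (real (Suc j))" "real i"] by (metis inverse_positive_iff_positive of_nat_0_less_iff zero_less_Suc)
  then obtain K where K: "\<And>i j. finite (K i j)" "\<And>i j. K i j \<subseteq> M"
    "\<And>i j x. x \<in> M \<Longrightarrow> d b x \<le> real i \<Longrightarrow> \<exists>k\<in>K i j. d k x < inverse (real (Suc j))"
    by metis
  define S where "S = insert b (\<Union>i j. K i j)"
  have S: "countable S" "S \<noteq> {}"
    unfolding S_def using K(1) by (auto intro!: countable_UN countable_insert intro: countable_finite)
  have SM: "S \<subseteq> M" unfolding S_def using K(2) b by blast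
  show thesis
  proof (rule that[of "from_nat_into S"])
    fix n show "from_nat_into S n \<in> M" using from_nat_into[OF S(2)] SM by blast
  next
    fix x and e :: real assume x: "x \<in> M" and e: "e > 0"
    obtain j where j: "inverse (real (Suc j)) < e" using reals_Archimedean[OF e] by blast
    obtain i where "d b x \<le> real i" using real_arch_simple by blast
    from K(3)[OF x this, of j] obtain k where "k \<in> K i j" "d k x < e" using j by force
    then have "k \<in> S" by (auto simp: S_def)
    then obtain n where "from_nat_into S n = k" using S(1) by (metis from_nat_into_surj)
    then show "\<exists>n. d (from_nat_into S n) x < e" using \<open>d k x < e\<close> by blast
  qed
qed

lemma open_is_cozero_metric:
  fixes V :: "'c::metric_space set"
  assumes "open V"
  obtains g :: "'c \<Rightarrow> real" where "continuous_on UNIV g" "\<And>x. 0 \<le> g x" "\<And>x. g x \<le> 1" "\<And>x. 0 < g x \<longleftrightarrow> x \<in> V"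
proof (cases "V = UNIV")
  case True
  then show ?thesis using that[of "\<lambda>x. 1"] by auto
next
  case False
  then have ne: "- V \<noteq> {}" by auto
  show ?thesis
  proof (rule that[of "\<lambda>x. min 1 (infdist x (- V))"])
    show "continuous_on UNIV (\<lambda>x. min 1 (infdist x (- V)))" by (intro continuous_intros)
    fix x
    have "infdist x (- V) = 0 \<longleftrightarrow> x \<notin> V"
      using in_closed_iff_infdist_zero[of "- V" x] assms ne by auto
    then show "0 < min 1 (infdist x (- V)) \<longleftrightarrow> x \<in> V" using infdist_nonneg[of x "- V"] by auto
  qed (auto intro: infdist_nonneg)
qed

text \<open>The horofunctions at a dense sequence of points embed the compactification into a metrizable
  space, so that every open set of the cone topology is the set of positivity of a continuous
  function. Metrizability enters the measure theory in this form.\<close>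

lemma open_is_cozero:
  assumes U: "openin T U" and b: "b \<in> M"
  obtains g where "continuous_map T euclideanreal g" "\<And>\<xi>. 0 \<le> g \<xi>" "\<And>\<xi>. g \<xi> \<le> 1"
    "\<And>\<xi>. \<xi> \<in> topspace T \<Longrightarrow> 0 < g \<xi> \<longleftrightarrow> \<xi> \<in> U"
proof -
  obtain ys where ys: "\<And>n::nat. ys n \<in> M" "\<And>x e. x \<in> M \<Longrightarrow> e > 0 \<Longrightarrow> \<exists>n. d (ys n) x < e"
    using dense_sequence[OF b] by blast
  define \<Phi> where "\<Phi> \<xi> = (\<lambda>n. horo m \<xi> (ys n) b)" for \<xi>
  have cont: "continuous_map T euclidean \<Phi>"
    unfolding euclidean_product_topology[symmetric] continuous_map_componentwise_UNIV \<Phi>_def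
    using continuous_horo[OF ys(1) b] by simp
  have single: "\<exists>W. open W \<and> \<Phi> \<xi> \<in> W \<and> (\<forall>\<eta>\<in>bordification m. \<Phi> \<eta> \<in> W \<longrightarrow> \<bar>horo m \<eta> y b - horo m \<xi> y b\<bar> < \<kappa>)"
    if \<xi>: "\<xi> \<in> bordification m" and y: "y \<in> M" and \<kappa>: "\<kappa> > 0" for \<xi> y \<kappa>
  proof -
    obtain n where n: "d (ys n) y < \<kappa> / 4" using ys(2)[OF y, of "\<kappa>/4"] \<kappa> by auto
    let ?W = "{f. \<bar>f n - \<Phi> \<xi> n\<bar> < \<kappa> / 4}"
    have "open ?W"
      by (intro open_Collect_less continuous_intros continuous_on_product_coordinates)
    moreover have "\<bar>horo m \<eta> y b - horo m \<xi> y b\<bar> < \<kappa>" if \<eta>: "\<eta> \<in> bordification m" "\<Phi> \<eta> \<in> ?W" for \<eta>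
    proof -
      have "\<bar>horo m \<eta> y (ys n)\<bar> < \<kappa>/4" "\<bar>horo m \<xi> y (ys n)\<bar> < \<kappa>/4"
        using horo_bound[OF \<eta>(1) y ys(1)[of n]] horo_bound[OF \<xi> y ys(1)[of n]] n
        by (simp_all add: mdist_commute[of m y])
      moreover have "\<bar>horo m \<eta> (ys n) b - horo m \<xi> (ys n) b\<bar> < \<kappa>/4" using \<eta>(2) by (simp add: \<Phi>_def)
      ultimately show ?thesis
        using horo_cocycle[OF \<eta>(1) y ys(1)[of n] b] horo_cocycle[OF \<xi> y ys(1)[of n] b] by linarith
    qed
    ultimately show ?thesis using \<kappa> by (intro exI[of _ ?W]) auto
  qed
  have nbhd: "\<exists>W. open W \<and> \<Phi> \<xi> \<in> W \<and> (\<forall>\<eta>\<in>bordification m. \<Phi> \<eta> \<in> W \<longrightarrow> \<eta> \<in> U)" if \<xi>U: "\<xi> \<in> U" for \<xi>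
  proof -
    have \<xi>: "\<xi> \<in> bordification m" using openin_subset[OF U] \<xi>U by (auto simp: topspace_T)
    obtain F \<kappa> where F: "finite F" "F \<subseteq> M" "\<kappa> > 0"
      "horo_nbhd b \<xi> F \<kappa> \<subseteq> U"
      using open_contains_horo_nbhd[OF U \<xi>U b] by blast
    have "\<forall>y\<in>F. \<exists>W. open W \<and> \<Phi> \<xi> \<in> W \<and> (\<forall>\<eta>\<in>bordification m. \<Phi> \<eta> \<in> W \<longrightarrow> \<bar>horo m \<eta> y b - horo m \<xi> y b\<bar> < \<kappa>)"
      using single[OF \<xi> _ F(3)] F(2) by blast
    then obtain W where W: "\<And>y. y \<in> F \<Longrightarrow> open (W y)" "\<And>y. y \<in> F \<Longrightarrow> \<Phi> \<xi> \<in> W y"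
      "\<And>y \<eta>. y \<in> F \<Longrightarrow> \<eta>\<in>bordification m \<Longrightarrow> \<Phi> \<eta> \<in> W y \<Longrightarrow> \<bar>horo m \<eta> y b - horo m \<xi> y b\<bar> < \<kappa>"
      by metis
    show ?thesis
    proof (intro exI[of _ "\<Inter>y\<in>F. W y"] conjI ballI impI)
      show "open (\<Inter>y\<in>F. W y)" using F(1) W(1) by auto
      show "\<Phi> \<xi> \<in> (\<Inter>y\<in>F. W y)" using W(2) by auto
      fix \<eta> assume "\<eta> \<in> bordification m" "\<Phi> \<eta> \<in> (\<Inter>y\<in>F. W y)"
      then show "\<eta> \<in> U" using F(4) W(3) by (auto simp: horo_nbhd_def)
    qed
  qed
  define V where "V = \<Union>{W. open W \<and> (\<forall>\<eta>\<in>bordification m. \<Phi> \<eta> \<in> W \<longrightarrow> \<eta> \<in> U)}"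
  have "open V" by (auto simp: V_def)
  then obtain g :: "(nat \<Rightarrow> real) \<Rightarrow> real" where g: "continuous_on UNIV g" "\<And>x. 0 \<le> g x" "\<And>x. g x \<le> 1" "\<And>x. 0 < g x \<longleftrightarrow> x \<in> V"
    using open_is_cozero_metric by blast
  show thesis
  proof (rule that[of "g \<circ> \<Phi>"])
    show "continuous_map T euclideanreal (g \<circ> \<Phi>)"
      using cont g(1) by (intro continuous_map_compose[OF cont]) (simp add: continuous_map_iff_continuous)
    show "0 < (g \<circ> \<Phi>) \<xi> \<longleftrightarrow> \<xi> \<in> U" if "\<xi> \<in> topspace T" for \<xi>
      using nbhd[of \<xi>] that g(4)[of "\<Phi> \<xi>"] by (auto simp: V_def topspace_T)
  qed (use g in auto)
qed

end

section \<open>Measures on spaces in which open sets are cozero sets\<close>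

definition opens_cozero :: "'c topology \<Rightarrow> bool" where
  "opens_cozero S \<longleftrightarrow> (\<forall>U. openin S U \<longrightarrow> (\<exists>g. continuous_map S euclideanreal g \<and>
     (\<forall>x. 0 \<le> g x \<and> g x \<le> 1) \<and> (\<forall>x\<in>topspace S. 0 < g x \<longleftrightarrow> x \<in> U)))"

lemma opens_cozeroE:
  assumes "opens_cozero S" "openin S U"
  obtains g where "continuous_map S euclideanreal g" "\<And>x. 0 \<le> g x" "\<And>x. g x \<le> 1"
    "\<And>x. x \<in> topspace S \<Longrightarrow> 0 < g x \<longleftrightarrow> x \<in> U"
proof -
  have "\<exists>g. continuous_map S euclideanreal g \<and>
     (\<forall>x. 0 \<le> g x \<and> g x \<le> 1) \<and> (\<forall>x\<in>topspace S. 0 < g x \<longleftrightarrow> x \<in> U)"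
    using assms unfolding opens_cozero_def by simp
  then show thesis using that by auto
qed

lemma sets_borel_of: "sets (borel_of S) = sigma_sets (topspace S) {U. openin S U}"
  unfolding borel_of_def by (rule sets_measure_of) (auto dest: openin_subset)

lemma space_borel_of [simp]: "space (borel_of S) = topspace S"
  unfolding borel_of_def by (rule space_measure_of) (auto dest: openin_subset)

lemma open_in_borel_of: "openin S U \<Longrightarrow> U \<in> sets (borel_of S)"
  unfolding sets_borel_of by (rule sigma_sets.Basic) simp

lemma continuous_map_borel_measurable:
  fixes f :: "_ \<Rightarrow> real"
  assumes "continuous_map S euclideanreal f" shows "f \<in> borel_measurable (borel_of S)"
proof (rule borel_measurableI)
  fix V :: "real set" assume "open V"
  then have "openin S {x \<in> topspace S. f x \<in> V}" using assms by (auto simp: continuous_map_def)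
  then show "f -` V \<inter> space (borel_of S) \<in> sets (borel_of S)"
    by (auto dest: open_in_borel_of simp: vimage_def Int_def conj_commute)
qed

lemma continuous_map_measurable:
  assumes "continuous_map S S' f" shows "f \<in> measurable (borel_of S) (borel_of S')"
proof (rule measurable_sigma_sets[OF sets_borel_of])
  show "{U. openin S' U} \<subseteq> Pow (topspace S')" by (auto dest: openin_subset)
  show "f \<in> space (borel_of S) \<rightarrow> topspace S'" using assms by (auto simp: continuous_map_def)
  fix V assume "V \<in> {U. openin S' U}"
  then have "openin S {x \<in> topspace S. f x \<in> V}" using assms by (auto simp: continuous_map_def)
  then show "f -` V \<inter> space (borel_of S) \<in> sets (borel_of S)"
    by (auto dest: open_in_borel_of simp: vimage_def Int_def conj_commute)
qed

lemma finite_borel_measureD: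
  assumes "finite_borel_measure S \<mu>"
  shows "sets \<mu> = sets (borel_of S)" "space \<mu> = topspace S" "finite_measure \<mu>"
    "\<And>U. openin S U \<Longrightarrow> U \<in> sets \<mu>"
    "\<And>f. continuous_map S euclideanreal f \<Longrightarrow> (f :: _ \<Rightarrow> real) \<in> borel_measurable \<mu>"
proof -
  show *: "sets \<mu> = sets (borel_of S)" "finite_measure \<mu>"
    using assms unfolding finite_borel_measure_def by auto
  show "space \<mu> = topspace S" using sets_eq_imp_space_eq[OF *(1)] by simp
  show "\<And>U. openin S U \<Longrightarrow> U \<in> sets \<mu>" using open_in_borel_of * by auto
  show "\<And>f. continuous_map S euclideanreal f \<Longrightarrow> (f :: _ \<Rightarrow> real) \<in> borel_measurable \<mu>"
    using continuous_map_borel_measurable measurable_cong_sets[OF *(1) refl, of borel] by blast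
qed

lemma integrable_bounded_continuous:
  fixes f :: "_ \<Rightarrow> real"
  assumes "finite_borel_measure S \<mu>" "continuous_map S euclideanreal f" "\<And>x. x \<in> topspace S \<Longrightarrow> \<bar>f x\<bar> \<le> B"
  shows "integrable \<mu> f"
proof -
  interpret finite_measure \<mu> using finite_borel_measureD(3)[OF assms(1)] .
  show ?thesis
    by (rule integrable_const_bound[of _ B])
      (use assms finite_borel_measureD[OF assms(1)] in auto)
qed

text \<open>The functions \<open>min 1 (n g)\<close> increase to the indicator of the open set where \<open>g\<close> is positive,
  so bounded continuous functions determine the measure of open sets.\<close>

lemma finite_borel_measure_eqI:
  assumes S: "opens_cozero S" and \<mu>: "finite_borel_measure S \<mu>" and \<nu>: "finite_borel_measure S \<nu>"
    and eq: "\<And>f. continuous_map S euclideanreal f \<Longrightarrow> bounded (f ` topspace S) \<Longrightarrow> integral\<^sup>L \<mu> f = integral\<^sup>L \<nu> f"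
  shows "\<mu> = \<nu>"
proof -
  have open_eq: "emeasure \<mu> U = emeasure \<nu> U" if U: "openin S U" for U
  proof -
    obtain g where g: "continuous_map S euclideanreal g" "\<And>x. 0 \<le> g x" "\<And>x. g x \<le> 1"
      "\<And>x. x \<in> topspace S \<Longrightarrow> 0 < g x \<longleftrightarrow> x \<in> U"
      using opens_cozeroE[OF S U] by blast
    let ?f = "\<lambda>n::nat. \<lambda>x. min 1 (real n * g x)"
    have cont: "continuous_map S euclideanreal (?f n)" for n
      by (intro continuous_intros g(1))
    have bd: "\<bar>?f n x\<bar> \<le> 1" for n x using g(2)[of x] by auto
    have lim: "(\<lambda>n. ?f n x) \<longlonglongrightarrow> indicator U x" if x: "x \<in> topspace S" for x
    proof (cases "x \<in> U")
      case True
      then have gx: "0 < g x" using g(4) x by simp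
      obtain N where N: "1 / g x \<le> real N" using real_arch_simple by blast
      have "?f n x = indicator U x" if "n \<ge> N" for n
      proof -
        have "1 / g x \<le> real n" using N that by linarith
        then show ?thesis using gx True by (simp add: pos_divide_le_eq min_def)
      qed
      then have "\<forall>\<^sub>F n in sequentially. ?f n x = indicator U x"
        by (auto simp: eventually_sequentially)
      then show ?thesis by (rule tendsto_eventually)
    next
      case False
      then have "g x = 0" using g(2)[of x] g(4)[OF x] by simp
      then show ?thesis using False by simp
    qed
    have conv: "(\<lambda>n. integral\<^sup>L \<rho> (?f n)) \<longlonglongrightarrow> measure \<rho> U" if \<rho>: "finite_borel_measure S \<rho>" for \<rho>
    proof -
      note \<rho>D = finite_borel_measureD[OF \<rho>]
      interpret finite_measure \<rho> by (rule \<rho>D(3))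
      have "(\<lambda>n. integral\<^sup>L \<rho> (?f n)) \<longlonglongrightarrow> integral\<^sup>L \<rho> (indicator U)"
        by (rule integral_dominated_convergence[where w = "\<lambda>_. 1"])
          (use \<rho>D cont lim U bd in \<open>auto intro!: AE_I2\<close>)
      also have "integral\<^sup>L \<rho> (indicator U) = measure \<rho> U"
        using \<rho>D(4)[OF U] by (simp add: sets.sets_into_space Int_absorb2)
      finally show ?thesis .
    qed
    have "bounded (?f n ` topspace S)" for n
      using bd by (intro boundedI[of _ 1]) auto
    then have "integral\<^sup>L \<mu> (?f n) = integral\<^sup>L \<nu> (?f n)" for n using eq[OF cont] by simp
    then have "measure \<mu> U = measure \<nu> U"
      using conv[OF \<mu>] conv[OF \<nu>] by (auto intro: LIMSEQ_unique)
    then show ?thesis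
      using finite_borel_measureD(3)[OF \<mu>] finite_borel_measureD(3)[OF \<nu>]
      by (simp add: finite_measure.emeasure_eq_measure)
  qed
  show ?thesis
  proof (rule measure_eqI_generator_eq[where E = "{U. openin S U}" and \<Omega> = "topspace S" and A = "\<lambda>_. topspace S"])
    show "Int_stable {U. openin S U}" by (auto simp: Int_stable_def)
    show "{U. openin S U} \<subseteq> Pow (topspace S)" by (auto dest: openin_subset)
    show "sets \<mu> = sigma_sets (topspace S) {U. openin S U}" "sets \<nu> = sigma_sets (topspace S) {U. openin S U}"
      using finite_borel_measureD(1)[OF \<mu>] finite_borel_measureD(1)[OF \<nu>] by (simp_all add: sets_borel_of)
    show "emeasure \<mu> (topspace S) \<noteq> \<infinity>" for i :: nat
      using finite_borel_measureD(2,3)[OF \<mu>] by (metis finite_measure.emeasure_finite infinity_ennreal_def)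
  qed (use open_eq in auto)
qed

lemma weak_limit_unique:
  assumes "opens_cozero S" "finite_borel_measure S \<mu>" "finite_borel_measure S \<nu>"
    and "weakly_converges S u \<mu>" "weakly_converges S u \<nu>"
  shows "\<mu> = \<nu>"
  using assms(4,5) unfolding weakly_converges_def
  by (intro finite_borel_measure_eqI[OF assms(1-3)]) (auto intro: LIMSEQ_unique)

text \<open>This is one half of the portmanteau theorem for null sets. If \<open>U\<close> is where \<open>g\<close> is positive, then
  \<open>\<integral> g\<close> is at most the measure of \<open>U\<close>.\<close>

lemma weak_limit_null_open:
  assumes S: "opens_cozero S" and u: "\<forall>\<^sub>F j in sequentially. finite_borel_measure S (u j)"
    and \<mu>: "finite_borel_measure S \<mu>"
    and conv: "weakly_converges S u \<mu>" and U: "openin S U" and null: "(\<lambda>j. measure (u j) U) \<longlonglongrightarrow> 0"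
  shows "emeasure \<mu> U = 0"
proof -
  obtain g where g: "continuous_map S euclideanreal g" "\<And>x. 0 \<le> g x" "\<And>x. g x \<le> 1"
    "\<And>x. x \<in> topspace S \<Longrightarrow> 0 < g x \<longleftrightarrow> x \<in> U"
    using opens_cozeroE[OF S U] by blast
  have bd: "bounded (g ` topspace S)" using g(2,3) by (intro boundedI[of _ 1]) auto
  have "\<forall>\<^sub>F j in sequentially. integral\<^sup>L (u j) g \<le> measure (u j) U"
    using u
  proof eventually_elim
    case (elim j)
    note D = finite_borel_measureD[OF elim]
    interpret finite_measure "u j" by (rule D(3))
    have "integral\<^sup>L (u j) g \<le> integral\<^sup>L (u j) (indicator U)"
    proof (rule integral_mono)
      show "integrable (u j) g" by (rule integrable_bounded_continuous[OF elim g(1), of 1]) (use g in auto)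
      show "integrable (u j) (indicator U :: _ \<Rightarrow> real)"
        using D(4)[OF U] by (auto simp: emeasure_eq_measure)
      fix x assume "x \<in> space (u j)"
      then show "g x \<le> indicator U x" using g(2)[of x] g(3)[of x] g(4)[of x] D(2) by (cases "x \<in> U") auto
    qed
    also have "\<dots> = measure (u j) U"
      using D(4)[OF U] by (simp add: sets.sets_into_space Int_absorb2)
    finally show ?case .
  qed
  moreover have "(\<lambda>j. integral\<^sup>L (u j) g) \<longlonglongrightarrow> integral\<^sup>L \<mu> g"
    using conv g(1) bd unfolding weakly_converges_def by blast
  ultimately have "integral\<^sup>L \<mu> g \<le> 0"
    using null by (intro tendsto_le[OF _ null]) auto
  moreover have "0 \<le> integral\<^sup>L \<mu> g" using g(2) by simp
  moreover have "integrable \<mu> g" by (rule integrable_bounded_continuous[OF \<mu> g(1), of 1]) (use g in auto)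
  ultimately have "AE x in \<mu>. g x = 0"
    using g(2) by (subst integral_nonneg_eq_0_iff_AE[symmetric]) auto
  then have "AE x in \<mu>. x \<notin> U"
  proof (rule AE_mp, intro AE_I2 impI)
    fix x assume "x \<in> space \<mu>" "g x = 0"
    then show "x \<notin> U" using g(4)[of x] finite_borel_measureD(2)[OF \<mu>] by simp
  qed
  then show ?thesis
    using AE_iff_null_sets[OF finite_borel_measureD(4)[OF \<mu> U]] by (simp add: null_sets_def)
qed

lemma sets_borel_of_subtopology:
  assumes "sets \<mu> = sets (borel_of S)" and A: "A \<inter> topspace S \<in> sets (borel_of S)"
  shows "sets (restrict_space \<mu> A) = sets (borel_of (subtopology S A))"
proof -
  have "sets (restrict_space \<mu> A) = sets (restrict_space (borel_of S) A)"
    using assms(1) by (rule sets_restrict_space_cong)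
  also have "\<dots> = (\<lambda>B. A \<inter> B) ` sigma_sets (topspace S) {U. openin S U}"
    by (simp add: sets_restrict_space sets_borel_of)
  also have "\<dots> = (\<lambda>B. (A \<inter> topspace S) \<inter> B) ` sigma_sets (topspace S) {U. openin S U}"
  proof (rule image_cong[OF refl])
    fix B assume "B \<in> sigma_sets (topspace S) {U. openin S U}"
    then have "B \<subseteq> topspace S" by (intro sigma_sets_into_sp[of "{U. openin S U}"]) (auto dest: openin_subset)
    then show "A \<inter> B = A \<inter> topspace S \<inter> B" by auto
  qed
  also have "\<dots> = sigma_sets (A \<inter> topspace S) ((\<lambda>B. (A \<inter> topspace S) \<inter> B) ` {U. openin S U})"
    using A by (intro sigma_sets_Int) (simp_all add: sets_borel_of)
  also have "\<dots> = sigma_sets (topspace (subtopology S A)) {U. openin (subtopology S A) U}"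
  proof -
    have "(\<lambda>B. (A \<inter> topspace S) \<inter> B) ` {U. openin S U} = {U. openin (subtopology S A) U}"
      by (auto simp: openin_subtopology image_def dest: openin_subset)
    then show ?thesis by (simp add: Int_commute)
  qed
  finally show ?thesis by (simp add: sets_borel_of)
qed

section \<open>Isometries acting on the bordification\<close>

definition isometric_into :: "'b metric \<Rightarrow> ('b \<Rightarrow> 'b) \<Rightarrow> bool" where
  "isometric_into m \<phi> \<longleftrightarrow> \<phi> ` mspace m \<subseteq> mspace m \<and>
     (\<forall>x\<in>mspace m. \<forall>y\<in>mspace m. mdist m (\<phi> x) (\<phi> y) = mdist m x y)"

lemma isometric_intoD:
  assumes "isometric_into m \<phi>"
  shows "x \<in> mspace m \<Longrightarrow> \<phi> x \<in> mspace m"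
    "x \<in> mspace m \<Longrightarrow> y \<in> mspace m \<Longrightarrow> mdist m (\<phi> x) (\<phi> y) = mdist m x y"
  using assms unfolding isometric_into_def by auto

lemma isometric_ray:
  assumes "isometric_into m \<phi>" "geodesic_ray m \<sigma>" shows "geodesic_ray m (\<phi> \<circ> \<sigma>)"
  using assms unfolding geodesic_ray_def isometric_into_def by (auto simp: image_subset_iff)

lemma isometric_asymptotic:
  assumes "isometric_into m \<phi>" "(\<sigma>, \<tau>) \<in> asymptotic m" shows "(\<phi> \<circ> \<sigma>, \<phi> \<circ> \<tau>) \<in> asymptotic m"
proof -
  have r: "geodesic_ray m \<sigma>" "geodesic_ray m \<tau>" using assms(2) unfolding asymptotic_def by auto
  have "mdist m (\<phi> (\<sigma> t)) (\<phi> (\<tau> t)) = mdist m (\<sigma> t) (\<tau> t)" if "0 \<le> t" for t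
    using isometric_intoD(2)[OF assms(1)] r that unfolding geodesic_ray_def by (auto simp: image_subset_iff)
  then show ?thesis
    using assms(2) isometric_ray[OF assms(1) r(1)] isometric_ray[OF assms(1) r(2)]
    unfolding asymptotic_def by auto
qed

lemma bord_act_class:
  assumes \<phi>: "isometric_into m \<phi>" and C: "Inr C \<in> geom_boundary m" and \<sigma>: "\<sigma> \<in> C"
  shows "bord_act m \<phi> (Inr C) = Inr (asymptotic m `` {\<phi> \<circ> \<sigma>})"
proof -
  have "asymptotic m `` ((\<lambda>\<sigma>. \<phi> \<circ> \<sigma>) ` C) = asymptotic m `` {\<phi> \<circ> \<sigma>}"
  proof
    show "asymptotic m `` ((\<lambda>\<sigma>. \<phi> \<circ> \<sigma>) ` C) \<subseteq> asymptotic m `` {\<phi> \<circ> \<sigma>}"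
      using isometric_asymptotic[OF \<phi> geom_boundaryD(3)[OF C \<sigma>]] by (auto intro: asymptotic_trans)
  qed (use \<sigma> in auto)
  then show ?thesis by simp
qed

lemma bord_act_boundary:
  assumes \<phi>: "isometric_into m \<phi>" and C: "Inr C \<in> geom_boundary m" and \<sigma>: "\<sigma> \<in> C"
  obtains C' where "bord_act m \<phi> (Inr C) = Inr C'" "Inr C' \<in> geom_boundary m" "\<phi> \<circ> \<sigma> \<in> C'"
proof -
  have "geodesic_ray m (\<phi> \<circ> \<sigma>)" using isometric_ray[OF \<phi> geom_boundaryD(2)[OF C \<sigma>]] .
  then show thesis
    using that[OF bord_act_class[OF \<phi> C \<sigma>]] geom_boundaryI asymptotic_refl by blast
qed

lemma bord_act_in_boundary:
  assumes "isometric_into m \<phi>" "\<xi> \<in> geom_boundary m" shows "bord_act m \<phi> \<xi> \<in> geom_boundary m"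
  using geom_boundary_cases[OF assms(2)] geom_boundaryD(1) bord_act_boundary[OF assms(1)] by metis

lemma bord_act_in_bordification:
  assumes "isometric_into m \<phi>" "\<xi> \<in> bordification m" shows "bord_act m \<phi> \<xi> \<in> bordification m"
proof (cases \<xi>)
  case (Inl z) then show ?thesis using assms isometric_intoD(1)[OF assms(1)] by simp
next
  case (Inr C) then show ?thesis using assms bord_act_in_boundary[OF assms(1), of \<xi>] by (auto simp: bordification_def)
qed

lemma bord_act_inverse:
  assumes \<phi>: "isometric_into m \<phi>" and \<psi>: "isometric_into m \<psi>"
    and inv: "\<And>x. x \<in> mspace m \<Longrightarrow> \<psi> (\<phi> x) = x" and \<xi>: "\<xi> \<in> bordification m"
  shows "bord_act m \<psi> (bord_act m \<phi> \<xi>) = \<xi>"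
proof (cases \<xi>)
  case (Inl z) then show ?thesis using inv \<xi> by simp
next
  case (Inr C)
  then have C: "Inr C \<in> geom_boundary m" using \<xi> by simp
  obtain \<sigma> where \<sigma>: "\<sigma> \<in> C" using geom_boundaryD(1)[OF C] by blast
  obtain C' where C': "bord_act m \<phi> (Inr C) = Inr C'" "Inr C' \<in> geom_boundary m" "\<phi> \<circ> \<sigma> \<in> C'"
    using bord_act_boundary[OF \<phi> C \<sigma>] by blast
  have r: "geodesic_ray m \<sigma>" using geom_boundaryD(2)[OF C \<sigma>] .
  define \<tau> where "\<tau> = \<psi> \<circ> (\<phi> \<circ> \<sigma>)"
  have ray: "geodesic_ray m \<tau>" unfolding \<tau>_def by (intro isometric_ray \<phi> \<psi> r)
  have eq: "\<tau> t = \<sigma> t" if "0 \<le> t" for t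
    using inv r that unfolding \<tau>_def geodesic_ray_def by (auto simp: image_subset_iff)
  have "mdist m (\<sigma> t) (\<tau> t) \<le> 0" if "0 \<le> t" for t
    using eq[OF that] r that unfolding geodesic_ray_def by simp
  then have "(\<sigma>, \<tau>) \<in> asymptotic m" unfolding asymptotic_def using r ray by blast
  then have \<tau>: "\<tau> \<in> C" using geom_boundaryD(4)[OF C \<sigma>] by blast
  have "asymptotic m `` {\<tau>} = C"
    using geom_boundaryD(3)[OF C \<tau>] geom_boundaryD(4)[OF C \<tau>] by blast
  then show ?thesis using bord_act_class[OF \<psi> C'(2,3)] C'(1) Inr by (simp add: \<tau>_def)
qed

context proper_CN_space
begin

lemma opens_cozero_T: "b \<in> M \<Longrightarrow> opens_cozero T"
  unfolding opens_cozero_def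
proof (intro allI impI)
  fix U assume "b \<in> M" "openin T U"
  from open_is_cozero[OF this(2,1)] show "\<exists>g. continuous_map T euclideanreal g \<and>
     (\<forall>x. 0 \<le> g x \<and> g x \<le> 1) \<and> (\<forall>x\<in>topspace T. 0 < g x \<longleftrightarrow> x \<in> U)" by metis
qed

lemma horo_bord_act:
  assumes \<phi>: "isometric_into m \<phi>" and \<xi>: "\<xi> \<in> bordification m" and xy: "x \<in> M" "y \<in> M"
  shows "horo m (bord_act m \<phi> \<xi>) (\<phi> x) (\<phi> y) = horo m \<xi> x y"
proof (cases \<xi>)
  case (Inl z) then show ?thesis using isometric_intoD(2)[OF \<phi>] xy \<xi> by simp
next
  case (Inr C)
  then have C: "Inr C \<in> geom_boundary m" using \<xi> by simp
  obtain \<sigma> where \<sigma>: "\<sigma> \<in> C" using geom_boundaryD(1)[OF C] by blast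
  have r: "geodesic_ray m \<sigma>" using geom_boundaryD(2)[OF C \<sigma>] .
  obtain C' where C': "bord_act m \<phi> (Inr C) = Inr C'" "Inr C' \<in> geom_boundary m" "\<phi> \<circ> \<sigma> \<in> C'"
    using bord_act_boundary[OF \<phi> C \<sigma>] by blast
  have "((\<lambda>s. d (\<phi> x) ((\<phi> \<circ> \<sigma>) s) - d (\<phi> y) ((\<phi> \<circ> \<sigma>) s)) \<longlongrightarrow> horo m (Inr C') (\<phi> x) (\<phi> y)) at_top"
    by (intro horo_along_ray C' isometric_intoD(1)[OF \<phi>] xy)
  moreover have "\<forall>\<^sub>F s in at_top. d (\<phi> x) ((\<phi> \<circ> \<sigma>) s) - d (\<phi> y) ((\<phi> \<circ> \<sigma>) s) = d x (\<sigma> s) - d y (\<sigma> s)"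
    using eventually_ge_at_top[of 0]
    by eventually_elim (use isometric_intoD(2)[OF \<phi>] xy rayD(1)[OF r] in simp)
  ultimately have "((\<lambda>s. d x (\<sigma> s) - d y (\<sigma> s)) \<longlongrightarrow> horo m (Inr C') (\<phi> x) (\<phi> y)) at_top"
    using tendsto_cong by fast
  then show ?thesis
    using tendsto_unique[OF trivial_limit_at_top_linorder _ horo_along_ray[OF C \<sigma> xy]] C'(1) Inr by simp
qed

text \<open>Since the topology is generated by horofunctions and these are equivariant, isometries act
  continuously.\<close>

lemma continuous_bord_act:
  assumes \<phi>: "isometric_into m \<phi>" and \<psi>: "isometric_into m \<psi>"
    and inv: "\<And>x. x \<in> M \<Longrightarrow> \<phi> (\<psi> x) = x" and b: "b \<in> M"
  shows "continuous_map T T (bord_act m \<phi>)"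
  unfolding continuous_map_def
proof (intro conjI allI impI)
  show "bord_act m \<phi> \<in> topspace T \<rightarrow> topspace T"
    using bord_act_in_bordification[OF \<phi>] by (auto simp: topspace_T)
  fix U assume U: "openin T U"
  have "\<exists>V. openin T V \<and> \<xi> \<in> V \<and> V \<subseteq> {\<xi> \<in> topspace T. bord_act m \<phi> \<xi> \<in> U}"
    if \<xi>: "\<xi> \<in> topspace T" "bord_act m \<phi> \<xi> \<in> U" for \<xi>
  proof -
    have \<xi>b: "\<xi> \<in> bordification m" using \<xi> by (simp add: topspace_T)
    obtain F \<kappa> where F: "finite F" "F \<subseteq> M" "\<kappa> > 0" and FU: "horo_nbhd b (bord_act m \<phi> \<xi>) F \<kappa> \<subseteq> U"
      using open_contains_horo_nbhd[OF U \<xi>(2) b] by blast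
    have h: "horo m (bord_act m \<phi> \<eta>) y b = horo m \<eta> (\<psi> y) (\<psi> b)" if "\<eta> \<in> bordification m" "y \<in> M" for \<eta> y
      using horo_bord_act[OF \<phi> that(1), of "\<psi> y" "\<psi> b"] inv that b isometric_intoD(1)[OF \<psi>] by simp
    define W where "W y = {\<eta> \<in> topspace T. horo m \<eta> (\<psi> y) (\<psi> b) \<in> ball (horo m \<xi> (\<psi> y) (\<psi> b)) \<kappa>}" for y
    have W: "openin T (W y)" if "y \<in> M" for y
      unfolding W_def using that b isometric_intoD(1)[OF \<psi>]
      by (intro openin_continuous_map_preimage[OF continuous_horo]) auto
    show ?thesis
    proof (intro exI[of _ "topspace T \<inter> (\<Inter>y\<in>F. W y)"] conjI)
      show "openin T (topspace T \<inter> (\<Inter>y\<in>F. W y))"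
      proof (cases "F = {}")
        case False
        then have "openin T (\<Inter>y\<in>F. W y)" using F W by (intro openin_INT2) auto
        then show ?thesis by (intro openin_Int) auto
      qed simp
      show "\<xi> \<in> topspace T \<inter> (\<Inter>y\<in>F. W y)" using \<xi> F(3) by (auto simp: W_def)
      show "topspace T \<inter> (\<Inter>y\<in>F. W y) \<subseteq> {\<xi> \<in> topspace T. bord_act m \<phi> \<xi> \<in> U}"
      proof
        fix \<eta> assume \<eta>: "\<eta> \<in> topspace T \<inter> (\<Inter>y\<in>F. W y)"
        then have \<eta>b: "\<eta> \<in> bordification m" by (simp add: topspace_T)
        have "\<bar>horo m (bord_act m \<phi> \<eta>) y b - horo m (bord_act m \<phi> \<xi>) y b\<bar> < \<kappa>" if y: "y \<in> F" for y
        proof -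
          have "horo m \<eta> (\<psi> y) (\<psi> b) \<in> ball (horo m \<xi> (\<psi> y) (\<psi> b)) \<kappa>" using \<eta> y by (auto simp: W_def)
          then show ?thesis
            using h[OF \<eta>b] h[OF \<xi>b] y F(2) by (auto simp: dist_real_def abs_minus_commute)
        qed
        then have "bord_act m \<phi> \<eta> \<in> U"
          using FU bord_act_in_bordification[OF \<phi> \<eta>b] by (auto simp: horo_nbhd_def)
        then show "\<eta> \<in> {\<xi> \<in> topspace T. bord_act m \<phi> \<xi> \<in> U}" using \<eta> by simp
      qed
    qed
  qed
  then show "openin T {\<xi> \<in> topspace T. bord_act m \<phi> \<xi> \<in> U}"
    by (subst openin_subopen) auto
qed

end

section \<open>Patterson series\<close>

lemma summable_imp_integrable_count_space:
  fixes f :: "'i \<Rightarrow> real"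
  assumes "\<And>i. i \<in> I \<Longrightarrow> 0 \<le> f i" "f summable_on I"
  shows "integrable (count_space I) f" "integral\<^sup>L (count_space I) f = infsum f I"
proof -
  have "(\<lambda>i. norm (f i)) summable_on I"
    using assms by (subst summable_on_cong[of I _ f]) auto
  then have "Infinite_Set_Sum.abs_summable_on f I" using abs_summable_equivalent by blast
  then show "integrable (count_space I) f" "integral\<^sup>L (count_space I) f = infsum f I"
    using infsetsum_infsum[of f I] by (simp_all add: abs_summable_on_def infsetsum_def)
qed

text \<open>The construction depends only on the family of orbit points, so it is carried out for an
  arbitrary family \<open>z\<close> of points in place of an orbit. Invariance enters in the form of a
  permutation of the indices.\<close>

locale patterson_series = proper_CN_space m for m :: "'b metric" +
  fixes I :: "'i set" and z :: "'i \<Rightarrow> 'b" and b :: 'b and \<delta> :: real and h :: "real \<Rightarrow> real"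
  assumes b: "b \<in> mspace m" and z: "\<And>i. i \<in> I \<Longrightarrow> z i \<in> mspace m" and \<delta>: "\<delta> > 0"
    and h_ge_1: "\<And>t. 0 \<le> t \<Longrightarrow> 1 \<le> h t" and h_mono: "mono_on {0..} h"
    and summable: "\<And>s. s > 1 \<Longrightarrow>
      (\<lambda>i. exp (- s * (\<delta> * mdist m b (z i))) * h (exp (\<delta> * mdist m b (z i)))) summable_on I"
    and divergent: "\<not> (\<lambda>i. exp (- 1 * (\<delta> * mdist m b (z i))) * h (exp (\<delta> * mdist m b (z i)))) summable_on I"
    and slow: "\<And>\<alpha>. \<alpha> > 0 \<Longrightarrow> \<exists>r0>0. \<forall>r\<ge>r0. \<forall>t>1. h (r * t) \<le> t powr \<alpha> * h r"
begin

definition weight :: "real \<Rightarrow> 'b \<Rightarrow> 'i \<Rightarrow> real" where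
  "weight s x i = exp (- s * (\<delta> * d x (z i))) * h (exp (\<delta> * d x (z i)))"

definition total :: "real \<Rightarrow> real" where "total s = infsum (weight s b) I"

definition factor :: "'b \<Rightarrow> 'i \<Rightarrow> real" where "factor x i = exp (\<delta> * (d b (z i) - d x (z i)))"

abbreviation integrable_I :: "('i \<Rightarrow> real) \<Rightarrow> bool" where "integrable_I \<equiv> integrable (count_space I)"
abbreviation sum_I :: "('i \<Rightarrow> real) \<Rightarrow> real" where "sum_I \<equiv> integral\<^sup>L (count_space I)"

definition \<nu> :: "real \<Rightarrow> 'b \<Rightarrow> 'b bordpt measure" where
  "\<nu> s x = distr (density (count_space I) (\<lambda>i. ennreal (weight s x i / total s))) (borel_of T) (\<lambda>i. Inl (z i))"

lemma h_exp_ge_1: "1 \<le> h (exp t)"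
  using h_ge_1[of "exp t"] by simp

lemma weight_pos: "0 < weight s x i"
  unfolding weight_def using h_exp_ge_1[of "\<delta> * d x (z i)"] by (intro mult_pos_pos) auto

lemma weight_antimono: "s \<le> s' \<Longrightarrow> weight s' x i \<le> weight s x i"
  unfolding weight_def using h_exp_ge_1[of "\<delta> * d x (z i)"] \<delta>
  by (intro mult_right_mono) (auto intro!: mult_right_mono)

lemma weight_summable: "s > 1 \<Longrightarrow> weight s b summable_on I"
  using summable[of s] unfolding weight_def by simp

lemma weight_integrable:
  assumes "s > 1"
  shows "integrable_I (weight s b)" "sum_I (weight s b) = total s"
  using summable_imp_integrable_count_space[OF _ weight_summable[OF assms]] weight_pos[of s b]
  by (auto simp: total_def less_imp_le)

lemma integrable_I_times_bounded:
  assumes w: "integrable_I w" and k: "\<And>i. i \<in> I \<Longrightarrow> \<bar>k i\<bar> \<le> B"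
  shows "integrable_I (\<lambda>i. w i * k i)"
proof (rule Bochner_Integration.integrable_bound)
  show "integrable_I (\<lambda>i. w i * B)" using w by simp
  have "\<bar>k i\<bar> \<le> \<bar>B\<bar>" if "i \<in> I" for i using k[OF that] by linarith
  then show "AE i in count_space I. norm (w i * k i) \<le> norm (w i * B)"
    by (auto intro!: AE_I2 mult_left_mono simp: abs_mult)
qed simp

lemma factor_bound:
  assumes "x \<in> M" "i \<in> I" shows "\<bar>factor x i\<bar> \<le> exp (\<delta> * d b x)"
  using reverse_triangle[OF b assms(1) z[OF assms(2)]] \<delta> by (simp add: factor_def abs_le_iff)

lemma partial_sum_le_total:
  assumes "s > 1" "finite F" "F \<subseteq> I" shows "sum (weight s b) F \<le> total s"
  unfolding total_def using weight_pos[of s b]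
  by (intro finite_sum_le_infsum weight_summable assms) (auto intro: less_imp_le)

text \<open>Discreteness of the orbit is a consequence of convergence: the terms of the series are bounded
  below on every ball.\<close>

lemma finite_in_ball: "finite {i\<in>I. d b (z i) \<le> R}"
proof (rule ccontr)
  let ?A = "{i\<in>I. d b (z i) \<le> R}"
  assume inf: "infinite ?A"
  define e where "e = exp (- 2 * (\<delta> * R))"
  have e: "e > 0" by (simp add: e_def)
  have low: "e \<le> weight 2 b i" if "i \<in> ?A" for i
  proof -
    have "e \<le> exp (- 2 * (\<delta> * d b (z i)))" unfolding e_def using that \<delta> by simp
    also have "\<dots> \<le> weight 2 b i" unfolding weight_def using h_exp_ge_1 by simp
    finally show ?thesis .
  qed
  obtain n where n: "total 2 < real n * e" using reals_Archimedean3[OF e] by blast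
  obtain F where F: "finite F" "card F = n" "F \<subseteq> ?A" using infinite_arbitrarily_large[OF inf] by blast
  have "real n * e \<le> sum (weight 2 b) F"
    using sum_bounded_below[of F e "weight 2 b"] F low by auto
  also have "\<dots> \<le> total 2" using F by (intro partial_sum_le_total) auto
  finally show False using n by simp
qed

lemma total_at_top: "\<forall>\<^sub>F s in at_right 1. C < total s"
proof -
  have ns: "\<not> weight 1 b summable_on I" using divergent unfolding weight_def by simp
  have "\<not> bdd_above (sum (weight 1 b) ` {F. F \<subseteq> I \<and> finite F})"
    using nonneg_bdd_above_summable_on[of I "weight 1 b"] ns weight_pos[of 1 b] by (auto intro: less_imp_le)
  then obtain F where F: "F \<subseteq> I" "finite F" "C < sum (weight 1 b) F"
    unfolding bdd_above_def by (auto simp: not_le)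
  have "((\<lambda>s. sum (weight s b) F) \<longlongrightarrow> sum (weight 1 b) F) (at_right 1)"
    unfolding weight_def by (intro tendsto_intros)
  then have "\<forall>\<^sub>F s in at_right 1. C < sum (weight s b) F" using F(3) by (rule order_tendstoD)
  moreover have "\<forall>\<^sub>F s in at_right (1::real). 1 < s" by (rule eventually_at_right_less)
  ultimately show ?thesis
    by eventually_elim (use partial_sum_le_total F in \<open>fastforce intro: less_le_trans\<close>)
qed

lemma total_pos:
  assumes "s > 1" shows "0 < total s"
proof -
  have "I \<noteq> {}" using divergent by auto
  then obtain i where "i \<in> I" by blast
  then have "sum (weight s b) {i} \<le> total s" by (intro partial_sum_le_total assms) auto
  then show ?thesis using weight_pos[of s b i] by simp
qed

text \<open>The arguments of \<open>h\<close> have a bounded quotient, so a small power of it is at most \<open>1 + e\<close>.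
  Exchanging \<open>u\<close> and \<open>v\<close> gives a lower bound.\<close>

lemma h_ratio:
  assumes e: "e > 0" and D: "D \<ge> 0"
  shows "\<exists>R. \<forall>u v. u - v \<le> D \<longrightarrow> R \<le> v \<longrightarrow> h (exp (\<delta> * u)) \<le> (1 + e) * h (exp (\<delta> * v))"
proof -
  define \<alpha> where "\<alpha> = ln (1 + e) / (\<delta> * (D + 1))"
  have \<alpha>: "\<alpha> > 0" using e D \<delta> by (simp add: \<alpha>_def)
  obtain r0 where r0: "r0 > 0" "\<And>r t. r \<ge> r0 \<Longrightarrow> t > 1 \<Longrightarrow> h (r * t) \<le> t powr \<alpha> * h r"
    using slow[OF \<alpha>] by blast
  have "h (exp (\<delta> * u)) \<le> (1 + e) * h (exp (\<delta> * v))" if uv: "u - v \<le> D" "ln r0 / \<delta> \<le> v" for u v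
  proof (cases "u \<le> v")
    case True
    then have "h (exp (\<delta> * u)) \<le> h (exp (\<delta> * v))"
      using \<delta> by (intro mono_onD[OF h_mono]) auto
    also have "\<dots> \<le> (1 + e) * h (exp (\<delta> * v))"
      using e h_exp_ge_1[of "\<delta> * v"] by (simp add: distrib_right)
    finally show ?thesis .
  next
    case False
    have "ln r0 \<le> \<delta> * v" using uv \<delta> by (simp add: divide_le_eq mult.commute)
    then have r: "r0 \<le> exp (\<delta> * v)" using r0(1) by (metis exp_le_cancel_iff exp_ln)
    have t: "exp (\<delta> * (u - v)) > 1" using False \<delta> by simp
    have "h (exp (\<delta> * v) * exp (\<delta> * (u - v))) \<le> exp (\<delta> * (u - v)) powr \<alpha> * h (exp (\<delta> * v))"
      by (rule r0(2)[OF r t])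
    also have "exp (\<delta> * v) * exp (\<delta> * (u - v)) = exp (\<delta> * u)"
      by (simp add: algebra_simps flip: exp_add)
    also have "exp (\<delta> * (u - v)) powr \<alpha> \<le> 1 + e"
    proof -
      have "\<alpha> * (\<delta> * (u - v)) \<le> \<alpha> * (\<delta> * (D + 1))" using uv \<alpha> \<delta> by simp
      also have "\<dots> = ln (1 + e)" using \<delta> D by (simp add: \<alpha>_def)
      finally have "exp (\<alpha> * (\<delta> * (u - v))) \<le> exp (ln (1 + e))" by simp
      then show ?thesis using e by (simp add: powr_def)
    qed
    then have "exp (\<delta> * (u - v)) powr \<alpha> * h (exp (\<delta> * v)) \<le> (1 + e) * h (exp (\<delta> * v))"
      using h_exp_ge_1[of "\<delta> * v"] by (intro mult_right_mono) auto
    finally show ?thesis .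
  qed
  then show ?thesis by blast
qed

text \<open>The weights for \<open>x\<close> and \<open>b\<close> differ by the conformal factor, a power with the small exponent
  \<open>s - 1\<close> and a quotient of values of the slowly varying function \<open>h\<close>. The last two tend to 1.\<close>

lemma weight_comparison:
  assumes x: "x \<in> M" and e: "e > 0"
  shows "\<exists>F s0. finite F \<and> F \<subseteq> I \<and> s0 > 1 \<and> (\<forall>s. 1 < s \<longrightarrow> s \<le> s0 \<longrightarrow> (\<forall>i\<in>I - F.
    \<bar>weight s x i - factor x i * weight s b i\<bar> \<le> e * weight s b i))"
proof -
  define D G \<eta> where "D = d x b" and "G = exp (\<delta> * D)" and "\<eta> = min 1 (e / (3 * G))"
  have D: "D \<ge> 0" by (simp add: D_def)
  have G: "G > 0" by (simp add: G_def)
  have "0 < e / (3 * G)" using e G by simp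
  then have \<eta>: "\<eta> > 0" "\<eta> \<le> 1" "\<eta> \<le> e / (3 * G)" unfolding \<eta>_def by auto
  obtain R where R: "\<And>u v. u - v \<le> D \<Longrightarrow> R \<le> v \<Longrightarrow> h (exp (\<delta> * u)) \<le> (1 + \<eta>) * h (exp (\<delta> * v))"
    using h_ratio[OF \<eta>(1) D] by blast
  define F where "F = {i\<in>I. d b (z i) \<le> R + D}"
  define s0 where "s0 = 1 + ln (1 + \<eta>) / (\<delta> * (D + 1))"
  have s0: "s0 > 1" using \<eta> \<delta> D by (simp add: s0_def)
  have "\<bar>weight s x i - factor x i * weight s b i\<bar> \<le> e * weight s b i"
    if s: "1 < s" "s \<le> s0" and i: "i \<in> I - F" for s i
  proof -
    define u v where "u = d x (z i)" and "v = d b (z i)"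
    have uv: "\<bar>u - v\<bar> \<le> D" using reverse_triangle[OF x b z, of i] i by (simp add: u_def v_def D_def)
    have vR: "R \<le> v" "R \<le> u" using i uv D by (auto simp: F_def v_def)
    define \<rho> where "\<rho> = h (exp (\<delta> * u)) / h (exp (\<delta> * v))"
    define f where "f = exp (- ((s - 1) * \<delta> * (u - v)))"
    have hp: "h (exp (\<delta> * u)) > 0" "h (exp (\<delta> * v)) > 0"
      using h_exp_ge_1[of "\<delta> * u"] h_exp_ge_1[of "\<delta> * v"] by auto
    have \<rho>: "\<rho> > 0" "\<rho> \<le> 1 + \<eta>" "1 \<le> (1 + \<eta>) * \<rho>"
      using R[of u v] R[of v u] uv vR hp by (auto simp: \<rho>_def divide_le_eq le_divide_eq)
    have f: "f > 0" "f \<le> 1 + \<eta>" "1 \<le> (1 + \<eta>) * f"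
    proof -
      have "(s - 1) * \<delta> * \<bar>u - v\<bar> \<le> ln (1 + \<eta>) / (\<delta> * (D + 1)) * \<delta> * (D + 1)"
        using s uv \<delta> D \<eta> by (intro mult_mono) (auto simp: s0_def)
      also have "\<dots> = ln (1 + \<eta>)" using \<delta> D by simp
      finally have B: "\<bar>(s - 1) * \<delta> * (u - v)\<bar> \<le> ln (1 + \<eta>)" using s \<delta> by (simp add: abs_mult)
      then have "f \<le> exp (ln (1 + \<eta>))" unfolding f_def by (simp add: abs_le_iff)
      moreover have "exp ((s - 1) * \<delta> * (u - v)) \<le> exp (ln (1 + \<eta>))" using B by (simp add: abs_le_iff)
      moreover have "exp ((s - 1) * \<delta> * (u - v)) * f = 1" unfolding f_def by (simp flip: exp_add)
      ultimately show "f > 0" "f \<le> 1 + \<eta>" "1 \<le> (1 + \<eta>) * f" using \<eta>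
        by (simp_all add: f_def) (metis exp_gt_zero exp_minus_inverse f_def less_imp_le mult.commute mult_right_mono)
    qed
    have "\<bar>f * \<rho> - 1\<bar> \<le> 3 * \<eta>"
    proof -
      have sq: "(1 + \<eta>) * (1 + \<eta>) \<le> 1 + 3 * \<eta>" using \<eta> by (simp add: algebra_simps mult_left_le)
      have "f * \<rho> \<le> (1 + \<eta>) * (1 + \<eta>)" using f \<rho> by (intro mult_mono) auto
      then have up: "f * \<rho> \<le> 1 + 3 * \<eta>" using sq by simp
      have "1 * 1 \<le> ((1 + \<eta>) * f) * ((1 + \<eta>) * \<rho>)" using f \<rho> by (intro mult_mono) auto
      also have "\<dots> = (1 + \<eta>) * (1 + \<eta>) * (f * \<rho>)" by simp
      also have "\<dots> \<le> (1 + 3 * \<eta>) * (f * \<rho>)" using sq f \<rho> by (intro mult_right_mono) auto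
      finally have low: "1 \<le> f * \<rho> + 3 * \<eta> * (f * \<rho>)" by (simp add: algebra_simps)
      have "1 - f * \<rho> \<le> 3 * \<eta>"
      proof (cases "f * \<rho> \<le> 1")
        case True
        then have "3 * \<eta> * (f * \<rho>) \<le> 3 * \<eta> * 1" using \<eta> by (intro mult_left_mono) auto
        then show ?thesis using low by simp
      qed (use \<eta> in simp)
      then show ?thesis using up by (simp add: abs_le_iff)
    qed
    moreover have "exp (\<delta> * (v - u)) \<le> G" using uv \<delta> by (simp add: G_def)
    ultimately have "exp (\<delta> * (v - u)) * \<bar>f * \<rho> - 1\<bar> \<le> G * (3 * \<eta>)" using G by (intro mult_mono) auto
    also have "\<dots> \<le> e" using \<eta>(3) G by (simp add: le_divide_eq mult.commute mult.left_commute)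
    finally have fac: "exp (\<delta> * (v - u)) * \<bar>f * \<rho> - 1\<bar> \<le> e" .
    have ws: "weight s x i = exp (\<delta> * (v - u)) * f * \<rho> * weight s b i"
    proof -
      have "exp (- s * (\<delta> * u)) = exp (\<delta> * (v - u)) * f * exp (- s * (\<delta> * v))"
        unfolding f_def by (simp add: algebra_simps flip: exp_add)
      moreover have "h (exp (\<delta> * u)) = \<rho> * h (exp (\<delta> * v))" using hp by (simp add: \<rho>_def)
      ultimately show ?thesis unfolding weight_def u_def[symmetric] v_def[symmetric] by (simp only: mult_ac)
    qed
    have "weight s x i - exp (\<delta> * (v - u)) * weight s b i = exp (\<delta> * (v - u)) * (f * \<rho> - 1) * weight s b i"
      unfolding ws by (simp add: algebra_simps)
    then have "\<bar>weight s x i - exp (\<delta> * (v - u)) * weight s b i\<bar> = exp (\<delta> * (v - u)) * \<bar>f * \<rho> - 1\<bar> * weight s b i"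
      using weight_pos[of s b i] by (simp add: abs_mult)
    also have "\<dots> \<le> e * weight s b i" using fac weight_pos[of s b i] by (intro mult_right_mono) auto
    finally show ?thesis by (simp add: u_def v_def factor_def)
  qed
  moreover have "finite F" "F \<subseteq> I" unfolding F_def using finite_in_ball by auto
  ultimately show ?thesis using s0 by (intro exI[of _ F] exI[of _ s0]) auto
qed

text \<open>The finitely many exceptional indices contribute an amount \<open>C\<close> that is bounded in \<open>s\<close>, because
  the weights increase as \<open>s\<close> decreases to 1.\<close>

lemma weight_comparison_integral:
  assumes x: "x \<in> M" and e: "e > 0"
  shows "\<exists>C s0. s0 > 1 \<and> (\<forall>s. 1 < s \<longrightarrow> s \<le> s0 \<longrightarrow> integrable_I (weight s x) \<and>
    sum_I (\<lambda>i. \<bar>weight s x i - factor x i * weight s b i\<bar>)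
      \<le> e * total s + C)"
proof -
  obtain F s0 where F: "finite F" "F \<subseteq> I" "s0 > 1" and close: "\<And>s i. 1 < s \<Longrightarrow> s \<le> s0 \<Longrightarrow> i \<in> I - F \<Longrightarrow>
      \<bar>weight s x i - factor x i * weight s b i\<bar> \<le> e * weight s b i"
    using weight_comparison[OF x e] by blast
  define c where "c i = (if i \<in> F then weight 1 x i + factor x i * weight 1 b i else 0)" for i
  define C where "C = infsum c I"
  have c0: "0 \<le> c i" for i
    unfolding c_def factor_def using weight_pos[of 1 x i] weight_pos[of 1 b i] by simp
  have "c summable_on F" using F(1) by simp
  then have "c summable_on I"
    by (rule summable_on_cong_neutral[THEN iffD1, rotated -1]) (use F(2) in \<open>auto simp: c_def\<close>)
  then have cint: "integrable (count_space I) c" "integral\<^sup>L (count_space I) c = C"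
    using summable_imp_integrable_count_space[of I c] c0 by (auto simp: C_def)
  have "integrable_I (weight s x) \<and>
    sum_I (\<lambda>i. \<bar>weight s x i - factor x i * weight s b i\<bar>) \<le> e * total s + C"
    if s: "1 < s" "s \<le> s0" for s
  proof -
    have bound: "\<bar>weight s x i - factor x i * weight s b i\<bar> \<le> e * weight s b i + c i" if "i \<in> I" for i
    proof (cases "i \<in> F")
      case True
      have g0: "0 \<le> factor x i" by (simp add: factor_def)
      have "weight s x i \<le> weight 1 x i" "factor x i * weight s b i \<le> factor x i * weight 1 b i"
        using weight_antimono[of 1 s] s g0 by (auto intro: mult_left_mono)
      moreover have "0 \<le> weight s x i" "0 \<le> factor x i * weight s b i" "0 \<le> e * weight s b i"
        using weight_pos[of s x i] weight_pos[of s b i] g0 e by auto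
      ultimately show ?thesis using True by (auto simp: c_def abs_le_iff)
    next
      case False then show ?thesis using close[of s i] s that by (simp add: c_def)
    qed
    have wi: "integrable_I (\<lambda>i. e * weight s b i + c i)"
      using weight_integrable(1)[OF s(1)] cint(1) by auto
    have di: "integrable_I (\<lambda>i. weight s x i - factor x i * weight s b i)"
      by (rule Bochner_Integration.integrable_bound[OF wi]) (use bound in \<open>fastforce intro!: AE_I2\<close>)+
    have gi: "integrable_I (\<lambda>i. factor x i * weight s b i)"
      using integrable_I_times_bounded[OF weight_integrable(1)[OF s(1)] factor_bound[OF x]] by (simp add: mult.commute)
    have wx: "integrable_I (\<lambda>i. (weight s x i - factor x i * weight s b i) + factor x i * weight s b i)"
      by (rule Bochner_Integration.integrable_add[OF di gi])
    have "sum_I (\<lambda>i. \<bar>weight s x i - factor x i * weight s b i\<bar>)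
        \<le> sum_I (\<lambda>i. e * weight s b i + c i)"
      using di wi bound by (intro integral_mono) auto
    also have "\<dots> = e * total s + C"
      using weight_integrable[OF s(1)] cint by simp
    finally show ?thesis using wx di by simp
  qed
  then show ?thesis using F(3) by blast
qed

lemma orbit_measurable: "(\<lambda>i. Inl (z i)) \<in> measurable (count_space I) (borel_of T)"
  using z by (auto simp: topspace_T)

lemma integral_\<nu>:
  fixes f :: "_ \<Rightarrow> real"
  assumes f: "f \<in> borel_measurable (borel_of T)" and s: "s > 1"
  shows "integral\<^sup>L (\<nu> s x) f = sum_I (\<lambda>i. weight s x i / total s * f (Inl (z i)))"
proof -
  have "integral\<^sup>L (\<nu> s x) f
      = integral\<^sup>L (density (count_space I) (\<lambda>i. ennreal (weight s x i / total s))) (\<lambda>i. f (Inl (z i)))"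
    unfolding \<nu>_def using orbit_measurable f by (intro integral_distr) simp_all
  also have "\<dots> = sum_I (\<lambda>i. weight s x i / total s * f (Inl (z i)))"
    using weight_pos[of s x] total_pos[OF s]
    by (subst integral_density) (auto intro!: AE_I2 simp: less_imp_le)
  finally show ?thesis .
qed

lemma finite_borel_\<nu>:
  assumes s: "s > 1" shows "finite_borel_measure T (\<nu> s b)"
  unfolding finite_borel_measure_def
proof
  show "sets (\<nu> s b) = sets (borel_of T)" by (simp add: \<nu>_def)
  have "emeasure (density (count_space I) (\<lambda>i. ennreal (weight s b i / total s))) I
      = (\<integral>\<^sup>+ i. ennreal (weight s b i / total s) \<partial>count_space I)"
    by (subst emeasure_density) (auto intro!: nn_integral_cong)
  also have "\<dots> < \<infinity>"
    using weight_integrable(1)[OF s] weight_pos[of s b] total_pos[OF s]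
    by (subst nn_integral_eq_integral) (auto intro!: AE_I2 simp: less_imp_le)
  finally have "finite_measure (density (count_space I) (\<lambda>i. ennreal (weight s b i / total s)))"
    by (intro finite_measureI) auto
  then show "finite_measure (\<nu> s b)"
    unfolding \<nu>_def using orbit_measurable by (intro finite_measure.finite_measure_distr) simp_all
qed

end

locale patterson_limit = patterson_series m I z b \<delta> h
  for m :: "'b metric" and I :: "'i set" and z b \<delta> h +
  fixes s :: "nat \<Rightarrow> real" and \<mu>0 :: "'b bordpt measure"
  assumes s_gt_1: "\<And>j. s j > 1" and s_lim: "s \<longlonglongrightarrow> 1"
    and \<mu>0: "finite_borel_measure (cone_topology m) \<mu>0"
    and conv: "weakly_converges (cone_topology m) (\<lambda>j. \<nu> (s j) b) \<mu>0"
begin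

definition \<mu> :: "'b \<Rightarrow> 'b bordpt measure" where
  "\<mu> x = density \<mu>0 (\<lambda>\<xi>. ennreal (exp (\<delta> * horo m \<xi> b x)))"

lemma s_at_right: "filterlim s (at_right 1) sequentially"
  unfolding filterlim_at using s_gt_1 s_lim by (auto intro!: always_eventually simp: less_imp_neq[symmetric])

lemma total_s_at_top: "\<forall>\<^sub>F j in sequentially. C < total (s j)"
  using total_at_top s_at_right by (auto simp: filterlim_iff)

lemma continuous_conformal_factor:
  assumes "x \<in> M" shows "continuous_map T euclideanreal (\<lambda>\<xi>. exp (\<delta> * horo m \<xi> b x))"
  using continuous_map_compose[OF continuous_horo[OF b assms], of euclideanreal "\<lambda>t. exp (\<delta> * t)"]
  by (simp add: o_def continuous_on_exp continuous_on_mult continuous_on_id)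

lemma conformal_factor_bound:
  assumes "x \<in> M" "\<xi> \<in> bordification m" shows "exp (\<delta> * horo m \<xi> b x) \<le> exp (\<delta> * d b x)"
  using horo_bound[OF assms(2) b assms(1)] \<delta> by (simp add: abs_le_iff)

lemma conformal_factor_measurable:
  assumes "x \<in> M" shows "(\<lambda>\<xi>. exp (\<delta> * horo m \<xi> b x)) \<in> borel_measurable \<mu>0"
  by (rule finite_borel_measureD(5)[OF \<mu>0 continuous_conformal_factor[OF assms]])

lemma \<mu>_base: "\<mu> b = \<mu>0"
  unfolding \<mu>_def by (simp add: horo_self density_1)

lemma sets_\<mu>: "sets (\<mu> x) = sets (borel_of T)" and space_\<mu>: "space (\<mu> x) = topspace T"
  using finite_borel_measureD(1,2)[OF \<mu>0] by (simp_all add: \<mu>_def)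

lemma finite_borel_\<mu>:
  assumes x: "x \<in> M" shows "finite_borel_measure T (\<mu> x)"
  unfolding finite_borel_measure_def
proof
  show "sets (\<mu> x) = sets (borel_of T)" by (rule sets_\<mu>)
  interpret finite_measure \<mu>0 by (rule finite_borel_measureD(3)[OF \<mu>0])
  have "emeasure (\<mu> x) (space (\<mu> x)) = (\<integral>\<^sup>+ \<xi>. ennreal (exp (\<delta> * horo m \<xi> b x)) \<partial>\<mu>0)"
    unfolding \<mu>_def using conformal_factor_measurable[OF x]
    by (subst emeasure_density) (auto intro!: nn_integral_cong)
  also have "\<dots> \<le> (\<integral>\<^sup>+ \<xi>. ennreal (exp (\<delta> * d b x)) \<partial>\<mu>0)"
    using conformal_factor_bound[OF x] finite_borel_measureD(2)[OF \<mu>0]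
    by (intro nn_integral_mono ennreal_leI) (auto simp: topspace_T)
  also have "\<dots> < \<infinity>" by (simp add: ennreal_mult_less_top emeasure_eq_measure)
  finally show "finite_measure (\<mu> x)" by (intro finite_measureI) auto
qed

text \<open>The integral of \<open>f\<close> for \<open>x\<close> is compared with the integral of \<open>f\<close> times the conformal factor
  for \<open>b\<close>. The product is continuous and bounded, so the second integral converges, and the
  difference is at most a multiple of \<open>e + C / total s\<close>.\<close>

lemma weak_convergence:
  assumes x: "x \<in> M" shows "weakly_converges T (\<lambda>j. \<nu> (s j) x) (\<mu> x)"
  unfolding weakly_converges_def
proof (intro allI impI)
  fix f assume f: "continuous_map T euclideanreal f \<and> bounded (f ` topspace T)"
  then obtain B where B: "B > 0" "\<And>\<xi>. \<xi> \<in> topspace T \<Longrightarrow> \<bar>f \<xi>\<bar> \<le> B"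
    unfolding bounded_pos by auto
  let ?g = "\<lambda>\<xi>. exp (\<delta> * horo m \<xi> b x)"
  have fm: "f \<in> borel_measurable (borel_of T)" "(\<lambda>\<xi>. ?g \<xi> * f \<xi>) \<in> borel_measurable (borel_of T)"
    using continuous_map_borel_measurable[of T f] f
      continuous_map_borel_measurable[OF continuous_conformal_factor[OF x]] by auto
  have gf: "continuous_map T euclideanreal (\<lambda>\<xi>. ?g \<xi> * f \<xi>)"
    using f by (intro continuous_map_real_mult continuous_conformal_factor x) auto
  have "bounded ((\<lambda>\<xi>. ?g \<xi> * f \<xi>) ` topspace T)"
  proof (rule boundedI)
    fix y assume "y \<in> (\<lambda>\<xi>. ?g \<xi> * f \<xi>) ` topspace T"
    then obtain \<xi> where \<xi>: "\<xi> \<in> topspace T" "y = ?g \<xi> * f \<xi>" by auto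
    then have "\<bar>y\<bar> \<le> exp (\<delta> * d b x) * B"
      unfolding \<xi>(2) abs_mult using conformal_factor_bound[OF x, of \<xi>] B(2)[OF \<xi>(1)]
      by (intro mult_mono) (auto simp: topspace_T)
    then show "norm y \<le> exp (\<delta> * d b x) * B" by simp
  qed
  then have "(\<lambda>j. integral\<^sup>L (\<nu> (s j) b) (\<lambda>\<xi>. ?g \<xi> * f \<xi>)) \<longlonglongrightarrow> integral\<^sup>L \<mu>0 (\<lambda>\<xi>. ?g \<xi> * f \<xi>)"
    using conv gf unfolding weakly_converges_def by blast
  moreover have "integral\<^sup>L (\<mu> x) f = integral\<^sup>L \<mu>0 (\<lambda>\<xi>. ?g \<xi> * f \<xi>)"
  proof -
    have "f \<in> borel_measurable \<mu>0" using finite_borel_measureD(5)[OF \<mu>0] f by simp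
    then show ?thesis
      unfolding \<mu>_def by (subst integral_density[OF _ conformal_factor_measurable[OF x]]) simp_all
  qed
  moreover have "(\<lambda>j. integral\<^sup>L (\<nu> (s j) x) f - integral\<^sup>L (\<nu> (s j) b) (\<lambda>\<xi>. ?g \<xi> * f \<xi>)) \<longlonglongrightarrow> 0"
  proof (rule LIMSEQ_I)
    fix r :: real assume r: "0 < r"
    define e where "e = r / (3 * B)"
    have e: "e > 0" using r B by (simp add: e_def)
    obtain C s0 where s0: "s0 > 1" and close: "\<And>s. 1 < s \<Longrightarrow> s \<le> s0 \<Longrightarrow> integrable_I (weight s x) \<and>
      sum_I (\<lambda>i. \<bar>weight s x i - factor x i * weight s b i\<bar>)
        \<le> e * total s + C"
      using weight_comparison_integral[OF x e] by blast
    have "\<forall>\<^sub>F j in sequentially. s j < s0" using s_lim s0 by (rule order_tendstoD)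
    moreover have "\<forall>\<^sub>F j in sequentially. \<bar>C\<bar> / e < total (s j)" by (rule total_s_at_top)
    ultimately have "\<forall>\<^sub>F j in sequentially.
      norm (integral\<^sup>L (\<nu> (s j) x) f - integral\<^sup>L (\<nu> (s j) b) (\<lambda>\<xi>. ?g \<xi> * f \<xi>) - 0) < r"
    proof eventually_elim
      case (elim j)
      define t where "t = s j"
      have t: "1 < t" "t \<le> s0" "\<bar>C\<bar> / e < total t" using s_gt_1 elim by (auto simp: t_def)
      have P: "0 < total t" using total_pos t by simp
      have fb: "\<bar>f (Inl (z i))\<bar> \<le> B" if "i \<in> I" for i using B(2) z[OF that] by (simp add: topspace_T)
      define diff where "diff i = weight t x i - factor x i * weight t b i" for i
      have wx: "integrable_I (weight t x)" using close t by simp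
      have wb: "integrable_I (\<lambda>i. weight t b i * factor x i)"
        by (rule integrable_I_times_bounded[OF weight_integrable(1)[OF t(1)] factor_bound[OF x]])
      have i1: "integrable_I (\<lambda>i. weight t x i * f (Inl (z i)))"
        by (rule integrable_I_times_bounded[OF wx fb])
      have i2: "integrable_I (\<lambda>i. weight t b i * factor x i * f (Inl (z i)))"
        by (rule integrable_I_times_bounded[OF wb fb])
      have di: "integrable_I diff"
        unfolding diff_def using wx wb by (intro Bochner_Integration.integrable_diff) (simp_all add: mult.commute)
      have "integral\<^sup>L (\<nu> t x) f - integral\<^sup>L (\<nu> t b) (\<lambda>\<xi>. ?g \<xi> * f \<xi>)
         = sum_I (\<lambda>i. weight t x i * f (Inl (z i)) / total t)
          - sum_I (\<lambda>i. weight t b i * factor x i * f (Inl (z i)) / total t)"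
        using integral_\<nu>[OF fm(1) t(1)] integral_\<nu>[OF fm(2) t(1)] by (simp add: factor_def mult.assoc)
      also have "\<dots> = sum_I (\<lambda>i. diff i * f (Inl (z i)) / total t)"
        using i1 i2 by (subst Bochner_Integration.integral_diff[symmetric])
          (auto intro!: Bochner_Integration.integral_cong simp: diff_def field_simps diff_divide_distrib)
      finally have eq: "integral\<^sup>L (\<nu> t x) f - integral\<^sup>L (\<nu> t b) (\<lambda>\<xi>. ?g \<xi> * f \<xi>) = \<dots>" .
      have bound: "norm (diff i * f (Inl (z i)) / total t) \<le> \<bar>diff i\<bar> * (B / total t)" if "i \<in> I" for i
      proof -
        have "norm (diff i * f (Inl (z i)) / total t) = \<bar>diff i\<bar> * (\<bar>f (Inl (z i))\<bar> / total t)"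
          using P by (simp add: abs_mult)
        also have "\<dots> \<le> \<bar>diff i\<bar> * (B / total t)"
          using fb[OF that] P by (intro mult_left_mono divide_right_mono) auto
        finally show ?thesis .
      qed
      have "norm (sum_I (\<lambda>i. diff i * f (Inl (z i)) / total t)) \<le> sum_I (\<lambda>i. \<bar>diff i\<bar> * (B / total t))"
        using integrable_I_times_bounded[OF di fb] di bound
        by (intro order_trans[OF integral_norm_bound Bochner_Integration.integral_mono]) auto
      also have "\<dots> = (B / total t) * sum_I (\<lambda>i. \<bar>diff i\<bar>)" by simp
      also have "\<dots> \<le> (B / total t) * (e * total t + C)"
        using close[OF t(1,2)] B P unfolding diff_def by (intro mult_left_mono) auto
      also have "\<dots> \<le> (B / total t) * (e * total t + e * total t)"
      proof -
        have "C \<le> e * total t" using t(3) e by (simp add: divide_less_eq mult.commute abs_less_iff)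
        then show ?thesis using B P by (intro mult_left_mono) auto
      qed
      also have "\<dots> = 2 * (B * e)" using P by (simp add: field_simps)
      also have "\<dots> < r" using B r by (simp add: e_def)
      finally show ?case using eq by (simp add: t_def)
    qed
    then show "\<exists>no. \<forall>j\<ge>no. norm (integral\<^sup>L (\<nu> (s j) x) f - integral\<^sup>L (\<nu> (s j) b) (\<lambda>\<xi>. ?g \<xi> * f \<xi>) - 0) < r"
      by (simp add: eventually_sequentially)
  qed
  ultimately have "(\<lambda>j. (integral\<^sup>L (\<nu> (s j) x) f - integral\<^sup>L (\<nu> (s j) b) (\<lambda>\<xi>. ?g \<xi> * f \<xi>))
     + integral\<^sup>L (\<nu> (s j) b) (\<lambda>\<xi>. ?g \<xi> * f \<xi>)) \<longlonglongrightarrow> 0 + integral\<^sup>L (\<mu> x) f"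
    by (intro tendsto_add) simp_all
  then show "(\<lambda>j. integral\<^sup>L (\<nu> (s j) x) f) \<longlonglongrightarrow> integral\<^sup>L (\<mu> x) f" by simp
qed

text \<open>The total mass of the series tends to infinity, so that a part of the orbit on which the
  series converges already at the critical exponent is invisible in the limit.\<close>

lemma null_open:
  assumes U: "openin T U" and sm: "weight 1 b summable_on {i\<in>I. Inl (z i) \<in> U}"
  shows "emeasure \<mu>0 U = 0"
proof (rule weak_limit_null_open[OF opens_cozero_T[OF b] _ \<mu>0 conv U])
  show "\<forall>\<^sub>F j in sequentially. finite_borel_measure T (\<nu> (s j) b)" using finite_borel_\<nu> s_gt_1 by simp
  define k where "k i = (if Inl (z i) \<in> U then weight 1 b i else 0)" for i
  have "k summable_on {i\<in>I. Inl (z i) \<in> U}" using sm by (subst summable_on_cong[of _ k "weight 1 b"]) (auto simp: k_def)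
  then have "k summable_on I"
    by (rule summable_on_cong_neutral[THEN iffD1, rotated -1]) (auto simp: k_def)
  then have k: "integrable (count_space I) k"
    using summable_imp_integrable_count_space(1)[of I k] weight_pos[of 1 b] by (auto simp: k_def less_imp_le)
  define K where "K = integral\<^sup>L (count_space I) k"
  have bound: "measure (\<nu> (s j) b) U \<le> K / total (s j)" for j
  proof -
    define t where "t = s j"
    have t: "1 < t" "0 < total t" using s_gt_1 total_pos by (auto simp: t_def)
    have Um: "U \<in> sets (borel_of T)" using U by (rule open_in_borel_of)
    have "measure (\<nu> t b) U = integral\<^sup>L (\<nu> t b) (indicator U)"
      using Um finite_borel_measureD(1,2)[OF finite_borel_\<nu>[OF t(1)]] openin_subset[OF U]
      by (simp add: Int_absorb2)
    also have "\<dots> = sum_I (\<lambda>i. weight t b i / total t * indicator U (Inl (z i)))"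
      using Um t by (intro integral_\<nu>) auto
    also have "\<dots> \<le> sum_I (\<lambda>i. k i / total t)"
    proof (rule integral_mono')
      show "integrable_I (\<lambda>i. k i / total t)" using k by simp
      show "weight t b i / total t * indicator U (Inl (z i)) \<le> k i / total t" for i
        using weight_antimono[of 1 t b i] t by (auto simp: k_def indicator_def intro: divide_right_mono)
      show "0 \<le> k i / total t" for i using weight_pos[of 1 b i] t by (simp add: k_def)
    qed
    also have "\<dots> = K / total t" by (simp add: K_def)
    finally show ?thesis by (simp add: t_def)
  qed
  show "(\<lambda>j. measure (\<nu> (s j) b) U) \<longlonglongrightarrow> 0"
  proof (rule LIMSEQ_I)
    fix r :: real assume r: "0 < r"
    have "\<forall>\<^sub>F j in sequentially. norm (measure (\<nu> (s j) b) U - 0) < r"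
      using total_s_at_top[of "\<bar>K\<bar> / r"]
    proof eventually_elim
      case (elim j)
      have P: "0 < total (s j)" using total_pos s_gt_1 by simp
      have "K / total (s j) < r" using elim P r by (simp add: divide_less_eq mult.commute abs_less_iff)
      then show ?case using bound[of j] by (simp add: measure_nonneg)
    qed
    then show "\<exists>no. \<forall>j\<ge>no. norm (measure (\<nu> (s j) b) U - 0) < r" by (simp add: eventually_sequentially)
  qed
qed

lemma null_\<mu>:
  assumes x: "x \<in> M" and U: "openin T U" and null: "emeasure \<mu>0 U = 0"
  shows "emeasure (\<mu> x) U = 0"
proof -
  have "U \<in> null_sets \<mu>0" using null finite_borel_measureD(4)[OF \<mu>0 U] by auto
  then have "AE \<xi> in \<mu>0. \<xi> \<notin> U" by (rule AE_not_in)
  then have "AE \<xi> in \<mu>0. ennreal (exp (\<delta> * horo m \<xi> b x)) * indicator U \<xi> = 0"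
    by eventually_elim simp
  then have "(\<integral>\<^sup>+ \<xi>. ennreal (exp (\<delta> * horo m \<xi> b x)) * indicator U \<xi> \<partial>\<mu>0) = (\<integral>\<^sup>+ \<xi>. 0 \<partial>\<mu>0)"
    by (rule nn_integral_cong_AE)
  then show ?thesis
    unfolding \<mu>_def using conformal_factor_measurable[OF x] finite_borel_measureD(4)[OF \<mu>0 U]
    by (subst emeasure_density) auto
qed

lemma not_in_support:
  assumes "x \<in> M" "openin T U" "weight 1 b summable_on {i\<in>I. Inl (z i) \<in> U}" "\<xi> \<in> U"
  shows "\<xi> \<notin> msupport T (\<mu> x)"
  using null_\<mu>[OF assms(1,2) null_open[OF assms(2,3)]] assms(2,4) unfolding msupport_def by auto

text \<open>A point off the closure of the orbit has a neighbourhood without orbit points, and an interior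
  point has one with finitely many.\<close>

lemma support_in_closure_of_orbit:
  assumes x: "x \<in> M"
  shows "msupport T (\<mu> x) \<subseteq> (T closure_of ((\<lambda>i. Inl (z i)) ` I)) \<inter> geom_boundary m"
proof
  fix \<xi> assume \<xi>: "\<xi> \<in> msupport T (\<mu> x)"
  then have \<xi>b: "\<xi> \<in> bordification m" by (auto simp: msupport_def topspace_T)
  have "\<xi> \<in> geom_boundary m"
  proof (cases \<xi>)
    case (Inl p)
    then have p: "p \<in> M" using \<xi>b by simp
    let ?U = "Inl ` mball_of m p 1 :: 'b bordpt set"
    have "{i\<in>I. Inl (z i) \<in> ?U} \<subseteq> {i\<in>I. d b (z i) \<le> d b p + 1}"
    proof
      fix i assume "i \<in> {i\<in>I. Inl (z i) \<in> ?U}"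
      then have i: "i \<in> I" "d p (z i) < 1" "z i \<in> M" by auto
      then show "i \<in> {i\<in>I. d b (z i) \<le> d b p + 1}" using mdist_triangle[OF b p i(3)] by simp
    qed
    then have "finite {i\<in>I. Inl (z i) \<in> ?U}" using finite_in_ball finite_subset by blast
    then have "\<xi> \<notin> msupport T (\<mu> x)"
      using not_in_support[OF x openin_ball[OF p, of 1]] p Inl by auto
    then show ?thesis using \<xi> by simp
  next
    case (Inr C) then show ?thesis using \<xi>b by simp
  qed
  moreover have "\<xi> \<in> T closure_of ((\<lambda>i. Inl (z i)) ` I)"
    unfolding in_closure_of
  proof (intro conjI allI impI)
    show "\<xi> \<in> topspace T" using \<xi>b by (simp add: topspace_T)
    fix U assume U: "\<xi> \<in> U \<and> openin T U"
    show "\<exists>y. y \<in> (\<lambda>i. Inl (z i)) ` I \<and> y \<in> U"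
    proof (rule ccontr)
      assume "\<nexists>y. y \<in> (\<lambda>i. Inl (z i)) ` I \<and> y \<in> U"
      then have empty: "{i\<in>I. Inl (z i) \<in> U} = {}" by auto
      have "weight 1 b summable_on {i\<in>I. Inl (z i) \<in> U}" unfolding empty by simp
      then have "\<xi> \<notin> msupport T (\<mu> x)" using U by (intro not_in_support[OF x]) auto
      then show False using \<xi> by simp
    qed
  qed
  ultimately show "\<xi> \<in> (T closure_of ((\<lambda>i. Inl (z i)) ` I)) \<inter> geom_boundary m" by simp
qed

lemma boundary_in_sets: "geom_boundary m \<inter> topspace T \<in> sets (borel_of T)"
proof -
  have "geom_boundary m \<inter> topspace T = topspace T - Inl ` M"
    by (auto simp: topspace_T bordification_def)
  then show ?thesis
    using sets.compl_sets[OF open_in_borel_of[OF openin_interior]] by simp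
qed

lemma boundary_in_sets_\<mu>: "geom_boundary m \<inter> space (\<mu> x) \<in> sets (\<mu> x)"
  using boundary_in_sets by (simp add: sets_\<mu> space_\<mu>)

abbreviation B :: "'b bordpt topology" where "B \<equiv> boundary_topology m"

definition \<mu>B :: "'b \<Rightarrow> 'b bordpt measure" where "\<mu>B x = restrict_space (\<mu> x) (geom_boundary m)"

lemma topspace_B: "topspace B = geom_boundary m"
  using geom_boundary_subset_bordification by (auto simp: boundary_topology_def topspace_T)

lemma sets_\<mu>B: "sets (\<mu>B x) = sets (borel_of B)"
  unfolding \<mu>B_def boundary_topology_def by (rule sets_borel_of_subtopology[OF sets_\<mu> boundary_in_sets])

lemma space_\<mu>B: "space (\<mu>B x) = geom_boundary m"
  using sets_eq_imp_space_eq[OF sets_\<mu>B] by (simp add: topspace_B)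

lemma emeasure_\<mu>B: "A \<subseteq> geom_boundary m \<Longrightarrow> emeasure (\<mu>B x) A = emeasure (\<mu> x) A"
  unfolding \<mu>B_def by (rule emeasure_restrict_space[OF boundary_in_sets_\<mu>])

lemma finite_borel_\<mu>B:
  assumes "x \<in> M" shows "finite_borel_measure B (\<mu>B x)"
  unfolding finite_borel_measure_def
proof
  interpret finite_measure "\<mu> x" by (rule finite_borel_measureD(3)[OF finite_borel_\<mu>[OF assms]])
  show "finite_measure (\<mu>B x)"
    by (intro finite_measureI) (simp add: space_\<mu>B emeasure_\<mu>B emeasure_eq_measure)
qed (rule sets_\<mu>B)

lemma support_\<mu>B: "msupport B (\<mu>B x) \<subseteq> msupport T (\<mu> x)"
proof
  fix \<xi> assume \<xi>: "\<xi> \<in> msupport B (\<mu>B x)"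
  then have "\<xi> \<in> geom_boundary m" by (simp add: msupport_def topspace_B)
  moreover have "0 < emeasure (\<mu> x) U" if U: "openin T U" "\<xi> \<in> U" for U
  proof -
    have "openin B (U \<inter> geom_boundary m)"
      unfolding boundary_topology_def openin_subtopology using U(1) by blast
    then have "0 < emeasure (\<mu>B x) (U \<inter> geom_boundary m)"
      using \<xi> U(2) \<open>\<xi> \<in> geom_boundary m\<close> unfolding msupport_def by blast
    also have "\<dots> = emeasure (\<mu> x) (U \<inter> geom_boundary m)" by (rule emeasure_\<mu>B) simp
    also have "\<dots> \<le> emeasure (\<mu> x) U"
      by (rule emeasure_mono) (use open_in_borel_of[OF U(1)] in \<open>auto simp: sets_\<mu>\<close>)
    finally show ?thesis .
  qed
  ultimately show "\<xi> \<in> msupport T (\<mu> x)"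
    using geom_boundary_subset_bordification by (auto simp: msupport_def topspace_T)
qed

lemma \<mu>B_density:
  assumes x: "x \<in> M"
  shows "\<mu>B x = density (\<mu>B b) (\<lambda>\<eta>. ennreal (exp (\<delta> * busemann m \<eta> b x)))"
proof (rule measure_eqI)
  show "sets (\<mu>B x) = sets (density (\<mu>B b) (\<lambda>\<eta>. ennreal (exp (\<delta> * busemann m \<eta> b x))))"
    by (simp add: sets_\<mu>B)
  fix A assume "A \<in> sets (\<mu>B x)"
  then have A: "A \<in> sets (\<mu>B b)" "A \<in> sets (borel_of B)" by (simp_all add: sets_\<mu>B)
  then have Asub: "A \<subseteq> geom_boundary m" using sets.sets_into_space[OF A(1)] by (simp add: space_\<mu>B)
  have A0: "A \<in> sets \<mu>0"
    using A(1) boundary_in_sets_\<mu>[of b] unfolding \<mu>B_def \<mu>_base by (metis sets_restrict_space_iff)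
  let ?h = "\<lambda>\<xi>. ennreal (exp (\<delta> * horo m \<xi> b x))"
  have eq: "?h \<eta> = ennreal (exp (\<delta> * busemann m \<eta> b x))" if "\<eta> \<in> geom_boundary m" for \<eta>
    using geom_boundary_cases[OF that] horo_Inr[of m] by metis
  have hB: "?h \<in> borel_measurable (\<mu>B b)"
    using conformal_factor_measurable[OF x] unfolding \<mu>B_def \<mu>_base by (intro measurable_restrict_space1) simp
  then have bB: "(\<lambda>\<eta>. ennreal (exp (\<delta> * busemann m \<eta> b x))) \<in> borel_measurable (\<mu>B b)"
    by (rule measurable_cong[THEN iffD1, rotated]) (simp add: space_\<mu>B eq)
  have "emeasure (density (\<mu>B b) (\<lambda>\<eta>. ennreal (exp (\<delta> * busemann m \<eta> b x)))) A
      = (\<integral>\<^sup>+ \<eta>. ennreal (exp (\<delta> * busemann m \<eta> b x)) * indicator A \<eta> \<partial>\<mu>B b)"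
    by (rule emeasure_density[OF bB A(1)])
  also have "\<dots> = (\<integral>\<^sup>+ \<eta>. ?h \<eta> * indicator A \<eta> \<partial>\<mu>B b)"
    by (rule nn_integral_cong) (simp add: space_\<mu>B eq)
  also have "\<dots> = (\<integral>\<^sup>+ \<eta>. ?h \<eta> * indicator A \<eta> * indicator (geom_boundary m) \<eta> \<partial>\<mu>0)"
    unfolding \<mu>B_def \<mu>_base using boundary_in_sets_\<mu>[of b]
    by (intro nn_integral_restrict_space) (simp add: \<mu>_base)
  also have "\<dots> = (\<integral>\<^sup>+ \<eta>. ?h \<eta> * indicator A \<eta> \<partial>\<mu>0)"
    using Asub by (intro nn_integral_cong) (auto simp: indicator_def)
  also have "\<dots> = emeasure (\<mu> x) A"
    unfolding \<mu>_def using conformal_factor_measurable[OF x] A0 by (intro emeasure_density[symmetric]) auto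
  also have "\<dots> = emeasure (\<mu>B x) A" by (rule emeasure_\<mu>B[OF Asub, symmetric])
  finally show "emeasure (\<mu>B x) A = emeasure (density (\<mu>B b) (\<lambda>\<eta>. ennreal (exp (\<delta> * busemann m \<eta> b x)))) A"
    by simp
qed

text \<open>An isometry that permutes the orbit permutes the weights, so both sides are weak limits of
  the same measures.\<close>

lemma \<mu>_equivariant:
  assumes \<phi>: "isometric_into m \<phi>" and \<psi>: "isometric_into m \<psi>"
    and inv: "\<And>x. x \<in> M \<Longrightarrow> \<phi> (\<psi> x) = x"
    and \<pi>: "bij_betw \<pi> I I" and orb: "\<And>i. i \<in> I \<Longrightarrow> z (\<pi> i) = \<phi> (z i)" and x: "x \<in> M"
  shows "distr (\<mu> x) (borel_of T) (bord_act m \<phi>) = \<mu> (\<phi> x)"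
proof -
  have cont: "continuous_map T T (bord_act m \<phi>)" by (rule continuous_bord_act[OF \<phi> \<psi> inv b])
  have meas: "bord_act m \<phi> \<in> measurable (\<mu> x) (borel_of T)"
    using continuous_map_measurable[OF cont] measurable_cong_sets[OF sets_\<mu> refl] by blast
  have fin: "finite_borel_measure T (distr (\<mu> x) (borel_of T) (bord_act m \<phi>))"
    unfolding finite_borel_measure_def
    using finite_measure.finite_measure_distr[OF finite_borel_measureD(3)[OF finite_borel_\<mu>[OF x]] meas] by simp
  have "weakly_converges T (\<lambda>j. \<nu> (s j) (\<phi> x)) (distr (\<mu> x) (borel_of T) (bord_act m \<phi>))"
    unfolding weakly_converges_def
  proof (intro allI impI)
    fix f assume f: "continuous_map T euclideanreal f \<and> bounded (f ` topspace T)"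
    have ff: "continuous_map T euclideanreal (\<lambda>\<xi>. f (bord_act m \<phi> \<xi>))"
      using continuous_map_compose[OF cont] f by (auto simp: o_def)
    have "(\<lambda>\<xi>. f (bord_act m \<phi> \<xi>)) ` topspace T \<subseteq> f ` topspace T"
      using cont unfolding continuous_map_def by auto
    then have "bounded ((\<lambda>\<xi>. f (bord_act m \<phi> \<xi>)) ` topspace T)" using f bounded_subset by blast
    with ff have lim: "(\<lambda>j. integral\<^sup>L (\<nu> (s j) x) (\<lambda>\<xi>. f (bord_act m \<phi> \<xi>))) \<longlonglongrightarrow> integral\<^sup>L (\<mu> x) (\<lambda>\<xi>. f (bord_act m \<phi> \<xi>))"
      using weak_convergence[OF x] unfolding weakly_converges_def by blast
    have fm: "f \<in> borel_measurable (borel_of T)" using f continuous_map_borel_measurable by blast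
    have "integral\<^sup>L (\<nu> (s j) x) (\<lambda>\<xi>. f (bord_act m \<phi> \<xi>)) = integral\<^sup>L (\<nu> (s j) (\<phi> x)) f" for j
    proof -
      have w: "weight (s j) x i = weight (s j) (\<phi> x) (\<pi> i)" if "i \<in> I" for i
        unfolding weight_def orb[OF that] using isometric_intoD(2)[OF \<phi> x z[OF that]] by simp
      have "integral\<^sup>L (\<nu> (s j) x) (\<lambda>\<xi>. f (bord_act m \<phi> \<xi>))
          = sum_I (\<lambda>i. weight (s j) x i / total (s j) * f (bord_act m \<phi> (Inl (z i))))"
        by (rule integral_\<nu>[OF continuous_map_borel_measurable[OF ff] s_gt_1])
      also have "\<dots> = integral\<^sup>L (count_space I)
          (\<lambda>i. (\<lambda>k. weight (s j) (\<phi> x) k / total (s j) * f (Inl (z k))) (\<pi> i))"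
        by (rule Bochner_Integration.integral_cong[OF refl]) (simp add: w orb)
      also have "\<dots> = sum_I (\<lambda>k. weight (s j) (\<phi> x) k / total (s j) * f (Inl (z k)))"
        by (rule integral_bij_count_space[OF \<pi>])
      also have "\<dots> = integral\<^sup>L (\<nu> (s j) (\<phi> x)) f"
        by (rule integral_\<nu>[OF fm s_gt_1, symmetric])
      finally show ?thesis .
    qed
    then show "(\<lambda>j. integral\<^sup>L (\<nu> (s j) (\<phi> x)) f) \<longlonglongrightarrow> integral\<^sup>L (distr (\<mu> x) (borel_of T) (bord_act m \<phi>)) f"
      using lim integral_distr[OF meas fm] by simp
  qed
  then show ?thesis
    using weak_limit_unique[OF opens_cozero_T[OF b] fin finite_borel_\<mu> _ weak_convergence]
      isometric_intoD(1)[OF \<phi> x] by blast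
qed

lemma \<mu>B_equivariant:
  assumes \<phi>: "isometric_into m \<phi>" and \<psi>: "isometric_into m \<psi>"
    and inv: "\<And>x. x \<in> M \<Longrightarrow> \<phi> (\<psi> x) = x"
    and \<pi>: "bij_betw \<pi> I I" and orb: "\<And>i. i \<in> I \<Longrightarrow> z (\<pi> i) = \<phi> (z i)" and x: "x \<in> M"
  shows "distr (\<mu>B x) (borel_of B) (bord_act m \<phi>) = \<mu>B (\<phi> x)"
proof (rule measure_eqI)
  have cont: "continuous_map T T (bord_act m \<phi>)" by (rule continuous_bord_act[OF \<phi> \<psi> inv b])
  then have contB: "continuous_map B B (bord_act m \<phi>)"
    unfolding boundary_topology_def
    using bord_act_in_boundary[OF \<phi>] by (auto simp: continuous_map_in_subtopology
        intro: continuous_map_from_subtopology)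
  have measB: "bord_act m \<phi> \<in> measurable (\<mu>B x) (borel_of B)"
    using continuous_map_measurable[OF contB] measurable_cong_sets[OF sets_\<mu>B refl] by blast
  have meas: "bord_act m \<phi> \<in> measurable (\<mu> x) (borel_of T)"
    using continuous_map_measurable[OF cont] measurable_cong_sets[OF sets_\<mu> refl] by blast
  show "sets (distr (\<mu>B x) (borel_of B) (bord_act m \<phi>)) = sets (\<mu>B (\<phi> x))" by (simp add: sets_\<mu>B)
  fix A assume "A \<in> sets (distr (\<mu>B x) (borel_of B) (bord_act m \<phi>))"
  then have A: "A \<in> sets (borel_of B)" by simp
  then have Asub: "A \<subseteq> geom_boundary m" using sets.sets_into_space[OF A] by (simp add: topspace_B)
  have AT: "A \<in> sets (borel_of T)"
  proof -
    have "A \<in> sets (restrict_space (\<mu> x) (geom_boundary m))" using A sets_\<mu>B[of x] by (simp add: \<mu>B_def)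
    then have "A \<in> sets (\<mu> x)" using boundary_in_sets_\<mu>[of x] by (metis sets_restrict_space_iff)
    then show ?thesis by (simp add: sets_\<mu>)
  qed
  have pre: "bord_act m \<phi> -` A \<inter> geom_boundary m = bord_act m \<phi> -` A \<inter> topspace T"
    using Asub geom_boundary_subset_bordification by (auto simp: topspace_T bordification_def)
  have "emeasure (distr (\<mu>B x) (borel_of B) (bord_act m \<phi>)) A = emeasure (\<mu>B x) (bord_act m \<phi> -` A \<inter> geom_boundary m)"
    using emeasure_distr[OF measB A] by (simp add: space_\<mu>B)
  also have "\<dots> = emeasure (\<mu> x) (bord_act m \<phi> -` A \<inter> geom_boundary m)" by (rule emeasure_\<mu>B) simp
  also have "\<dots> = emeasure (distr (\<mu> x) (borel_of T) (bord_act m \<phi>)) A"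
    unfolding pre using emeasure_distr[OF meas AT] by (simp add: space_\<mu>)
  also have "\<dots> = emeasure (\<mu>B (\<phi> x)) A"
    using \<mu>_equivariant[OF \<phi> \<psi> inv \<pi> orb x] emeasure_\<mu>B[OF Asub] by simp
  finally show "emeasure (distr (\<mu>B x) (borel_of B) (bord_act m \<phi>)) A = emeasure (\<mu>B (\<phi> x)) A" .
qed

end

section \<open>Growth in a direction\<close>

declare mdist_product_metric [simp del]

definition growth_rate :: "(nat \<Rightarrow> nat) \<Rightarrow> ereal" where
  "growth_rate c = limsup (\<lambda>n. if c n = 0 then - \<infinity> else ereal (ln (real (c n)) / real n))"

lemma growth_rate_mono:
  assumes "\<And>n. c n \<le> c' n" shows "growth_rate c \<le> growth_rate c'"
  unfolding growth_rate_def
proof (intro Limsup_mono always_eventually allI)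
  fix n
  show "(if c n = 0 then - \<infinity> else ereal (ln (real (c n)) / real n))
    \<le> (if c' n = 0 then - \<infinity> else ereal (ln (real (c' n)) / real n))"
    using assms[of n] by (auto intro!: divide_right_mono)
qed

lemma growth_rate_less_imp_bound:
  assumes "growth_rate c < ereal a" shows "\<forall>\<^sub>F n in sequentially. real (c n) \<le> exp (a * real n)"
proof -
  have "\<forall>\<^sub>F n in sequentially. (if c n = 0 then - \<infinity> else ereal (ln (real (c n)) / real n)) < ereal a"
    using assms unfolding growth_rate_def by (rule Limsup_lessD)
  moreover have "\<forall>\<^sub>F n in sequentially. 0 < n" by (rule eventually_gt_at_top)
  ultimately show ?thesis
  proof eventually_elim
    case (elim n)
    show ?case
    proof (cases "c n = 0")
      case False
      then have "ln (real (c n)) < a * real n" using elim by (simp add: divide_less_eq)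
      then show ?thesis using False by (metis exp_less_cancel_iff exp_ln less_imp_le of_nat_0_less_iff not_gr_zero)
    qed simp
  qed
qed

lemma growth_rate_le:
  assumes bd: "\<And>n. real (c n) \<le> C * exp (s * real n)" shows "growth_rate c \<le> ereal s"
proof -
  define C' where "C' = max C 1"
  have le: "C * exp (s * real n) \<le> C' * exp (s * real n)" for n
    by (intro mult_right_mono) (auto simp: C'_def)
  have C': "C' \<ge> 1" "\<And>n. real (c n) \<le> C' * exp (s * real n)"
    by (simp add: C'_def, rule order_trans[OF bd le])
  have "growth_rate c \<le> limsup (\<lambda>n. ereal (ln C' / real n + s))"
    unfolding growth_rate_def
  proof (rule Limsup_mono)
    show "\<forall>\<^sub>F n in sequentially. (if c n = 0 then - \<infinity> else ereal (ln (real (c n)) / real n))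
      \<le> ereal (ln C' / real n + s)"
      using eventually_gt_at_top[of 0]
    proof eventually_elim
      case (elim n)
      show ?case
      proof (cases "c n = 0")
        case False
        then have "ln (real (c n)) \<le> ln (C' * exp (s * real n))" using C'(2)[of n] by simp
        also have "\<dots> = ln C' + s * real n" using C'(1) by (simp add: ln_mult)
        finally have "ln (real (c n)) / real n \<le> (ln C' + s * real n) / real n" by (intro divide_right_mono) auto
        then show ?thesis using False elim by (simp add: add_divide_distrib)
      qed simp
    qed
  qed
  also have "\<dots> = ereal s"
  proof (rule lim_imp_Limsup)
    have "(\<lambda>n. ln C' / real n + s) \<longlonglongrightarrow> 0 + s" by (intro tendsto_add tendsto_const lim_const_over_n)
    then show "(\<lambda>n. ereal (ln C' / real n + s)) \<longlonglongrightarrow> ereal s" by simp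
  qed simp
  finally show ?thesis .
qed

lemma Lim_at_right_mono:
  fixes f :: "real \<Rightarrow> ereal"
  assumes mono: "\<And>x y. 0 < x \<Longrightarrow> x \<le> y \<Longrightarrow> f x \<le> f y"
  shows "Lim (at_right 0) f = (INF x\<in>{0<..}. f x)"
proof (rule tendsto_Lim)
  show "(f \<longlongrightarrow> (INF x\<in>{0<..}. f x)) (at_right 0)"
  proof (rule order_tendstoI)
    fix a assume "a < (INF x\<in>{0<..}. f x)"
    then have "a < f x" if "0 < x" for x using that by (auto intro: less_le_trans INF_lower)
    then show "\<forall>\<^sub>F x in at_right 0. a < f x" by (auto simp: eventually_at_right_field intro: gt_ex)
  next
    fix a assume "(INF x\<in>{0<..}. f x) < a"
    then obtain e where e: "0 < e" "f e < a" by (auto simp: INF_less_iff)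
    then have "f x < a" if "0 < x" "x < e" for x using mono[of x e] that by (auto intro: le_less_trans)
    then show "\<forall>\<^sub>F x in at_right 0. f x < a" using e(1) by (auto simp: eventually_at_right_field)
  qed
qed simp

lemma slope_exponent_eq_INF:
  assumes fin: "\<And>n. finite {\<gamma>\<in>\<Gamma>. mdist (product_metric X) x0 (prod_act \<gamma> x0) < real n}"
  shows "slope_exponent X \<Gamma> x0 \<theta> = (INF \<epsilon>\<in>{0<..}. growth_rate (slope_count X \<Gamma> x0 \<theta> \<epsilon>))"
  unfolding slope_exponent_def growth_rate_def[symmetric]
proof (rule Lim_at_right_mono, rule growth_rate_mono)
  fix \<epsilon> \<epsilon>' :: real and n assume "\<epsilon> \<le> \<epsilon>'"
  then show "slope_count X \<Gamma> x0 \<theta> \<epsilon> n \<le> slope_count X \<Gamma> x0 \<theta> \<epsilon>' n"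
    unfolding slope_count_def
    by (intro card_mono finite_subset[OF _ fin[of n]]) (auto intro: less_le_trans)
qed

text \<open>Orbit points at distance less than \<open>n\<close> contribute at least \<open>exp (- s n)\<close> to the Poincare
  series.\<close>

lemma slope_exponent_le_critical_exponent:
  assumes fin: "\<And>n. finite {\<gamma>\<in>\<Gamma>. mdist (product_metric X) x0 (prod_act \<gamma> x0) < real n}"
  shows "slope_exponent X \<Gamma> x0 \<theta> \<le> critical_exponent X \<Gamma> x0"
  unfolding critical_exponent_def
proof (rule Inf_greatest)
  let ?D = "\<lambda>\<gamma>. mdist (product_metric X) x0 (prod_act \<gamma> x0)"
  fix v assume "v \<in> ereal ` {s. s > 0 \<and> (\<lambda>\<gamma>. exp (- s * ?D \<gamma>)) summable_on \<Gamma>}"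
  then obtain s where s: "v = ereal s" "s > 0" "(\<lambda>\<gamma>. exp (- s * ?D \<gamma>)) summable_on \<Gamma>" by auto
  define C where "C = infsum (\<lambda>\<gamma>. exp (- s * ?D \<gamma>)) \<Gamma>"
  have "real (slope_count X \<Gamma> x0 \<theta> 1 n) \<le> C * exp (s * real n)" for n
  proof -
    define S where "S = {\<gamma> \<in> \<Gamma>. 0 < ?D \<gamma> \<and> ?D \<gamma> < real n \<and>
       (\<forall>i. \<bar>mdist (X i) (x0 i) (\<gamma> i (x0 i)) / ?D \<gamma> - \<theta> $ i\<bar> < 1)}"
    have S: "finite S" "S \<subseteq> \<Gamma>" unfolding S_def by (auto intro: finite_subset[OF _ fin[of n]])
    have "real (card S) * exp (- s * real n) \<le> (\<Sum>\<gamma>\<in>S. exp (- s * ?D \<gamma>))"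
      using s(2) sum_bounded_below[of S "exp (- s * real n)" "\<lambda>\<gamma>. exp (- s * ?D \<gamma>)"] by (auto simp: S_def)
    also have "\<dots> \<le> C" unfolding C_def using s(3) S by (intro finite_sum_le_infsum) auto
    finally have "real (card S) * exp (- s * real n) * exp (s * real n) \<le> C * exp (s * real n)"
      by (intro mult_right_mono) auto
    then show ?thesis by (simp add: slope_count_def S_def mult.assoc flip: exp_add)
  qed
  then have "growth_rate (slope_count X \<Gamma> x0 \<theta> 1) \<le> v" unfolding s(1) by (rule growth_rate_le)
  then show "slope_exponent X \<Gamma> x0 \<theta> \<le> v"
    unfolding slope_exponent_eq_INF[OF fin] by (intro INF_lower2[of 1]) auto
qed

text \<open>Summation by shells \<open>n \<le> D i < n + 1\<close> leads to a geometric series of ratio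
  \<open>exp (a - k)\<close>.\<close>

lemma exponential_count_imp_summable:
  fixes D :: "'i \<Rightarrow> real"
  assumes D: "\<And>i. i \<in> S \<Longrightarrow> 0 \<le> D i" and fin: "\<And>n::nat. finite {i\<in>S. D i < real n}"
    and count: "\<forall>\<^sub>F n in sequentially. real (card {i\<in>S. D i < real n}) \<le> exp (a * real n)"
    and k: "a < k" "0 \<le> k"
  shows "(\<lambda>i. exp (- k * D i)) summable_on S"
proof (rule nonneg_bdd_above_summable_on)
  define c where "c n = real (card {i\<in>S. D i < real n})" for n
  define t where "t n = exp (- k * real n) * c (Suc n)" for n
  have t0: "0 \<le> t n" for n by (simp add: t_def c_def)
  have "summable t"
  proof (rule summable_comparison_test_ev)
    have "\<forall>\<^sub>F n in sequentially. c (Suc n) \<le> exp (a * real (Suc n))"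
      using count unfolding c_def by (subst eventually_sequentially_Suc)
    then show "\<forall>\<^sub>F n in sequentially. norm (t n) \<le> exp a * exp (a - k) ^ n"
    proof eventually_elim
      case (elim n)
      have "t n \<le> exp (- k * real n) * exp (a * real (Suc n))"
        unfolding t_def using elim by (intro mult_left_mono) auto
      also have "\<dots> = exp a * exp (a - k) ^ n"
        by (simp add: exp_of_nat_mult[symmetric] algebra_simps flip: exp_add)
      finally show ?case using t0[of n] by simp
    qed
    show "summable (\<lambda>n. exp a * exp (a - k) ^ n)" using k by (intro summable_mult summable_geometric) auto
  qed
  show "bdd_above (sum (\<lambda>i. exp (- k * D i)) ` {F. F \<subseteq> S \<and> finite F})"
  proof (rule bdd_aboveI2)
    fix F assume F: "F \<in> {F. F \<subseteq> S \<and> finite F}"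
    define N where "N = Suc (Max (insert 0 ((\<lambda>i. nat \<lfloor>D i\<rfloor>) ` F)))"
    \<comment> \<open>count an index once for every integer exceeding its distance\<close>
    have "exp (- k * D i) \<le> (\<Sum>n<N. if D i < real (Suc n) then exp (- k * real n) else 0)" if i: "i \<in> F" for i
    proof -
      define n where "n = nat \<lfloor>D i\<rfloor>"
      have Di: "0 \<le> D i" using D F i by auto
      then have n: "real n \<le> D i" "D i < real (Suc n)" unfolding n_def by (simp_all add: of_nat_nat) linarith+
      have "n \<le> Max (insert 0 ((\<lambda>i. nat \<lfloor>D i\<rfloor>) ` F))" using F i unfolding n_def by (intro Max_ge) auto
      then have "n < N" by (simp add: N_def)
      have "k * real n \<le> k * D i" using n(1) k(2) by (rule mult_left_mono)
      then have "exp (- k * D i) \<le> (if D i < real (Suc n) then exp (- k * real n) else 0)" using n by simp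
      also have "\<dots> \<le> (\<Sum>n<N. if D i < real (Suc n) then exp (- k * real n) else 0)"
        using \<open>n < N\<close> by (intro member_le_sum) auto
      finally show ?thesis .
    qed
    then have "(\<Sum>i\<in>F. exp (- k * D i)) \<le> (\<Sum>i\<in>F. \<Sum>n<N. if D i < real (Suc n) then exp (- k * real n) else 0)"
      by (rule sum_mono)
    also have "\<dots> = (\<Sum>n<N. \<Sum>i\<in>F. if D i < real (Suc n) then exp (- k * real n) else 0)" by (rule sum.swap)
    also have "\<dots> \<le> (\<Sum>n<N. t n)"
    proof (rule sum_mono)
      fix n
      have "(\<Sum>i\<in>F. if D i < real (Suc n) then exp (- k * real n) else 0)
          = real (card {i\<in>F. D i < real (Suc n)}) * exp (- k * real n)"
        using F by (simp add: sum.If_cases Int_def)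
      also have "\<dots> \<le> t n"
        unfolding t_def c_def using F by (subst mult.commute) (intro mult_left_mono of_nat_mono card_mono fin, auto)
      finally show "(\<Sum>i\<in>F. if D i < real (Suc n) then exp (- k * real n) else 0) \<le> t n" .
    qed
    also have "\<dots> \<le> suminf t" using \<open>summable t\<close> t0 by (intro sum_le_suminf) auto
    finally show "(\<Sum>i\<in>F. exp (- k * D i)) \<le> suminf t" .
  qed
qed simp

context patterson_series
begin

text \<open>The function \<open>h\<close> grows more slowly than any power, so it does not affect convergence at an
  exponent below the critical one.\<close>

lemma weight_summable_on_sparse_part:
  assumes J: "J \<subseteq> I" and a: "0 < a" "a < \<delta>"
    and count: "\<forall>\<^sub>F n in sequentially. real (card {i\<in>J. d b (z i) < real n}) \<le> exp (a * real n)"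
  shows "weight 1 b summable_on J"
proof -
  define \<alpha> where "\<alpha> = (1 - a / \<delta>) / 2"
  have \<alpha>: "\<alpha> > 0" using a \<delta> by (simp add: \<alpha>_def)
  define k where "k = \<delta> * (1 - \<alpha>)"
  have k: "a < k" using a \<delta> by (simp add: k_def \<alpha>_def field_simps)
  obtain r0 where r0: "r0 > 0" "\<And>r t. r \<ge> r0 \<Longrightarrow> t > 1 \<Longrightarrow> h (r * t) \<le> t powr \<alpha> * h r"
    using slow[OF \<alpha>] by blast
  define C where "C = h r0 * max 1 (inverse r0 powr \<alpha>)"
  have h0: "h r0 \<ge> 1" using h_ge_1 r0 by simp
  have C: "h r \<le> C * r powr \<alpha>" if r: "r \<ge> 1" for r
  proof (cases "r \<le> r0")
    case True
    then have "h r \<le> h r0" using r r0 by (intro mono_onD[OF h_mono]) auto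
    also have "\<dots> \<le> h r0 * max 1 (inverse r0 powr \<alpha>) * 1" using h0 by (simp add: mult_le_cancel_left1)
    also have "\<dots> \<le> C * r powr \<alpha>"
      unfolding C_def using h0 r \<alpha> by (intro mult_left_mono ge_one_powr_ge_zero mult_nonneg_nonneg) auto
    finally show ?thesis .
  next
    case False
    then have "h (r0 * (r / r0)) \<le> (r / r0) powr \<alpha> * h r0" using r0 by (intro r0(2)) auto
    moreover have "r0 * (r / r0) = r" using r0(1) by simp
    ultimately have "h r \<le> (r / r0) powr \<alpha> * h r0" by simp
    then have "h r \<le> (inverse r0 powr \<alpha>) * (r powr \<alpha>) * h r0"
      using r0(1) r by (simp add: divide_inverse powr_mult mult.commute)
    also have "\<dots> \<le> C * r powr \<alpha>"
      unfolding C_def using h0 by (auto intro!: mult_right_mono mult_left_mono simp: mult_ac)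
    finally show ?thesis .
  qed
  have bound: "weight 1 b i \<le> C * exp (- k * d b (z i))" for i
  proof -
    have "weight 1 b i \<le> exp (- 1 * (\<delta> * d b (z i))) * (C * exp (\<delta> * d b (z i)) powr \<alpha>)"
      unfolding weight_def using \<delta> by (intro mult_left_mono C) auto
    also have "\<dots> = C * exp (- k * d b (z i))"
      by (simp add: powr_def k_def algebra_simps flip: exp_add)
    finally show ?thesis .
  qed
  have "(\<lambda>i. exp (- k * d b (z i))) summable_on J"
  proof (rule exponential_count_imp_summable[OF _ _ count k])
    show "finite {i\<in>J. d b (z i) < real n}" for n
      using J by (intro finite_subset[OF _ finite_in_ball[of "real n"]]) auto
  qed (use a k in auto)
  then have "(\<lambda>i. C * exp (- k * d b (z i))) summable_on J" by (rule summable_on_cmult_right)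
  then show ?thesis
    by (rule summable_on_comparison_test) (use bound weight_pos[of 1 b] in \<open>auto intro: less_imp_le\<close>)
qed

end

section \<open>Slopes of rays\<close>

text \<open>The constant speeds on initial segments of a ray agree, since each is the speed on the unit
  interval.\<close>

lemma ray_component_speed:
  fixes X :: "'r::finite \<Rightarrow> 'a metric"
  assumes geo: "\<And>i. geodesic_space (X i)" and CN: "\<And>i. CN_inequality (X i)"
    and \<sigma>: "geodesic_ray (product_metric X) \<sigma>" and st: "0 \<le> s" "0 \<le> t"
  shows "mdist (X i) (\<sigma> s i) (\<sigma> t i) = \<bar>s - t\<bar> * mdist (X i) (\<sigma> 0 i) (\<sigma> 1 i)"
proof -
  let ?Y = "product_metric X"
  define n where "n = max 1 (max s t)"
  have n: "1 \<le> n" "s \<le> n" "t \<le> n" by (auto simp: n_def)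
  have r: "\<sigma> t \<in> mspace ?Y" "mdist ?Y (\<sigma> s) (\<sigma> t) = \<bar>s - t\<bar>" if "0 \<le> s" "0 \<le> t" for s t
    using \<sigma> that unfolding geodesic_ray_def by blast+
  have L: "mdist ?Y (\<sigma> 0) (\<sigma> n) = n" using r(2)[of 0 n] n by simp
  have seg: "geodesic_segment ?Y \<sigma> (\<sigma> 0) (\<sigma> n)"
    unfolding geodesic_segment_def L using r(1)[of 0] r(2) by (auto simp del: mspace_product_metric)
  define v where "v = mdist (X i) (\<sigma> 0 i) (\<sigma> n i) / n"
  have "mdist (X i) (\<sigma> s i) (\<sigma> t i) = \<bar>s - t\<bar> * v"
    using product_geodesic_component_speed[OF geo CN seg, of s t i] n st by (simp add: L v_def)
  moreover have "mdist (X i) (\<sigma> 0 i) (\<sigma> 1 i) = \<bar>0 - 1\<bar> * v"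
    using product_geodesic_component_speed[OF geo CN seg, of 0 1 i] n by (simp add: L v_def)
  ultimately show ?thesis by simp
qed

lemma ray_slope:
  fixes X :: "'r::finite \<Rightarrow> 'a metric"
  assumes geo: "\<And>i. geodesic_space (X i)" and CN: "\<And>i. CN_inequality (X i)"
    and \<sigma>: "geodesic_ray (product_metric X) \<sigma>"
  defines "\<theta> \<equiv> (\<chi> i. mdist (X i) (\<sigma> 0 i) (\<sigma> 1 i))"
  shows "ray_has_slope X \<sigma> \<theta>" "0 \<le> t \<Longrightarrow> mdist (X i) (\<sigma> 0 i) (\<sigma> t i) = t * \<theta> $ i"
proof -
  let ?Y = "product_metric X"
  have r: "\<sigma> t i \<in> mspace (X i)" if "0 \<le> t" for t i using \<sigma> that unfolding geodesic_ray_def by auto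
  have d01: "mdist ?Y (\<sigma> 0) (\<sigma> 1) = 1" using \<sigma> unfolding geodesic_ray_def by auto
  have speed: "mdist (X i) (\<sigma> s i) (\<sigma> t i) = \<bar>s - t\<bar> * \<theta> $ i" if "0 \<le> s" "0 \<le> t" for s t i
    using ray_component_speed[OF geo CN \<sigma> that] by (simp add: \<theta>_def)
  show "0 \<le> t \<Longrightarrow> mdist (X i) (\<sigma> 0 i) (\<sigma> t i) = t * \<theta> $ i" using speed[of 0 t i] by simp
  have \<theta>: "\<theta> \<in> slopes"
    using d01 by (simp add: slopes_def \<theta>_def norm_vec_def L2_set_def mdist_product_metric)
  show "ray_has_slope X \<sigma> \<theta>"
    unfolding ray_has_slope_def
  proof (intro conjI \<theta> allI)
    fix i
    show "if \<theta> $ i = 0 then \<exists>p\<in>mspace (X i). \<forall>t\<ge>0. \<sigma> t i = p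
          else \<exists>\<rho>. geodesic_ray (X i) \<rho> \<and> (\<forall>t\<ge>0. \<sigma> t i = \<rho> (t * \<theta> $ i))"
    proof (cases "\<theta> $ i = 0")
      case True
      have "\<sigma> t i = \<sigma> 0 i" if t: "0 \<le> t" for t
      proof -
        have "mdist (X i) (\<sigma> t i) (\<sigma> 0 i) = 0" unfolding speed[OF t order_refl] True by simp
        then show ?thesis using mdist_zero[OF r[OF t] r[OF order_refl]] by (rule iffD1[rotated])
      qed
      then have "\<exists>p\<in>mspace (X i). \<forall>t\<ge>0. \<sigma> t i = p" using r[OF order_refl, of i] by blast
      then show ?thesis using True by simp
    next
      case False
      then have p: "\<theta> $ i > 0" using \<theta> by (auto simp: slopes_def order_less_le)
      have "geodesic_ray (X i) (\<lambda>u. \<sigma> (u / \<theta> $ i) i)"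
        unfolding geodesic_ray_def
      proof (intro conjI allI impI)
        show "(\<lambda>u. \<sigma> (u / \<theta> $ i) i) ` {0..} \<subseteq> mspace (X i)" using r p by auto
        fix s t :: real assume "0 \<le> s" "0 \<le> t"
        then have "mdist (X i) (\<sigma> (s / \<theta> $ i) i) (\<sigma> (t / \<theta> $ i) i) = \<bar>s / \<theta> $ i - t / \<theta> $ i\<bar> * \<theta> $ i"
          using speed[of "s / \<theta> $ i" "t / \<theta> $ i" i] p by simp
        also have "\<dots> = \<bar>s - t\<bar>" using p by (simp flip: diff_divide_distrib)
        finally show "mdist (X i) (\<sigma> (s / \<theta> $ i) i) (\<sigma> (t / \<theta> $ i) i) = \<bar>s - t\<bar>" .
      qed
      then show ?thesis using False by (auto intro!: exI[of _ "\<lambda>u. \<sigma> (u / \<theta> $ i) i"])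
    qed
  qed
qed

text \<open>The components of the geodesic to \<open>w\<close> and of the ray have constant speed, so their positions
  at time 1 show the two directions.\<close>

lemma cone_nbhd_direction:
  fixes X :: "'r::finite \<Rightarrow> 'a metric"
  assumes geo: "\<And>i. geodesic_space (X i)" and CN: "\<And>i. CN_inequality (X i)"
    and c: "geodesic_ray (product_metric X) c"
    and w: "Inl w \<in> cone_nbhd (product_metric X) c 1 \<epsilon>"
  shows "1 < mdist (product_metric X) (c 0) w"
    "\<bar>mdist (X i) (c 0 i) (w i) / mdist (product_metric X) (c 0) w - mdist (X i) (c 0 i) (c 1 i)\<bar> < \<epsilon>"
proof -
  let ?Y = "product_metric X"
  obtain \<sigma> where \<sigma>: "1 < mdist ?Y (c 0) w" "geodesic_segment ?Y \<sigma> (c 0) w" "mdist ?Y (\<sigma> 1) (c 1) < \<epsilon>"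
    using w unfolding cone_nbhd_def by auto
  show "1 < mdist ?Y (c 0) w" by (rule \<sigma>)
  have "c t \<in> mspace ?Y" if "0 \<le> t" for t using c that unfolding geodesic_ray_def by blast
  then have m: "c 0 \<in> mspace ?Y" "c 1 \<in> mspace ?Y" by (simp_all del: mspace_product_metric)
  have s: "\<sigma> 1 \<in> mspace ?Y" "\<sigma> 0 = c 0"
    using geodesic_segment_props(1,5)[OF \<sigma>(2)] \<sigma>(1) by (auto simp del: mspace_product_metric)
  have "mdist (X i) (\<sigma> 0 i) (\<sigma> 1 i) = \<bar>0 - 1\<bar> * (mdist (X i) (c 0 i) (w i) / mdist ?Y (c 0) w)"
    using \<sigma>(1) by (intro product_geodesic_component_speed[OF geo CN \<sigma>(2)]) auto
  then have "mdist (X i) (c 0 i) (\<sigma> 1 i) = mdist (X i) (c 0 i) (w i) / mdist ?Y (c 0) w" using s by simp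
  moreover have "mdist (X i) (\<sigma> 1 i) (c 1 i) < \<epsilon>" using mdist_component_le[of X i "\<sigma> 1" "c 1"] \<sigma>(3) by simp
  moreover have "mdist (X i) (c 0 i) (\<sigma> 1 i) \<le> mdist (X i) (c 0 i) (c 1 i) + mdist (X i) (\<sigma> 1 i) (c 1 i)"
    "mdist (X i) (c 0 i) (c 1 i) \<le> mdist (X i) (c 0 i) (\<sigma> 1 i) + mdist (X i) (\<sigma> 1 i) (c 1 i)"
    using mdist_triangle[of "c 0 i" "X i" "c 1 i" "\<sigma> 1 i"] mdist_triangle[of "c 0 i" "X i" "\<sigma> 1 i" "c 1 i"] m s(1)
    by (simp_all add: mdist_commute[of "X i" "c 1 i"])
  ultimately show "\<bar>mdist (X i) (c 0 i) (w i) / mdist ?Y (c 0) w - mdist (X i) (c 0 i) (c 1 i)\<bar> < \<epsilon>"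
    by linarith
qed

section \<open>Groups of isometries of the product\<close>

lemma isometry_group_carrierD:
  assumes "f \<in> carrier (isometry_group m)"
  shows "f \<in> Bij (mspace m)" "isometric_into m f"
  using assms unfolding isometry_group_def isometric_into_def
  by (auto dest: Bij_imp_funcset)

lemma group_isometry_group: "group (isometry_group m)"
proof -
  let ?S = "mspace m"
  let ?H = "{f \<in> Bij ?S. \<forall>x\<in>?S. \<forall>y\<in>?S. mdist m (f x) (f y) = mdist m x y}"
  have "subgroup ?H (BijGroup ?S)"
  proof (rule subgroup.intro)
    show "?H \<subseteq> carrier (BijGroup ?S)" by (auto simp: BijGroup_def)
    show "\<one>\<^bsub>BijGroup ?S\<^esub> \<in> ?H" by (auto simp: BijGroup_def id_Bij)
  next
    fix f g assume fg: "f \<in> ?H" "g \<in> ?H"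
    then have "compose ?S f g \<in> ?H"
      using Bij_imp_funcset[of g ?S] by (simp add: compose_Bij compose_eq Pi_iff)
    then show "f \<otimes>\<^bsub>BijGroup ?S\<^esub> g \<in> ?H" using fg by (simp add: BijGroup_def)
  next
    fix f assume f: "f \<in> ?H"
    then have fB: "f \<in> Bij ?S" by simp
    have inv: "inv_into ?S f x \<in> ?S" "f (inv_into ?S f x) = x" if "x \<in> ?S" for x
      using Bij_inv_into_mem[OF fB that] fB that by (auto simp: Bij_def bij_betw_def f_inv_into_f)
    have "mdist m (inv_into ?S f x) (inv_into ?S f y) = mdist m x y" if "x \<in> ?S" "y \<in> ?S" for x y
      using f inv[OF that(1)] inv[OF that(2)] by force
    then show "inv\<^bsub>BijGroup ?S\<^esub> f \<in> ?H"
      using restrict_inv_into_Bij[OF fB] by (auto simp: inv_BijGroup[OF fB])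
  qed
  then show ?thesis
    unfolding isometry_group_def by (rule subgroup.subgroup_is_group[OF _ group_BijGroup])
qed

locale product_isometry_group =
  fixes X :: "'r::finite \<Rightarrow> 'a metric" and \<Gamma> :: "('r \<Rightarrow> 'a \<Rightarrow> 'a) set"
  assumes subgroup: "subgroup \<Gamma> (product_group UNIV (\<lambda>i. isometry_group (X i)))"
begin

abbreviation Y where "Y \<equiv> product_metric X"
abbreviation G where "G \<equiv> product_group UNIV (\<lambda>i. isometry_group (X i))"

lemma group_G: "group G"
  by (rule product_group) (rule group_isometry_group)

lemma component:
  assumes "\<gamma> \<in> \<Gamma>" shows "\<gamma> i \<in> carrier (isometry_group (X i))"
  using subgroup.subset[OF subgroup] assms by (auto simp: PiE_iff)

lemma isometric_component: "\<gamma> \<in> \<Gamma> \<Longrightarrow> isometric_into (X i) (\<gamma> i)"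
  by (rule isometry_group_carrierD(2)[OF component])

lemma isometric_prod_act:
  assumes "\<gamma> \<in> \<Gamma>" shows "isometric_into (Y) (prod_act \<gamma>)"
  unfolding isometric_into_def
  using isometric_intoD[OF isometric_component[OF assms]]
  by (auto simp: prod_act_def mdist_product_metric)

lemma prod_act_mult:
  assumes "\<gamma> \<in> \<Gamma>" "\<beta> \<in> \<Gamma>" "x \<in> mspace (Y)"
  shows "prod_act (\<gamma> \<otimes>\<^bsub>G\<^esub> \<beta>) x = prod_act \<gamma> (prod_act \<beta> x)"
proof
  fix i
  show "prod_act (\<gamma> \<otimes>\<^bsub>G\<^esub> \<beta>) x i = prod_act \<gamma> (prod_act \<beta> x) i"
    using isometry_group_carrierD(1)[OF component[OF assms(1), of i]]
      isometry_group_carrierD(1)[OF component[OF assms(2), of i]] assms(3)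
    by (simp add: prod_act_def isometry_group_def BijGroup_def compose_def)
qed

lemma prod_act_one:
  assumes "x \<in> mspace (Y)" shows "prod_act \<one>\<^bsub>G\<^esub> x = x"
  using assms by (auto simp: prod_act_def isometry_group_def BijGroup_def)

lemma prod_act_inverse:
  assumes \<gamma>: "\<gamma> \<in> \<Gamma>" and x: "x \<in> mspace (Y)"
  shows "prod_act \<gamma> (prod_act (inv\<^bsub>G\<^esub> \<gamma>) x) = x" "prod_act (inv\<^bsub>G\<^esub> \<gamma>) (prod_act \<gamma> x) = x"
proof -
  have i: "inv\<^bsub>G\<^esub> \<gamma> \<in> \<Gamma>" by (rule subgroup.m_inv_closed[OF subgroup \<gamma>])
  have c: "\<gamma> \<in> carrier G" by (rule subgroup.mem_carrier[OF subgroup \<gamma>])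
  have "\<gamma> \<otimes>\<^bsub>G\<^esub> inv\<^bsub>G\<^esub> \<gamma> = \<one>\<^bsub>G\<^esub>" "inv\<^bsub>G\<^esub> \<gamma> \<otimes>\<^bsub>G\<^esub> \<gamma> = \<one>\<^bsub>G\<^esub>"
    by (rule group.r_inv[OF group_G c], rule group.l_inv[OF group_G c])
  then show "prod_act \<gamma> (prod_act (inv\<^bsub>G\<^esub> \<gamma>) x) = x" "prod_act (inv\<^bsub>G\<^esub> \<gamma>) (prod_act \<gamma> x) = x"
    using prod_act_mult[OF \<gamma> i x] prod_act_mult[OF i \<gamma> x] prod_act_one[OF x] by metis+
qed

lemma bij_left_mult:
  assumes \<gamma>: "\<gamma> \<in> \<Gamma>" shows "bij_betw (\<lambda>\<beta>. \<gamma> \<otimes>\<^bsub>G\<^esub> \<beta>) \<Gamma> \<Gamma>"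
proof (rule bij_betw_byWitness[where f' = "\<lambda>\<beta>. inv\<^bsub>G\<^esub> \<gamma> \<otimes>\<^bsub>G\<^esub> \<beta>"])
  interpret group G by (rule group_G)
  have i: "inv\<^bsub>G\<^esub> \<gamma> \<in> \<Gamma>" by (rule subgroup.m_inv_closed[OF subgroup \<gamma>])
  have c: "\<beta> \<in> carrier G" if "\<beta> \<in> \<Gamma>" for \<beta> by (rule subgroup.mem_carrier[OF subgroup that])
  show "\<forall>\<beta>\<in>\<Gamma>. inv\<^bsub>G\<^esub> \<gamma> \<otimes>\<^bsub>G\<^esub> (\<gamma> \<otimes>\<^bsub>G\<^esub> \<beta>) = \<beta>"
    using inv_solve_left'[OF c[OF \<gamma>]] c \<gamma> by (metis m_assoc inv_closed l_inv l_one)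
  show "\<forall>\<beta>\<in>\<Gamma>. \<gamma> \<otimes>\<^bsub>G\<^esub> (inv\<^bsub>G\<^esub> \<gamma> \<otimes>\<^bsub>G\<^esub> \<beta>) = \<beta>"
    using c \<gamma> by (metis m_assoc inv_closed r_inv l_one)
  show "(\<lambda>\<beta>. \<gamma> \<otimes>\<^bsub>G\<^esub> \<beta>) ` \<Gamma> \<subseteq> \<Gamma>" "(\<lambda>\<beta>. inv\<^bsub>G\<^esub> \<gamma> \<otimes>\<^bsub>G\<^esub> \<beta>) ` \<Gamma> \<subseteq> \<Gamma>"
    using subgroup.m_closed[OF subgroup] \<gamma> i by blast+
qed

lemma ray_has_slope_image:
  assumes \<gamma>: "\<gamma> \<in> \<Gamma>" and \<sigma>: "ray_has_slope X \<sigma> \<theta>"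
  shows "ray_has_slope X (prod_act \<gamma> \<circ> \<sigma>) \<theta>"
  unfolding ray_has_slope_def
proof (intro conjI allI)
  show "\<theta> \<in> slopes" using \<sigma> by (simp add: ray_has_slope_def)
  fix i
  have i: "if \<theta> $ i = 0 then \<exists>p\<in>mspace (X i). \<forall>t\<ge>0. \<sigma> t i = p
          else \<exists>\<rho>. geodesic_ray (X i) \<rho> \<and> (\<forall>t\<ge>0. \<sigma> t i = \<rho> (t * \<theta> $ i))"
    using \<sigma> unfolding ray_has_slope_def by blast
  show "if \<theta> $ i = 0 then \<exists>p\<in>mspace (X i). \<forall>t\<ge>0. (prod_act \<gamma> \<circ> \<sigma>) t i = p
          else \<exists>\<rho>. geodesic_ray (X i) \<rho> \<and> (\<forall>t\<ge>0. (prod_act \<gamma> \<circ> \<sigma>) t i = \<rho> (t * \<theta> $ i))"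
  proof (cases "\<theta> $ i = 0")
    case True
    then obtain p where "p \<in> mspace (X i)" "\<forall>t\<ge>0. \<sigma> t i = p" using i by auto
    then show ?thesis using True isometric_intoD(1)[OF isometric_component[OF \<gamma>], of p i]
      by (auto simp: prod_act_def)
  next
    case False
    then obtain \<rho> where "geodesic_ray (X i) \<rho>" "\<forall>t\<ge>0. \<sigma> t i = \<rho> (t * \<theta> $ i)" using i by auto
    then show ?thesis using False isometric_ray[OF isometric_component[OF \<gamma>], of i \<rho>]
      by (auto simp: prod_act_def intro!: exI[of _ "\<gamma> i \<circ> \<rho>"])
  qed
qed

lemma boundary_of_slope_invariant:
  assumes \<gamma>: "\<gamma> \<in> \<Gamma>" and \<xi>: "\<xi> \<in> boundary_of_slope X \<theta>"
  shows "bord_act (Y) (prod_act \<gamma>) \<xi> \<in> boundary_of_slope X \<theta>"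
proof -
  obtain C \<sigma> where C: "\<xi> = Inr C" "Inr C \<in> geom_boundary (Y)" "\<sigma> \<in> C" "ray_has_slope X \<sigma> \<theta>"
    using \<xi> unfolding boundary_of_slope_def by auto
  obtain C' where "bord_act (Y) (prod_act \<gamma>) (Inr C) = Inr C'"
    "Inr C' \<in> geom_boundary (Y)" "prod_act \<gamma> \<circ> \<sigma> \<in> C'"
    using bord_act_boundary[OF isometric_prod_act[OF \<gamma>] C(2,3)] by blast
  then show ?thesis using ray_has_slope_image[OF \<gamma> C(4)] C(1) unfolding boundary_of_slope_def by auto
qed

lemma limit_set_invariant:
  assumes Y: "proper_CN_space (Y)" and \<gamma>: "\<gamma> \<in> \<Gamma>"
    and x: "x \<in> mspace (Y)" and \<xi>: "\<xi> \<in> limit_set X \<Gamma> x"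
  shows "bord_act (Y) (prod_act \<gamma>) \<xi> \<in> limit_set X \<Gamma> x"
proof -
  interpret proper_CN_space "Y" by (rule Y)
  let ?O = "(\<lambda>\<beta>. Inl (prod_act \<beta> x)) ` \<Gamma> :: ('r \<Rightarrow> 'a) bordpt set" and ?a = "bord_act (Y) (prod_act \<gamma>)"
  have i: "inv\<^bsub>G\<^esub> \<gamma> \<in> \<Gamma>" by (rule subgroup.m_inv_closed[OF subgroup \<gamma>])
  have "continuous_map T T ?a"
    by (rule continuous_bord_act[OF isometric_prod_act[OF \<gamma>] isometric_prod_act[OF i] prod_act_inverse(1)[OF \<gamma>] x])
  then have "?a ` (T closure_of ?O) \<subseteq> T closure_of (?a ` ?O)" by (rule continuous_map_image_closure_subset)
  moreover have "?a ` ?O \<subseteq> ?O"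
  proof
    fix \<eta> assume "\<eta> \<in> ?a ` ?O"
    then obtain \<beta> where \<beta>: "\<beta> \<in> \<Gamma>" "\<eta> = Inl (prod_act \<gamma> (prod_act \<beta> x))" by auto
    then have "\<eta> = Inl (prod_act (\<gamma> \<otimes>\<^bsub>G\<^esub> \<beta>) x)" using prod_act_mult[OF \<gamma> \<beta>(1) x] by simp
    moreover have "\<gamma> \<otimes>\<^bsub>G\<^esub> \<beta> \<in> \<Gamma>" by (rule subgroup.m_closed[OF subgroup \<gamma> \<beta>(1)])
    ultimately show "\<eta> \<in> ?O" by blast
  qed
  then have "T closure_of (?a ` ?O) \<subseteq> T closure_of ?O" by (rule closure_of_mono)
  ultimately show ?thesis
    using \<xi> bord_act_in_boundary[OF isometric_prod_act[OF \<gamma>]] unfolding limit_set_def by blast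
qed

lemma limit_points_of_slope_invariant:
  assumes Y: "proper_CN_space (Y)" and \<gamma>: "\<gamma> \<in> \<Gamma>"
    and x: "x \<in> mspace (Y)"
  shows "bord_act (Y) (prod_act \<gamma>) ` (limit_set X \<Gamma> x \<inter> boundary_of_slope X \<theta>)
    = limit_set X \<Gamma> x \<inter> boundary_of_slope X \<theta>"
proof
  have sub: "bord_act (Y) (prod_act \<beta>) ` (limit_set X \<Gamma> x \<inter> boundary_of_slope X \<theta>)
    \<subseteq> limit_set X \<Gamma> x \<inter> boundary_of_slope X \<theta>" if "\<beta> \<in> \<Gamma>" for \<beta>
    using limit_set_invariant[OF Y that x] boundary_of_slope_invariant[OF that] by blast
  show "bord_act (Y) (prod_act \<gamma>) ` (limit_set X \<Gamma> x \<inter> boundary_of_slope X \<theta>)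
    \<subseteq> limit_set X \<Gamma> x \<inter> boundary_of_slope X \<theta>" by (rule sub[OF \<gamma>])
  have i: "inv\<^bsub>G\<^esub> \<gamma> \<in> \<Gamma>" by (rule subgroup.m_inv_closed[OF subgroup \<gamma>])
  show "limit_set X \<Gamma> x \<inter> boundary_of_slope X \<theta>
    \<subseteq> bord_act (Y) (prod_act \<gamma>) ` (limit_set X \<Gamma> x \<inter> boundary_of_slope X \<theta>)"
  proof
    fix \<xi> assume \<xi>: "\<xi> \<in> limit_set X \<Gamma> x \<inter> boundary_of_slope X \<theta>"
    then have \<xi>b: "\<xi> \<in> bordification (Y)"
      using geom_boundary_subset_bordification unfolding limit_set_def by blast
    have eq: "bord_act (Y) (prod_act \<gamma>) (bord_act (Y) (prod_act (inv\<^bsub>G\<^esub> \<gamma>)) \<xi>) = \<xi>"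
      by (rule bord_act_inverse[OF isometric_prod_act[OF i] isometric_prod_act[OF \<gamma>] _ \<xi>b])
        (rule prod_act_inverse(1)[OF \<gamma>])
    have "bord_act (Y) (prod_act (inv\<^bsub>G\<^esub> \<gamma>)) \<xi> \<in> limit_set X \<Gamma> x \<inter> boundary_of_slope X \<theta>"
      using sub[OF i] imageI[OF \<xi>] by (rule subsetD)
    then show "\<xi> \<in> bord_act (Y) (prod_act \<gamma>) ` (limit_set X \<Gamma> x \<inter> boundary_of_slope X \<theta>)"
      by (intro image_eqI[where x = "bord_act (Y) (prod_act (inv\<^bsub>G\<^esub> \<gamma>)) \<xi>"] eq[symmetric])
  qed
qed

end

section \<open>Patterson measures of a product\<close>

lemma proper_CN_product:
  fixes X :: "'r::finite \<Rightarrow> 'a metric"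
  assumes "\<And>i. Hadamard_space (X i)" "\<And>i. locally_compact_space (mtopology_of (X i))"
  shows "proper_CN_space (product_metric X)"
proof
  have X: "geodesic_space (X i)" "CN_inequality (X i)" "mcomplete_of (X i)" "balls_totally_bounded (X i)" for i
    using assms(1)[of i] CAT0_imp_CN_inequality[of "X i"] Hopf_Rinow[OF _ _ assms(2)[of i]]
    unfolding Hadamard_space_def CAT0_def by auto
  show "geodesic_space (product_metric X)" by (rule geodesic_space_product[OF X(1)])
  show "CN_inequality (product_metric X)" by (rule CN_inequality_product[OF X(1,2)])
  show "mcomplete_of (product_metric X)" by (rule mcomplete_of_product[OF X(3)])
  show "balls_totally_bounded (product_metric X)" by (rule balls_totally_bounded_product[OF X(4)])
qed

theorem theoremA:
  fixes X :: "'r::finite \<Rightarrow> 'a metric"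
    and \<Gamma> :: "('r \<Rightarrow> 'a \<Rightarrow> 'a) set"
    and hh gg :: "'r \<Rightarrow> 'a \<Rightarrow> 'a"
    and x0 :: "'r \<Rightarrow> 'a"
    and \<theta>s :: "real ^ 'r"
    and h :: "real \<Rightarrow> real"
    and s :: "nat \<Rightarrow> real"
    and \<mu>0 :: "('r \<Rightarrow> 'a) bordpt measure"
  defines "Y \<equiv> product_metric X"
    and "\<delta> \<equiv> critical_exponent X \<Gamma> x0"
  assumes "\<And>i. Hadamard_space (X i)"
    and "\<And>i. locally_compact_space (mtopology_of (X i))"
    and "subgroup \<Gamma> (product_group UNIV (\<lambda>i. isometry_group (X i)))"
    and "properly_discontinuous X \<Gamma>"
    and "hh \<in> \<Gamma>" and "gg \<in> \<Gamma>"
    and "\<And>i. independent_rank_one (X i) (gg i) (hh i)"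
    and "x0 \<in> Ax Y (prod_act hh)"
    and "\<delta> < \<infinity>"
    and "\<forall>\<theta>. is_arg_max (slope_exponent X \<Gamma> x0) (\<lambda>\<theta>. \<theta> \<in> slopes) \<theta> \<longleftrightarrow> \<theta> = \<theta>s"
    and "patterson_function X \<Gamma> x0 h"
    and "\<And>j. s j > 1" and "decseq s" and "s \<longlonglongrightarrow> 1"
    and "finite_borel_measure (cone_topology Y) \<mu>0"
    and "weakly_converges (cone_topology Y) (\<lambda>j. patterson_measure X \<Gamma> x0 h (s j) x0) \<mu>0"
  shows "(\<forall>\<gamma>\<in>\<Gamma>. bord_act Y (prod_act \<gamma>) ` (limit_set X \<Gamma> x0 \<inter> boundary_of_slope X \<theta>s)
                 = limit_set X \<Gamma> x0 \<inter> boundary_of_slope X \<theta>s) \<and>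
    (\<exists>\<mu>. \<mu> x0 = \<mu>0 \<and>
      (\<forall>x\<in>mspace Y. finite_borel_measure (cone_topology Y) (\<mu> x) \<and>
         weakly_converges (cone_topology Y) (\<lambda>j. patterson_measure X \<Gamma> x0 h (s j) x) (\<mu> x)) \<and>
      conformal_density X \<Gamma> x0 (real_of_ereal \<delta>)
        (\<lambda>x. restrict_space (\<mu> x) (geom_boundary Y)) \<and>
      (\<forall>x\<in>mspace Y. msupport (cone_topology Y) (\<mu> x)
         \<subseteq> limit_set X \<Gamma> x0 \<inter> boundary_of_slope X \<theta>s))"
proof -
  define D where "D = real_of_ereal \<delta>"
  let ?z = "\<lambda>\<gamma>. prod_act \<gamma> x0"
  have hadamard: "\<And>i. Hadamard_space (X i)" using assms(3) .
  have geo: "\<And>i. geodesic_space (X i)" using hadamard unfolding Hadamard_space_def CAT0_def by blast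
  have CN: "\<And>i. CN_inequality (X i)"
    using hadamard unfolding Hadamard_space_def by (blast intro: CAT0_imp_CN_inequality)
  have Y: "proper_CN_space Y" unfolding Y_def by (rule proper_CN_product[OF assms(3,4)])
  interpret G: product_isometry_group X \<Gamma> by (rule product_isometry_group.intro) (rule assms(5))
  have x0: "x0 \<in> mspace Y" using assms(10) unfolding Ax_def by blast
  have zM: "?z \<gamma> \<in> mspace Y" if "\<gamma> \<in> \<Gamma>" for \<gamma>
    using isometric_intoD(1)[OF G.isometric_prod_act[OF that]] x0 unfolding Y_def by blast
  have pf: "h ` {0..} \<subseteq> {1..}" "mono_on {0..} h"
    "\<And>s. s > 1 \<Longrightarrow> patterson_term X \<Gamma> x0 h s x0 summable_on \<Gamma>"
    "\<And>s. s \<le> 1 \<Longrightarrow> \<not> patterson_term X \<Gamma> x0 h s x0 summable_on \<Gamma>"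
    "\<And>\<alpha>. \<alpha> > 0 \<Longrightarrow> \<exists>r0>0. \<forall>r\<ge>r0. \<forall>t>1. h (r * t) \<le> t powr \<alpha> * h r"
    using assms(13) unfolding patterson_function_def by blast+
  have term_eq: "patterson_term X \<Gamma> x0 h s x \<gamma>
      = exp (- s * (D * mdist Y x (?z \<gamma>))) * h (exp (D * mdist Y x (?z \<gamma>)))" for s x \<gamma>
    by (simp add: patterson_term_def patterson_b_def D_def \<delta>_def Y_def)
  have "0 \<le> \<delta>" unfolding \<delta>_def critical_exponent_def by (rule Inf_greatest) auto
  then have \<delta>D: "\<delta> = ereal D" and "0 \<le> D"
    using assms(11) unfolding D_def by (cases \<delta>; simp)+
  \<comment> \<open>for exponent 0 the Patterson series would not depend on \<open>s\<close>\<close>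
  have "D > 0"
  proof (rule ccontr)
    assume "\<not> D > 0"
    then have "D = 0" using \<open>0 \<le> D\<close> by simp
    then have "patterson_term X \<Gamma> x0 h 2 x0 = patterson_term X \<Gamma> x0 h 1 x0" by (simp add: term_eq fun_eq_iff)
    then show False using pf(3)[of 2] pf(4)[of 1] by simp
  qed
  have series: "patterson_series_axioms Y \<Gamma> ?z x0 D h"
  proof (rule patterson_series_axioms.intro)
    show "x0 \<in> mspace Y" "0 < D" "mono_on {0..} h" by fact+
    show "\<And>\<gamma>. \<gamma> \<in> \<Gamma> \<Longrightarrow> ?z \<gamma> \<in> mspace Y" by (rule zM)
    show "\<And>t. 0 \<le> t \<Longrightarrow> 1 \<le> h t" using pf(1) by (auto simp: image_subset_iff)
    show "\<And>s. 1 < s \<Longrightarrow> (\<lambda>\<gamma>. exp (- s * (D * mdist Y x0 (?z \<gamma>))) * h (exp (D * mdist Y x0 (?z \<gamma>)))) summable_on \<Gamma>"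
      using pf(3) unfolding term_eq[abs_def] .
    show "\<not> (\<lambda>\<gamma>. exp (- 1 * (D * mdist Y x0 (?z \<gamma>))) * h (exp (D * mdist Y x0 (?z \<gamma>)))) summable_on \<Gamma>"
      using pf(4)[of 1] unfolding term_eq[abs_def] by simp
    show "\<And>\<alpha>. 0 < \<alpha> \<Longrightarrow> \<exists>r0>0. \<forall>r\<ge>r0. \<forall>t>1. h (r * t) \<le> t powr \<alpha> * h r" by (rule pf(5))
  qed
  interpret S: patterson_series Y \<Gamma> ?z x0 D h
    by (intro patterson_series.intro Y series)
  have weight_eq: "patterson_term X \<Gamma> x0 h s x = S.weight s x" for s x
    by (simp add: fun_eq_iff term_eq S.weight_def)
  have \<nu>_eq: "patterson_measure X \<Gamma> x0 h s x = S.\<nu> s x" for s x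
    unfolding patterson_measure_def S.\<nu>_def S.total_def weight_eq Y_def[symmetric] ..
  interpret L: patterson_limit Y \<Gamma> ?z x0 D h s \<mu>0
  proof (intro patterson_limit.intro S.patterson_series_axioms patterson_limit_axioms.intro)
    show "\<And>j. 1 < s j" "s \<longlonglongrightarrow> 1" "finite_borel_measure (cone_topology Y) \<mu>0"
      by (fact assms(14), fact assms(16), fact assms(17))
    show "weakly_converges (cone_topology Y) (\<lambda>j. S.\<nu> (s j) x0) \<mu>0"
      using assms(18) unfolding \<nu>_eq .
  qed

  have fin: "finite {\<gamma>\<in>\<Gamma>. mdist (product_metric X) x0 (?z \<gamma>) < real n}" for n
    by (rule finite_subset[OF _ S.finite_in_ball[of "real n"]]) (auto simp: Y_def)
  \<comment> \<open>The only place where the maximal slope enters: every other slope has a smaller exponent.\<close>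
  have exponent_less: "slope_exponent X \<Gamma> x0 \<theta> < ereal D" if \<theta>: "\<theta> \<in> slopes" "\<theta> \<noteq> \<theta>s" for \<theta>
  proof -
    have "\<not> is_arg_max (slope_exponent X \<Gamma> x0) (\<lambda>\<theta>. \<theta> \<in> slopes) \<theta>" using assms(12) \<theta>(2) by blast
    then obtain \<theta>' where "slope_exponent X \<Gamma> x0 \<theta> < slope_exponent X \<Gamma> x0 \<theta>'"
      using \<theta>(1) unfolding is_arg_max_def by blast
    also have "\<dots> \<le> ereal D"
      using slope_exponent_le_critical_exponent[OF fin] \<delta>D unfolding \<delta>_def by simp
    finally show ?thesis .
  qed

  have support: "msupport (cone_topology Y) (L.\<mu> x) \<subseteq> limit_set X \<Gamma> x0 \<inter> boundary_of_slope X \<theta>s"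
    if x: "x \<in> mspace Y" for x
  proof
    fix \<xi> assume \<xi>: "\<xi> \<in> msupport (cone_topology Y) (L.\<mu> x)"
    have lim: "\<xi> \<in> limit_set X \<Gamma> x0" "\<xi> \<in> geom_boundary Y"
      using L.support_in_closure_of_orbit[OF x] \<xi> unfolding limit_set_def Y_def by auto
    obtain C where C: "\<xi> = Inr C" "Inr C \<in> geom_boundary Y" using geom_boundary_cases[OF lim(2)] by blast
    have "\<xi> \<in> bordification Y" using C by simp
    then obtain c where c: "c \<in> C" "c 0 = x0" using S.ex_reaches[OF _ x0, of \<xi> 0] C(1) by auto
    have ray: "geodesic_ray (product_metric X) c" using geom_boundaryD(2)[OF C(2) c(1)] unfolding Y_def .
    define \<theta> where "\<theta> = (\<chi> i. mdist (X i) (c 0 i) (c 1 i))"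
    have slope: "ray_has_slope X c \<theta>" unfolding \<theta>_def by (rule ray_slope(1)[OF geo CN ray])
    have "\<theta> = \<theta>s"
    proof (rule ccontr)
      assume ne: "\<theta> \<noteq> \<theta>s"
      have "\<theta> \<in> slopes" using slope unfolding ray_has_slope_def by blast
      then have "(INF \<epsilon>\<in>{0<..}. growth_rate (slope_count X \<Gamma> x0 \<theta> \<epsilon>)) < ereal D"
        using exponent_less[OF _ ne] slope_exponent_eq_INF[OF fin] by simp
      then obtain \<epsilon> where \<epsilon>: "\<epsilon> > 0" "growth_rate (slope_count X \<Gamma> x0 \<theta> \<epsilon>) < ereal D"
        by (auto simp: INF_less_iff)
      have "max (growth_rate (slope_count X \<Gamma> x0 \<theta> \<epsilon>)) 0 < ereal D" using \<epsilon>(2) \<open>D > 0\<close> by simp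
      then obtain a where a: "max (growth_rate (slope_count X \<Gamma> x0 \<theta> \<epsilon>)) 0 < ereal a" "ereal a < ereal D"
        using ereal_dense2 by blast
      then have a': "growth_rate (slope_count X \<Gamma> x0 \<theta> \<epsilon>) < ereal a" "0 < a" "a < D" by auto
      define J where "J = {\<gamma>\<in>\<Gamma>. 0 < mdist Y x0 (?z \<gamma>) \<and>
        (\<forall>i. \<bar>mdist (X i) (x0 i) (\<gamma> i (x0 i)) / mdist Y x0 (?z \<gamma>) - \<theta> $ i\<bar> < \<epsilon>)}"
      have count: "slope_count X \<Gamma> x0 \<theta> \<epsilon> n = card {\<gamma>\<in>J. mdist Y x0 (?z \<gamma>) < real n}" for n
        unfolding slope_count_def J_def Y_def by (rule arg_cong[where f = card]) auto
      have "S.weight 1 x0 summable_on J"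
      proof (rule S.weight_summable_on_sparse_part[OF _ a'(2,3)])
        show "J \<subseteq> \<Gamma>" by (auto simp: J_def)
        show "\<forall>\<^sub>F n in sequentially. real (card {\<gamma>\<in>J. mdist Y x0 (?z \<gamma>) < real n}) \<le> exp (a * real n)"
          using growth_rate_less_imp_bound[OF a'(1)] unfolding count .
      qed
      moreover have "{\<gamma>\<in>\<Gamma>. Inl (?z \<gamma>) \<in> cone_nbhd Y c 1 \<epsilon>} \<subseteq> J"
      proof
        fix \<gamma> assume "\<gamma> \<in> {\<gamma>\<in>\<Gamma>. Inl (?z \<gamma>) \<in> cone_nbhd Y c 1 \<epsilon>}"
        then have \<gamma>: "\<gamma> \<in> \<Gamma>" "Inl (?z \<gamma>) \<in> cone_nbhd (product_metric X) c 1 \<epsilon>" by (auto simp: Y_def)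
        note dir = cone_nbhd_direction[OF geo CN ray \<gamma>(2), unfolded c(2)]
        have "0 < mdist Y x0 (?z \<gamma>)" using dir(1) unfolding Y_def by linarith
        moreover have "\<bar>mdist (X i) (x0 i) (\<gamma> i (x0 i)) / mdist Y x0 (?z \<gamma>) - \<theta> $ i\<bar> < \<epsilon>" for i
          using dir(2)[of i] by (simp add: Y_def \<theta>_def c(2) prod_act_def[of \<gamma> x0])
        ultimately show "\<gamma> \<in> J" using \<gamma>(1) by (simp add: J_def)
      qed
      ultimately have "S.weight 1 x0 summable_on {\<gamma>\<in>\<Gamma>. Inl (?z \<gamma>) \<in> cone_nbhd Y c 1 \<epsilon>}"
        by (rule summable_on_subset_banach)
      moreover have "openin (cone_topology Y) (cone_nbhd Y c 1 \<epsilon>)"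
        using S.openin_cone_nbhd[of c 1 \<epsilon>] ray \<epsilon>(1) unfolding Y_def by simp
      moreover have "\<xi> \<in> cone_nbhd Y c 1 \<epsilon>"
        using S.ray_end_in_cone_nbhd[OF C(2) c(1) \<epsilon>(1), of 1] C(1) by simp
      ultimately show False using L.not_in_support[OF x] \<xi> by blast
    qed
    then have "\<xi> \<in> boundary_of_slope X \<theta>s"
      using C c(1) slope unfolding boundary_of_slope_def Y_def by blast
    then show "\<xi> \<in> limit_set X \<Gamma> x0 \<inter> boundary_of_slope X \<theta>s" using lim(1) by blast
  qed

  have equivariant: "distr (L.\<mu>B x) (borel_of (boundary_topology Y)) (bord_act Y (prod_act \<gamma>)) = L.\<mu>B (prod_act \<gamma> x)"
    if \<gamma>: "\<gamma> \<in> \<Gamma>" and x: "x \<in> mspace Y" for \<gamma> x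
  proof (rule L.\<mu>B_equivariant[OF _ _ _ G.bij_left_mult[OF \<gamma>] _ x])
    have i: "inv\<^bsub>G.G\<^esub> \<gamma> \<in> \<Gamma>" by (rule subgroup.m_inv_closed[OF G.subgroup \<gamma>])
    show "isometric_into Y (prod_act \<gamma>)" "isometric_into Y (prod_act (inv\<^bsub>G.G\<^esub> \<gamma>))"
      unfolding Y_def by (rule G.isometric_prod_act[OF \<gamma>], rule G.isometric_prod_act[OF i])
    show "\<And>y. y \<in> mspace Y \<Longrightarrow> prod_act \<gamma> (prod_act (inv\<^bsub>G.G\<^esub> \<gamma>) y) = y"
      unfolding Y_def by (rule G.prod_act_inverse(1)[OF \<gamma>])
    show "\<And>\<beta>. \<beta> \<in> \<Gamma> \<Longrightarrow> prod_act (\<gamma> \<otimes>\<^bsub>G.G\<^esub> \<beta>) x0 = prod_act \<gamma> (prod_act \<beta> x0)"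
      using G.prod_act_mult[OF \<gamma>] x0 unfolding Y_def by blast
  qed
  have "conformal_density X \<Gamma> x0 D L.\<mu>B"
    unfolding conformal_density_def Let_def Y_def[symmetric]
  proof (intro conjI ballI)
    show "0 \<le> D" using \<open>D > 0\<close> by simp
    show "finite_borel_measure (boundary_topology Y) (L.\<mu>B x)" if "x \<in> mspace Y" for x
      by (rule L.finite_borel_\<mu>B[OF that])
    show "msupport (boundary_topology Y) (L.\<mu>B x0) \<subseteq> limit_set X \<Gamma> x0"
      using L.support_\<mu>B[of x0] support[OF x0] by blast
  qed (rule equivariant L.\<mu>B_density; assumption)+
  moreover have "bord_act Y (prod_act \<gamma>) ` (limit_set X \<Gamma> x0 \<inter> boundary_of_slope X \<theta>s)
      = limit_set X \<Gamma> x0 \<inter> boundary_of_slope X \<theta>s" if "\<gamma> \<in> \<Gamma>" for \<gamma>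
    unfolding Y_def using Y x0 by (intro G.limit_points_of_slope_invariant that) (simp_all only: Y_def)
  ultimately show ?thesis
    using L.\<mu>_base L.finite_borel_\<mu> L.weak_convergence support
    unfolding \<nu>_eq D_def[symmetric] L.\<mu>B_def[abs_def]
    by (intro conjI ballI exI[of _ L.\<mu>]) auto
qed

end
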